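(* Let $\alpha\ge2$. There exist constants $0<\epsilon_*\ll R_*\ll1$ with the following property. Let $\psi$ be any solution of the Hill's type lunar problem on its maximal interval $[0,T_{\max})$ satisfying $$E(\psi)<E^*+\epsilon^2,\qquad d_Q(\psi(0))<R$$ for some $\epsilon\in(0,\epsilon_*]$ and $R\in(2\epsilon,R_*]$, and let $$T_{\mathrm{trap}}:=\sup\{t_*\ge0:\ d_Q(\psi(t))<R+R^2\ \ \forall\, t\in[0,t_* )\}.$$ Then: (i) if $T_{\mathrm{trap}}=T_{\max}$, then $\psi$ is trapped at $\pm\tilde Q$ (i.e. $d_Q(\psi(t))<R+R^2$ for all $t\in[0,T_{\max})$) and $T_{\max}=\infty$; (ii) if $T_{\mathrm{trap}}<T_{\max}$ and $\mathfrak S(\psi(T_{\mathrm{trap}}))=-1$, then $\mathfrak S(\psi(t))$ does not change on $[T_{\mathrm{trap}},T_{\max})$, and $d_Q(\psi(t))\ge R+R^2$ for all $T_{\mathrm{trap}}\le t<T_{\max}$. Moreover, the solution has a finite time collision with the origin, i.e. $T_{\max}<\infty$ and $(x(t),y(t))\to(0,0)$ as $t\to T_{\max}$.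
   Context: Hill's type lunar problem: $\ddot x-2\dot y=-V_x$, $\ddot y+2\dot x=-V_y$, with $V(x,y)=-\frac{\alpha+2}{2}x^2-\frac{\alpha+2}{r^\alpha}$, $r=\sqrt{x^2+y^2}$, on $(x,y)\neq(0,0)$. In symplectic coordinates $\psi=(x,y,p_x,p_y)$ with $p_x=\dot x-y$, $p_y=\dot y+x$, it reads $\dot\psi=J\nabla E(\psi)$, where $J=\begin{pmatrix}0&I\\-I&0\end{pmatrix}$ and $E(\psi)=\frac12[(p_x+y)^2+(p_y-x)^2]+V(x,y)$ is the conserved energy. $W=-xV_x-yV_y=(\alpha+2)(x^2-\alpha r^{-\alpha})$. The ground states are the equilibria $\pm\tilde Q=\pm(q_0,0,0,q_0)$, $q_0=\alpha^{1/(\alpha+2)}$, and $E^*=E(\pm\tilde Q)=-\frac12(\alpha+2)^2\alpha^{-\alpha/(\alpha+2)}$. The notation $0<\epsilon_*\ll R_*\ll1$ means $R_*$ is sufficiently small and $\epsilon_*$ is sufficiently small depending on $R_*$. Distance function $d_Q$. Let $\Omega(\xi,\eta)=J\xi\cdot\eta$ and $A=J\nabla^2E(\tilde Q)$ $(=J\nabla^2E(-\tilde Q))$. The eigenvalues of $A$ are $\pm k$ and $\pm i\omega$ with $k,\omega>0$. Let $\xi_\pm$ be eigenvectors for $\pm k$ normalized by $\Omega(\xi_+,\xi_-)=1$ and $|\xi_+|=|\xi_-|$, with the common sign chosen so that $\Omega(Q_0,\xi_+)>0$ for $Q_0=(-q_0,0,0,q_0)$ (equivalently, the $x$-component of $\xi_+$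 is positive). Let $E^c$ be the real invariant plane of $A$ for $\pm i\omega$. For $\sigma\in\{+1,-1\}$ write $\psi=\sigma(\tilde Q+X)$ and $X=\lambda_+\xi_++\lambda_-\xi_-+\gamma$ with $\gamma\in E^c$, and put $\lambda_1=\frac{\lambda_++\lambda_-}2$. Set $|X|_E^2=\frac k2(\lambda_+^2+\lambda_-^2)+\frac12\Omega(\gamma,A\gamma)$ (a norm squared) and $C(\psi)=E(\psi)-E(\tilde Q)+\frac k2(\lambda_++\lambda_-)^2-|X|_E^2$ (which is $O(|X|^3)$). Fix a small constant $\delta_E>0$ such that $|C(\psi)|\le|X|_E^2/10$ whenever $|X|_E\le4\delta_E$, small enough that for $d_Q(\psi)\le\delta_E$ (defined next) the sign $\sigma$ with $d_Q=d_\sigma$ is unique. Let $\chi:\mathbb R\to[0,1]$ be smooth with $\chi(s)=1$ for $|s|\le1$ and $\chi(s)=0$ for $|s|\ge2$. Define $d_\sigma(\psi)=\sqrt{|X|_E^2+\chi(|X|_E/2\delta_E)\,C(\psi)}$ and $d_Q(\psi)=\min(d_+(\psi),d_-(\psi))$. Sign function $\mathfrak S$. For small $\delta>0$ there is $\epsilon(\delta)>0$ such that on the set of $\psi$ with $E(\psi)<E^*+\min(\frac12d_Q(\psi)^2,\epsilon(\delta)^2)$, $\mathfrak S(\psi)\in\{\pm1\}$ is the continuous function given by $\mathfrak S(\psi)=\mathrm{sign}[\lambda_1]$ if $d_Q(\psi)\le\delta_E$ (with $\lambda_1$ computed for the $\sigma$ with $d_Q(\psi)=d_\sigma(\psi)$)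 and $\mathfrak S(\psi)=\mathrm{sign}[W(\psi)]$ if $d_Q(\psi)\ge\delta$, where $\mathrm{sign}[0]=+1$; the two prescriptions agree where both apply. In particular $\mathfrak S=\mathrm{sign}[\lambda_1]$ for $d_Q\le\delta_E$ and $\mathfrak S=\mathrm{sign}[W]$ for $d_Q>\delta_E$. *)

theory Defs
  imports "HOL-Analysis.Analysis"
begin

text \<open>
  Phase points \<open>\<psi> = (x, y, p\<^sub>x, p\<^sub>y)\<close> are vectors in \<open>real ^ 4\<close>.
\<close>

type_synonym phase = "real ^ 4"

definition grad :: "('a::real_inner \<Rightarrow> real) \<Rightarrow> 'a \<Rightarrow> 'a"
  where "grad f x = (THE g. GDERIV f x :> g)"

definition hessian :: "(phase \<Rightarrow> real) \<Rightarrow> phase \<Rightarrow> real ^ 4 ^ 4"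
  where "hessian f x = matrix (frechet_derivative (grad f) (at x))"

definition Jmat :: "real ^ 4 ^ 4"
  where "Jmat = vector [vector [ 0,  0, 1, 0],
                        vector [ 0,  0, 0, 1],
                        vector [-1,  0, 0, 0],
                        vector [ 0, -1, 0, 0]]"

definition Omega :: "phase \<Rightarrow> phase \<Rightarrow> real"
  where "Omega u v = (Jmat *v u) \<bullet> v"


subsection \<open>The Hill type lunar problem\<close>

definition V :: "real \<Rightarrow> real \<Rightarrow> real \<Rightarrow> real"
  where "V \<alpha> x y = - (\<alpha> + 2) / 2 * x\<^sup>2 - (\<alpha> + 2) / sqrt (x\<^sup>2 + y\<^sup>2) powr \<alpha>"

definition phase_space :: "phase set"
  where "phase_space = {\<psi>. (\<psi> $ 1, \<psi> $ 2) \<noteq> (0, 0)}"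

definition energy :: "real \<Rightarrow> phase \<Rightarrow> real"
  where "energy \<alpha> \<psi> =
    ((\<psi> $ 3 + \<psi> $ 2)\<^sup>2 + (\<psi> $ 4 - \<psi> $ 1)\<^sup>2) / 2 + V \<alpha> (\<psi> $ 1) (\<psi> $ 2)"

definition W :: "real \<Rightarrow> phase \<Rightarrow> real"
  where "W \<alpha> \<psi> = (let x = \<psi> $ 1; y = \<psi> $ 2 in
    - x * deriv (\<lambda>s. V \<alpha> s y) x - y * deriv (\<lambda>s. V \<alpha> x s) y)"

definition is_solution :: "real \<Rightarrow> (real \<Rightarrow> phase) \<Rightarrow> ereal \<Rightarrow> bool"
  where "is_solution \<alpha> \<psi> T \<longleftrightarrow>
    0 < T \<and>
    (\<forall>t. 0 \<le> t \<and> ereal t < T \<longrightarrow>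
      \<psi> t \<in> phase_space \<and>
      (\<psi> has_vector_derivative Jmat *v grad (energy \<alpha>) (\<psi> t))
        (at t within {s. 0 \<le> s \<and> ereal s < T}))"

text \<open>Values of \<open>\<psi>\<close> outside \<open>[0, T)\<close> are irrelevant.\<close>

definition is_maximal_solution :: "real \<Rightarrow> (real \<Rightarrow> phase) \<Rightarrow> ereal \<Rightarrow> bool"
  where "is_maximal_solution \<alpha> \<psi> T \<longleftrightarrow>
    is_solution \<alpha> \<psi> T \<and>
    \<not> (\<exists>\<phi> T'. T < T' \<and> is_solution \<alpha> \<phi> T' \<and>
            (\<forall>t. 0 \<le> t \<and> ereal t < T \<longrightarrow> \<phi> t = \<psi> t))"


subsection \<open>Ground states and the linearization\<close>

definition q0 :: "real \<Rightarrow> real"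
  where "q0 \<alpha> = \<alpha> powr (1 / (\<alpha> + 2))"

definition ground :: "real \<Rightarrow> phase"
  where "ground \<alpha> = vector [q0 \<alpha>, 0, 0, q0 \<alpha>]"

definition Q0 :: "real \<Rightarrow> phase"
  where "Q0 \<alpha> = vector [- q0 \<alpha>, 0, 0, q0 \<alpha>]"

definition E_star :: "real \<Rightarrow> real"
  where "E_star \<alpha> = energy \<alpha> (ground \<alpha>)"

definition linop :: "real \<Rightarrow> real ^ 4 ^ 4"
  where "linop \<alpha> = Jmat ** hessian (energy \<alpha>) (ground \<alpha>)"

definition cvec :: "real ^ 'n \<Rightarrow> complex ^ 'n"
  where "cvec v = (\<chi> i. complex_of_real (v $ i))"

definition cmat :: "real ^ 'n ^ 'm \<Rightarrow> complex ^ 'n ^ 'm"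
  where "cmat M = (\<chi> i j. complex_of_real (M $ i $ j))"

definition eigenspace :: "real ^ 'n ^ 'n \<Rightarrow> complex \<Rightarrow> (complex ^ 'n) set"
  where "eigenspace M z = {v. cmat M *v v = z *s v}"

definition eigenvalues :: "real ^ 'n ^ 'n \<Rightarrow> complex set"
  where "eigenvalues M = {z. \<exists>v \<in> eigenspace M z. v \<noteq> 0}"

record frame =
  rate :: real
  freq :: real
  xi_plus :: phase
  xi_minus :: phase

text \<open>
  The conditions below determine all four components uniquely: the normalizations
  leave only a common sign of \<open>\<xi>\<^sub>+, \<xi>\<^sub>-\<close>, which the last condition fixes.
\<close>

definition is_frame :: "real \<Rightarrow> frame \<Rightarrow> bool"
  where "is_frame \<alpha> F \<longleftrightarrow>
    0 < rate F \<and> 0 < freq F \<and>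
    eigenvalues (linop \<alpha>) =
      {complex_of_real (rate F), - complex_of_real (rate F),
       \<i> * complex_of_real (freq F), - \<i> * complex_of_real (freq F)} \<and>
    linop \<alpha> *v xi_plus F = rate F *\<^sub>R xi_plus F \<and>
    linop \<alpha> *v xi_minus F = - rate F *\<^sub>R xi_minus F \<and>
    Omega (xi_plus F) (xi_minus F) = 1 \<and>
    norm (xi_plus F) = norm (xi_minus F) \<and>
    0 < Omega (Q0 \<alpha>) (xi_plus F)"

text \<open>
  The real invariant plane for \<open>\<plusminus> i \<omega>\<close>: the real points of the sum of the two complex
  eigenspaces.
\<close>

definition center_plane :: "real \<Rightarrow> frame \<Rightarrow> phase set"
  where "center_plane \<alpha> F = {\<gamma>.
    \<exists>u \<in> eigenspace (linop \<alpha>) (\<i> * complex_of_real (freq F)).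
    \<exists>w \<in> eigenspace (linop \<alpha>) (- \<i> * complex_of_real (freq F)). cvec \<gamma> = u + w}"

definition coords :: "real \<Rightarrow> frame \<Rightarrow> phase \<Rightarrow> real \<times> real \<times> phase"
  where "coords \<alpha> F X = (THE (a, b, \<gamma>). \<gamma> \<in> center_plane \<alpha> F \<and>
    X = a *\<^sub>R xi_plus F + b *\<^sub>R xi_minus F + \<gamma>)"

definition lam_plus :: "real \<Rightarrow> frame \<Rightarrow> phase \<Rightarrow> real"
  where "lam_plus \<alpha> F X = fst (coords \<alpha> F X)"

definition lam_minus :: "real \<Rightarrow> frame \<Rightarrow> phase \<Rightarrow> real"
  where "lam_minus \<alpha> F X = fst (snd (coords \<alpha> F X))"

definition center_part :: "real \<Rightarrow> frame \<Rightarrow> phase \<Rightarrow> phase"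
  where "center_part \<alpha> F X = snd (snd (coords \<alpha> F X))"

definition lam1 :: "real \<Rightarrow> frame \<Rightarrow> phase \<Rightarrow> real"
  where "lam1 \<alpha> F X = (lam_plus \<alpha> F X + lam_minus \<alpha> F X) / 2"

definition normE_sq :: "real \<Rightarrow> frame \<Rightarrow> phase \<Rightarrow> real"
  where "normE_sq \<alpha> F X =
    rate F / 2 * ((lam_plus \<alpha> F X)\<^sup>2 + (lam_minus \<alpha> F X)\<^sup>2) +
    Omega (center_part \<alpha> F X) (linop \<alpha> *v center_part \<alpha> F X) / 2"

definition normE :: "real \<Rightarrow> frame \<Rightarrow> phase \<Rightarrow> real"
  where "normE \<alpha> F X = sqrt (normE_sq \<alpha> F X)"


subsection \<open>The distance function\<close>

text \<open>The sign \<open>\<sigma>\<close> ranges over \<open>{1, -1}\<close>, so \<open>\<psi> = \<sigma> (Q + X)\<close> means \<open>X = \<sigma> \<psi> - Q\<close>.\<close>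

definition displacement :: "real \<Rightarrow> real \<Rightarrow> phase \<Rightarrow> phase"
  where "displacement \<alpha> \<sigma> \<psi> = \<sigma> *\<^sub>R \<psi> - ground \<alpha>"

definition remainder :: "real \<Rightarrow> frame \<Rightarrow> real \<Rightarrow> phase \<Rightarrow> real"
  where "remainder \<alpha> F \<sigma> \<psi> = (let X = displacement \<alpha> \<sigma> \<psi> in
    energy \<alpha> \<psi> - energy \<alpha> (ground \<alpha>)
      + rate F / 2 * (lam_plus \<alpha> F X + lam_minus \<alpha> F X)\<^sup>2 - normE_sq \<alpha> F X)"

definition is_cutoff :: "(real \<Rightarrow> real) \<Rightarrow> bool"
  where "is_cutoff chi \<longleftrightarrow>
    (\<forall>n s. (deriv ^^ n) chi field_differentiable at s) \<and>
    (\<forall>s. 0 \<le> chi s \<and> chi s \<le> 1) \<and>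
    (\<forall>s. \<bar>s\<bar> \<le> 1 \<longrightarrow> chi s = 1) \<and>
    (\<forall>s. \<bar>s\<bar> \<ge> 2 \<longrightarrow> chi s = 0)"

definition d_sigma ::
  "real \<Rightarrow> frame \<Rightarrow> (real \<Rightarrow> real) \<Rightarrow> real \<Rightarrow> real \<Rightarrow> phase \<Rightarrow> real"
  where "d_sigma \<alpha> F chi \<delta> \<sigma> \<psi> = (let X = displacement \<alpha> \<sigma> \<psi> in
    sqrt (normE_sq \<alpha> F X + chi (normE \<alpha> F X / (2 * \<delta>)) * remainder \<alpha> F \<sigma> \<psi>))"

definition d_Q :: "real \<Rightarrow> frame \<Rightarrow> (real \<Rightarrow> real) \<Rightarrow> real \<Rightarrow> phase \<Rightarrow> real"
  where "d_Q \<alpha> F chi \<delta> \<psi> = min (d_sigma \<alpha> F chi \<delta> 1 \<psi>) (d_sigma \<alpha> F chi \<delta> (-1) \<psi>)"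

definition is_nearest_sign ::
  "real \<Rightarrow> frame \<Rightarrow> (real \<Rightarrow> real) \<Rightarrow> real \<Rightarrow> phase \<Rightarrow> real \<Rightarrow> bool"
  where "is_nearest_sign \<alpha> F chi \<delta> \<psi> \<sigma> \<longleftrightarrow>
    \<sigma> \<in> {1, -1} \<and> d_Q \<alpha> F chi \<delta> \<psi> = d_sigma \<alpha> F chi \<delta> \<sigma> \<psi>"

definition is_delta_E :: "real \<Rightarrow> frame \<Rightarrow> (real \<Rightarrow> real) \<Rightarrow> real \<Rightarrow> bool"
  where "is_delta_E \<alpha> F chi \<delta> \<longleftrightarrow>
    0 < \<delta> \<and>
    (\<forall>\<sigma> \<in> {1, -1}. \<forall>\<psi> \<in> phase_space.
      normE \<alpha> F (displacement \<alpha> \<sigma> \<psi>) \<le> 4 * \<delta> \<longrightarrow>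
      \<bar>remainder \<alpha> F \<sigma> \<psi>\<bar> \<le> normE_sq \<alpha> F (displacement \<alpha> \<sigma> \<psi>) / 10) \<and>
    (\<forall>\<psi> \<in> phase_space. d_Q \<alpha> F chi \<delta> \<psi> \<le> \<delta> \<longrightarrow>
      (\<exists>!\<sigma>. is_nearest_sign \<alpha> F chi \<delta> \<psi> \<sigma>))"


subsection \<open>The sign function\<close>

text \<open>Unlike \<^const>\<open>sgn\<close>, this sign is \<open>1\<close> at \<open>0\<close>.\<close>

definition sign0 :: "real \<Rightarrow> real"
  where "sign0 s = (if s < 0 then -1 else 1)"

text \<open>
  A total function; it is continuous with values in \<open>{1, -1}\<close> where
  \<open>E(\<psi>) < E* + min (d\<^sub>Q(\<psi>)\<^sup>2 / 2) (\<epsilon>(\<delta>)\<^sup>2)\<close>, and there it also equals \<open>sign0 (W(\<psi>))\<close> for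
  \<open>\<delta> \<le> d\<^sub>Q(\<psi>) \<le> \<delta>\<^sub>E\<close>. It is only used in that region.
\<close>

definition sign_fun :: "real \<Rightarrow> frame \<Rightarrow> (real \<Rightarrow> real) \<Rightarrow> real \<Rightarrow> phase \<Rightarrow> real"
  where "sign_fun \<alpha> F chi \<delta>E \<psi> =
    (if d_Q \<alpha> F chi \<delta>E \<psi> \<le> \<delta>E
     then sign0 (lam1 \<alpha> F (displacement \<alpha> (THE \<sigma>. is_nearest_sign \<alpha> F chi \<delta>E \<psi> \<sigma>) \<psi>))
     else sign0 (W \<alpha> \<psi>))"


subsection \<open>The trapping time\<close>

definition T_trap :: "(phase \<Rightarrow> real) \<Rightarrow> real \<Rightarrow> (real \<Rightarrow> phase) \<Rightarrow> ereal \<Rightarrow> ereal"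
  where "T_trap d R \<psi> T = Sup {ereal t' |t'. 0 \<le> t' \<and> ereal t' \<le> T \<and>
    (\<forall>t. 0 \<le> t \<and> t < t' \<longrightarrow> d (\<psi> t) < R + R\<^sup>2)}"

end

theory Submission
  imports Defs
begin

text \<open>
  Near a ground state, energy conservation gives \<open>d\<^sub>Q\<^sup>2 = E - E\<^sup>* + 2 k \<lambda>\<^sub>1\<^sup>2\<close>. Hence \<open>\<lambda>\<^sub>1\<close> keeps its sign
  as long as \<open>d\<^sub>Q > \<epsilon>\<close>, and \<open>d\<^sub>Q\<^sup>2\<close> is convex in time there: a solution leaving the small neighbourhood
  is ejected to a fixed distance. If \<open>\<lambda>\<^sub>1 < 0\<close> on exit, the ejection takes place inside the disc
  \<open>r < q\<^sub>0\<close>. The second time derivative of \<open>r\<^sup>2 / 2\<close> is \<open>|v|\<^sup>2 + 2 (x v\<^sub>y - y v\<^sub>x) + W\<close>, and for \<open>\<alpha> \<ge> 2\<close> this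
  is nonpositive in the disc away from the ground states, because the energy bound controls \<open>|v|\<close>
  and thus the Coriolis term. The time derivative of \<open>r\<^sup>2 / 2\<close>, which is below a fixed negative number
  after the ejection, therefore stays there; this excludes a return to the ground states, where it is
  small, and forces \<open>r\<^sup>2\<close> to reach zero in finite time. A solution of finite lifetime has to leave every
  compact subset of phase space, so a trapped solution is global and an ejected one ends in a collision.
\<close>

subsection \<open>Taylor bounds and local solvability\<close>

text \<open>The obstacle is the shell
  \<open>2 * \<epsilon> \<le> D \<phi> \<le> M * \<epsilon>\<close>: there
  \<open>\<lambda>\<^sub>1\<close> already has a sign, but the energy slack may outweigh the virial,
  whose sign is therefore unknown. Along the flow the second derivative of
  \<open>\<lambda>\<^sub>1\<close> is \<open>k\<^sup>2 * \<lambda>\<^sub>1\<close> up to a quadratic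
  error, so after an exit \<open>\<lambda>\<^sub>1\<close> grows at least quadratically in time and
  the shell is passed within a time independent of \<epsilon>; meanwhile \<open>virial\<close> is
  O(\<epsilon>). Beyond the shell \<open>virial\<close> is below a negative multiple of the
  distance, which also bounds the derivative of \<open>\<lambda>\<^sub>1\<close>. Hence a suitable
  combination \<open>radial - c3 * lamQ\<close> does not increase, and the negative sign of
  \<open>\<lambda>\<^sub>1\<close> passes to \<open>radial\<close>; the loss is proportional to the
  exit level and is beaten at the fixed distance \<open>dX\<close>. The virial inequality uses
  \<alpha> \<ge> 2 twice: as 2 / \<alpha> \<le> 1, and as sqrt m \<le> m / 2 with m = \<alpha> + 2.
  The reflection of \<psi> to -\<psi> preserves the flow and all quantities involved, so the local
  analysis is done at one ground state. Maximality only says that no extension exists, so local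
  existence and continuation are proved for this field.\<close>

lemma powr_neg_taylor2:
  fixes a :: real
  assumes "a > 0"
  obtains C where "C > 0"
    "\<And>p. 1/2 \<le> p \<Longrightarrow> p \<le> 3/2 \<Longrightarrow> \<bar>p powr (-a) - 1 - a * (1 - p)\<bar> \<le> C * (1 - p)\<^sup>2"
proof
  let ?C = "a * (a + 1) * (1/2) powr (-a-2)"
  show "?C > 0" using assms by auto
  fix p :: real assume p: "1/2 \<le> p" "p \<le> 3/2"
  define g where "g = (\<lambda>n::nat. if n = 0 then (\<lambda>t::real. t powr (-a)) else if n = 1 then (\<lambda>t. (-a) * t powr (-a-1)) else (\<lambda>t. a*(a+1) * t powr (-a-2)))"
  show "\<bar>p powr (-a) - 1 - a * (1 - p)\<bar> \<le> ?C * (1 - p)\<^sup>2"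
  proof (cases "p = 1")
    case False
    have "\<exists>t. (if p<1 then p < t \<and> t < 1 else 1 < t \<and> t < p) \<and> g 0 p = (\<Sum>n<2. g n 1 / fact n * (p - 1) ^ n) + g 2 t / fact 2 * (p - 1) ^ 2"
    proof (rule Taylor[of 2 g "g 0" "1/2" "3/2" 1 p])
      show "\<forall>n t. n < 2 \<and> 1/2 \<le> t \<and> t \<le> 3/2 \<longrightarrow> DERIV (g n) t :> g (Suc n) t"
      proof (intro allI impI)
        fix n :: nat and t :: real assume *: "n < 2 \<and> 1/2 \<le> t \<and> t \<le> 3/2"
        then have t: "t > 0" by linarith
        consider "n = 0" | "n = 1" using * by linarith
        then show "DERIV (g n) t :> g (Suc n) t"
        proof cases
          case 1
          show ?thesis unfolding 1 g_def using t
            by (auto intro!: derivative_eq_intros simp: algebra_simps)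
        next
          case 2
          show ?thesis unfolding 2 g_def using t
            by (auto intro!: derivative_eq_intros simp: algebra_simps)
        qed
      qed
    qed (use p False in auto)
    then obtain t where t: "if p<1 then p < t \<and> t < 1 else 1 < t \<and> t < p"
      and eq: "g 0 p = (\<Sum>n<2. g n 1 / fact n * (p - 1) ^ n) + g 2 t / fact 2 * (p - 1) ^ 2" by blast
    have t2: "t \<ge> 1/2" using t p by (auto split: if_splits)
    have "p powr (-a) - 1 - a * (1 - p) = a*(a+1) * t powr (-a-2) / 2 * (p-1)\<^sup>2"
      using eq by (simp add: g_def numeral_2_eq_2 algebra_simps)
    moreover have "t powr (-a-2) \<le> (1/2) powr (-a-2)"
      using t2 assms by (intro powr_mono2') auto
    then have "a*(a+1) * t powr (-a-2) \<le> a*(a+1) * (1/2) powr (-a-2)"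
      using assms by (intro mult_left_mono) auto
    moreover have "0 \<le> a*(a+1) * t powr (-a-2)" using assms by auto
    ultimately have "\<bar>p powr (-a) - 1 - a * (1 - p)\<bar> = (a*(a+1) * t powr (-a-2) / 2) * (p-1)\<^sup>2"
      by (metis abs_of_nonneg divide_nonneg_nonneg mult_nonneg_nonneg zero_le_numeral zero_le_power2)
    also have "\<dots> \<le> ?C * (p-1)\<^sup>2"
      using \<open>a*(a+1) * t powr (-a-2) \<le> _\<close> \<open>0 \<le> a*(a+1) * t powr (-a-2)\<close>
      by (intro mult_right_mono) auto
    finally show ?thesis by (simp add: power2_commute)
  qed auto
qed

text \<open>Convexity of \<open>p powr (-b)\<close>: the tangent at \<open>p\<close> lies below the
  graph at 1. The slope is taken at \<open>p\<close> rather than at 1 because the virial estimate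
  needs a bound proportional to \<open>Zed\<close>. The proof is Bernoulli's inequality for
  \<open>p powr b\<close>, from ln p \<ge> 1 - 1/p.\<close>

lemma powr_convex_tangent:
  fixes b p :: real
  assumes "0 \<le> b" "0 < p"
  shows "p powr (-b) - 1 \<le> b * p powr (-b-1) * (1 - p)"
proof -
  have "1 - 1/p \<le> ln p" using ln_le_minus_one[of "1/p"] assms by (simp add: ln_div)
  then have "1 + b * (1 - 1/p) \<le> 1 + b * ln p" using assms by (intro add_left_mono mult_left_mono)
  also have "\<dots> \<le> exp (b * ln p)" by (rule exp_ge_add_one_self)
  also have "\<dots> = p powr b" using assms by (simp add: powr_def)
  finally have "(1 + b * (1 - 1/p)) * p powr (-b) \<le> p powr b * p powr (-b)"
    by (rule mult_right_mono) auto
  also have "\<dots> = 1" using assms by (simp add: powr_add[symmetric])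
  finally have "p powr (-b) - 1 \<le> b * (1/p - 1) * p powr (-b)" by (simp add: algebra_simps)
  also have "\<dots> = b * p powr (-b-1) * (1 - p)" using assms by (simp add: powr_diff field_simps)
  finally show ?thesis .
qed

text \<open>Picard iteration on the complete space of bounded continuous functions on the whole
  line. Two devices make this possible: the field is composed with the closest-point projection onto
  the ball, hence globally Lipschitz and bounded, and time is clamped to [0, h]. The fixed point
  stays in the ball, where the projection is the identity.\<close>

lemma local_solution_exists:
  fixes f :: "'a::euclidean_space \<Rightarrow> 'a"
  assumes r: "r > 0" and lip: "L-lipschitz_on (cball x0 r) f"
  obtains h \<phi> where "h > 0" "\<phi> 0 = x0" "\<And>t. 0 \<le> t \<Longrightarrow> t \<le> h \<Longrightarrow> \<phi> t \<in> cball x0 r"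
    "\<And>t. 0 \<le> t \<Longrightarrow> t \<le> h \<Longrightarrow> (\<phi> has_vector_derivative f (\<phi> t)) (at t within {0..h})"
proof -
  define K where "K = cball x0 r"
  have K: "convex K" "closed K" "K \<noteq> {}" "compact K" using r by (simp_all add: K_def)
  define P where "P = closest_point K"
  define G where "G = f \<circ> P"
  have PK: "P z \<in> K" for z unfolding P_def using K by (intro closest_point_in_set) auto
  have L0: "L \<ge> 0" using lip by (rule lipschitz_on_nonneg)
  have Glip: "norm (G a - G b) \<le> L * norm (a - b)" for a b
  proof -
    have "dist (G a) (G b) \<le> L * dist (P a) (P b)" unfolding G_def o_def
      using lipschitz_onD[OF lip] PK by (auto simp: K_def)
    also have "\<dots> \<le> L * dist a b" unfolding P_def 
      by (intro mult_left_mono closest_point_lipschitz K L0)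
    finally show ?thesis by (simp add: dist_norm)
  qed
  then have "L-lipschitz_on UNIV G" using L0 by (auto simp: lipschitz_on_def dist_norm)
  then have Gcont: "continuous_on UNIV G" by (rule lipschitz_on_continuous_on)
  have "compact (f ` K)" unfolding K_def
    by (rule compact_continuous_image[OF lipschitz_on_continuous_on[OF lip] compact_cball])
  then obtain B where B: "B > 0" "\<And>z. z \<in> K \<Longrightarrow> norm (f z) \<le> B"
    using compact_imp_bounded[of "f ` K"] unfolding bounded_pos by blast
  have GB: "norm (G z) \<le> B" for z using B(2)[OF PK] by (simp add: G_def)
  \<comment> \<open>The first bound keeps the iterates within distance \<open>r\<close> of
    \<open>x0\<close>; the second makes the map a contraction with factor 1/2.\<close>
  define h where "h = min (r / B) (1 / (2 * (L + 1)))"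
  have h: "h > 0" "h * B \<le> r" "h * L \<le> 1/2"
  proof -
    show "h > 0" using r B L0 by (simp add: h_def)
    have "h * B \<le> (r/B) * B" using B by (intro mult_right_mono) (auto simp: h_def)
    then show "h * B \<le> r" using B by simp
    have "h * (L+1) \<le> (1 / (2 * (L + 1))) * (L+1)" using L0 by (intro mult_right_mono) (auto simp: h_def)
    also have "\<dots> = 1/2" using L0 by (simp add: field_simps)
    finally show "h * L \<le> 1/2" using \<open>h > 0\<close> by (simp add: algebra_simps)
  qed
  define cl where "cl = (\<lambda>t::real. max 0 (min h t))"
  have cl: "0 \<le> cl t" "cl t \<le> h" for t using h by (auto simp: cl_def)
  define Tg where "Tg = (\<lambda>g::real \<Rightarrow>\<^sub>C 'a. \<lambda>t. x0 + integral {0..cl t} (\<lambda>s. G (apply_bcontfun g s)))"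
  have gcont: "continuous_on S (\<lambda>s. G (apply_bcontfun g s))" for S and g :: "real \<Rightarrow>\<^sub>C 'a"
    using continuous_on_compose2[OF Gcont, of S "apply_bcontfun g"]
    by (simp add: continuous_on_apply_bcontfun)
  have int: "(\<lambda>s. G (apply_bcontfun g s)) integrable_on {0..c}" for g :: "real \<Rightarrow>\<^sub>C 'a" and c
    by (rule integrable_continuous_interval[OF gcont])
  have bnd: "norm (integral {0..cl t} (\<lambda>s. G (apply_bcontfun g s))) \<le> r" for g t
  proof -
    have "norm (integral {0..cl t} (\<lambda>s. G (apply_bcontfun g s))) \<le> B * (cl t - 0)"
      using cl by (intro integral_bound[OF _ gcont]) (auto simp: GB)
    also have "\<dots> \<le> B * h" using cl B by (intro mult_left_mono) auto
    finally show ?thesis using h by (simp add: mult.commute)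
  qed
  have Tgb: "Tg g \<in> bcontfun" for g
  proof (rule bcontfun_normI)
    have "continuous_on {0..h} (\<lambda>t. integral {0..t} (\<lambda>s. G (apply_bcontfun g s)))"
      by (rule indefinite_integral_continuous_1[OF int])
    then have "continuous_on UNIV (\<lambda>t. integral {0..cl t} (\<lambda>s. G (apply_bcontfun g s)))"
      by (rule continuous_on_compose2) (auto simp: cl_def intro!: continuous_intros, use h in auto)
    then show "continuous_on UNIV (Tg g)" unfolding Tg_def by (intro continuous_intros)
    fix t
    have "norm (Tg g t) \<le> norm x0 + norm (integral {0..cl t} (\<lambda>s. G (apply_bcontfun g s)))"
      unfolding Tg_def by (rule norm_triangle_ineq)
    then show "norm (Tg g t) \<le> norm x0 + r" using bnd[of t g] by simp
  qed
  define TT where "TT = (\<lambda>g. Bcontfun (Tg g))"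
  have TT: "apply_bcontfun (TT g) = Tg g" for g unfolding TT_def by (rule Bcontfun_inverse[OF Tgb])
  have contr: "dist (TT g) (TT g') \<le> 1/2 * dist g g'" for g g'
  proof (rule dist_bound)
    fix t
    have "dist (TT g t) (TT g' t) = norm (integral {0..cl t} (\<lambda>s. G (apply_bcontfun g s) - G (apply_bcontfun g' s)))"
      unfolding TT Tg_def dist_norm by (simp add: integral_diff[OF int int])
    also have "\<dots> \<le> (L * dist g g') * (cl t - 0)"
    proof (rule integral_bound)
      show "continuous_on {0..cl t} (\<lambda>s. G (apply_bcontfun g s) - G (apply_bcontfun g' s))"
        by (intro continuous_intros gcont)
      fix s
      have "norm (apply_bcontfun g s - apply_bcontfun g' s) \<le> dist g g'"
        using dist_bounded[of g s g'] by (simp add: dist_norm)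
      then show "norm (G (apply_bcontfun g s) - G (apply_bcontfun g' s)) \<le> L * dist g g'"
        using Glip[of "apply_bcontfun g s" "apply_bcontfun g' s"] L0 
        by (meson mult_left_mono order_trans)
    qed (use cl in auto)
    also have "\<dots> \<le> (L * dist g g') * h" using cl L0 by (intro mult_left_mono) auto
    also have "\<dots> = (h * L) * dist g g'" by simp
    also have "\<dots> \<le> 1/2 * dist g g'" using h by (intro mult_right_mono) auto
    finally show "dist (TT g t) (TT g' t) \<le> 1/2 * dist g g'" .
  qed
  have "\<exists>!g. TT g = g"
    using contr by (intro banach_fix_type[of "1/2" TT]) auto
  then obtain g where g: "TT g = g" by blast
  define \<phi> where "\<phi> = apply_bcontfun g"
  have \<phi>: "\<phi> t = x0 + integral {0..cl t} (\<lambda>s. G (\<phi> s))" for t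
    using fun_cong[OF TT[of g], of t] by (simp add: g Tg_def \<phi>_def)
  have inK: "\<phi> t \<in> K" for t
    using bnd[of t g] by (subst \<phi>) (simp add: K_def dist_norm \<phi>_def)
  have GF: "G (\<phi> t) = f (\<phi> t)" for t using inK by (simp add: G_def P_def closest_point_self)
  have der: "(\<phi> has_vector_derivative f (\<phi> t)) (at t within {0..h})" if "0 \<le> t" "t \<le> h" for t
  proof -
    have "((\<lambda>u. x0 + integral {0..u} (\<lambda>s. G (\<phi> s))) has_vector_derivative (0 + G (\<phi> t))) (at t within {0..h})"
      unfolding \<phi>_def using that
      by (intro has_vector_derivative_add has_vector_derivative_const integral_has_vector_derivative gcont) auto
    then have "((\<lambda>u. x0 + integral {0..u} (\<lambda>s. G (\<phi> s))) has_vector_derivative f (\<phi> t)) (at t within {0..h})" 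
      by (simp add: GF)
    then show ?thesis
    proof (rule has_vector_derivative_transform[rotated 2])
      show "t \<in> {0..h}" using that by simp
      show "\<phi> u = x0 + integral {0..u} (\<lambda>s. G (\<phi> s))" if "u \<in> {0..h}" for u
        using that \<phi>[of u] by (simp add: cl_def)
    qed
  qed
  have "\<phi> 0 = x0" using \<phi>[of 0] h by (simp add: cl_def)
  then show thesis using that[of h \<phi>] h inK der by (auto simp: K_def)
qed

text \<open>The field is bounded on \<open>K\<close>, so \<psi> is Lipschitz in time and has a limit
  \<open>z\<close> in \<open>K\<close> at \<open>T\<close>; a local solution starting at
  \<open>z\<close> is glued on.\<close>

lemma solution_extends:
  fixes f :: "'a::euclidean_space \<Rightarrow> 'a" and \<psi> :: "real \<Rightarrow> 'a"
  assumes t1: "0 \<le> t1" "t1 < T" and K: "compact K"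
    and inK: "\<And>t. t1 \<le> t \<Longrightarrow> t < T \<Longrightarrow> \<psi> t \<in> K"
    and der: "\<And>t. 0 \<le> t \<Longrightarrow> t < T \<Longrightarrow> (\<psi> has_vector_derivative f (\<psi> t)) (at t within {0..<T})"
    and lip: "\<And>z. z \<in> K \<Longrightarrow> \<exists>r>0. \<exists>L. cball z r \<subseteq> U \<and> L-lipschitz_on (cball z r) f"
  obtains h \<phi> where "h > 0" "\<And>t. t < T \<Longrightarrow> \<phi> t = \<psi> t"
    "\<And>t. T \<le> t \<Longrightarrow> t < T + h \<Longrightarrow> \<phi> t \<in> U"
    "\<And>t. 0 \<le> t \<Longrightarrow> t < T + h \<Longrightarrow> (\<phi> has_vector_derivative f (\<phi> t)) (at t within {0..<T + h})"
proof -
  have fcont: "continuous (at z) f" if "z \<in> K" for z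
  proof -
    from lip[OF that] obtain r L where r: "r > 0" "L-lipschitz_on (cball z r) f" by blast
    then have "continuous_on (cball z r) f" by (intro lipschitz_on_continuous_on)
    then show ?thesis using r by (intro continuous_on_interior[of "cball z r"]) auto
  qed
  then have "continuous_on K f" by (intro continuous_at_imp_continuous_on) auto
  then have "bounded (f ` K)" using K by (intro compact_imp_bounded compact_continuous_image)
  then obtain B where B: "\<And>z. z \<in> K \<Longrightarrow> norm (f z) \<le> B" "B > 0"
    unfolding bounded_pos by blast
  have "norm (\<psi> a - \<psi> b) \<le> B * norm (a - b)" if "a \<in> {t1..<T}" "b \<in> {t1..<T}" for a b
  proof (rule differentiable_bound[of "{t1..<T}" \<psi> "\<lambda>t h. h *\<^sub>R f (\<psi> t)"])
    fix t assume t: "t \<in> {t1..<T}"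
    then have "(\<psi> has_vector_derivative f (\<psi> t)) (at t within {t1..<T})"
      using t1 by (intro has_vector_derivative_within_subset[OF der]) auto
    then show "(\<psi> has_derivative (\<lambda>h. h *\<^sub>R f (\<psi> t))) (at t within {t1..<T})"
      by (simp add: has_vector_derivative_def)
    show "onorm (\<lambda>h. h *\<^sub>R f (\<psi> t)) \<le> B"
    proof (rule onorm_bound)
      fix h :: real
      show "norm (h *\<^sub>R f (\<psi> t)) \<le> B * norm h" 
        using mult_left_mono[OF B(1)[OF inK[of t]], of "norm h"] t by (simp add: mult.commute)
    qed (use B in auto)
  qed (use that in auto)
  then have "B-lipschitz_on {t1..<T} \<psi>" using B by (auto simp: lipschitz_on_def dist_norm)
  then have "uniformly_continuous_on {t1..<T} \<psi>" by (rule lipschitz_on_uniformly_continuous)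
  moreover have "T \<in> closure {t1..<T}" using t1 by (simp add: closure_atLeastLessThan)
  ultimately obtain z where z: "(\<psi> \<longlongrightarrow> z) (at T within {t1..<T})"
    using uniformly_continuous_on_extension_at_closure by blast
  have nb: "at T within {t1..<T} \<noteq> bot" using \<open>T \<in> closure _\<close> by (simp add: at_within_eq_bot_iff)
  have zK: "z \<in> K"
    by (rule Lim_in_closed_set[OF compact_imp_closed[OF K] _ nb z])
      (auto simp: eventually_at_filter inK)
  define \<psi>b where "\<psi>b = (\<lambda>t. if t < T then \<psi> t else z)"
  have psib: "\<psi>b t = \<psi> t" if "t < T" for t using that by (simp add: \<psi>b_def)
  have psiT: "\<psi>b T = z" by (simp add: \<psi>b_def)
  have bK: "\<psi>b t \<in> K" if "t1 \<le> t" "t \<le> T" for t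
    using that zK inK by (auto simp: \<psi>b_def)
  have contb: "continuous_on {t1..T} \<psi>b"
    unfolding continuous_on_eq_continuous_within
  proof
    fix t assume t: "t \<in> {t1..T}"
    show "continuous (at t within {t1..T}) \<psi>b"
    proof (cases "t = T")
      case True
      have "(\<psi>b \<longlongrightarrow> z) (at T within {t1..<T})"
        by (rule Lim_transform_within[OF z, of 1]) (auto simp: psib)
      moreover have "at T within {t1..<T} = at T within {t1..T}"
        by (rule at_within_nhd[of T UNIV]) (auto)
      ultimately show ?thesis unfolding True continuous_within psiT by simp
    next
      case False
      then have "t < T" using t by auto
      have "continuous (at t within {t1..<T}) \<psi>"
        using has_vector_derivative_continuous[OF der[of t]] t t1 \<open>t < T\<close>
        by (rule_tac continuous_within_subset[of t "{0..<T}"]) auto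
      then have "(\<psi> \<longlongrightarrow> \<psi> t) (at t within {t1..<T})" by (simp add: continuous_within)
      then have "(\<psi>b \<longlongrightarrow> \<psi>b t) (at t within {t1..<T})"
        unfolding psib[OF \<open>t < T\<close>] by (rule Lim_transform_within[of _ _ _ _ 1]) (auto simp: psib)
      moreover have "at t within {t1..<T} = at t within {t1..T}"
        using \<open>t < T\<close> by (intro at_within_nhd[of t "{..<T}"]) auto
      ultimately show ?thesis unfolding continuous_within by simp
    qed
  qed
  have contf: "continuous_on {t1..T} (\<lambda>t. f (\<psi>b t))"
    by (rule continuous_on_compose2[OF \<open>continuous_on K f\<close> contb]) (auto intro: bK)
  have inner: "(\<psi>b has_vector_derivative f (\<psi>b t)) (at t within {0..T})" if "0 \<le> t" "t < T" for t
  proof -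
    have "(\<psi>b has_vector_derivative f (\<psi>b t)) (at t within {0..<T})"
      unfolding psib[OF that(2)]
      by (rule has_vector_derivative_transform[OF _ _ der[OF that]]) (use that in \<open>auto simp: psib\<close>)
    moreover have "at t within {0..<T} = at t within {0..T}"
      using that by (intro at_within_nhd[of t "{..<T}"]) auto
    ultimately show ?thesis by simp
  qed
  have intg: "((\<lambda>s. f (\<psi>b s)) has_integral (\<psi>b u - \<psi>b t1)) {t1..u}" if "t1 \<le> u" "u \<le> T" for u
  proof (rule fundamental_theorem_of_calculus_interior)
    show "continuous_on {t1..u} \<psi>b" using contb that by (rule_tac continuous_on_subset) auto
    fix t assume t: "t \<in> {t1<..<u}"
    have "(\<psi>b has_vector_derivative f (\<psi>b t)) (at t within {0..T})" using inner t that t1 by auto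
    moreover have "at t within {0..T} = at t"
      using t that t1 by (intro at_within_interior) auto
    ultimately show "(\<psi>b has_vector_derivative f (\<psi>b t)) (at t)" by simp
  qed (use that in auto)
  \<comment> \<open>At the added endpoint no derivative is given. It comes from differentiating the
    integral identity, whose integrand is continuous up to \<open>T\<close>.\<close>
  have derT: "(\<psi>b has_vector_derivative f z) (at T within {0..T})"
  proof -
    have "((\<lambda>u. \<psi>b t1 + integral {t1..u} (\<lambda>s. f (\<psi>b s))) has_vector_derivative (0 + f (\<psi>b T))) (at T within {t1..T})"
      using t1 by (intro has_vector_derivative_add has_vector_derivative_const integral_has_vector_derivative contf) auto
    then have "(\<psi>b has_vector_derivative (0 + f (\<psi>b T))) (at T within {t1..T})"
      by (rule has_vector_derivative_transform[rotated 2])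
        (use t1 integral_unique[OF intg] in auto)
    moreover have "at T within {t1..T} = at T within {0..T}"
      using t1 by (intro at_within_nhd[of T "{t1<..}"]) auto
    ultimately show ?thesis by (simp add: psiT)
  qed
  from lip[OF zK] obtain r L where r: "r > 0" "cball z r \<subseteq> U" "L-lipschitz_on (cball z r) f" by blast
  obtain h \<eta> where h: "h > 0" "\<eta> 0 = z" "\<And>t. 0 \<le> t \<Longrightarrow> t \<le> h \<Longrightarrow> \<eta> t \<in> cball z r"
    "\<And>t. 0 \<le> t \<Longrightarrow> t \<le> h \<Longrightarrow> (\<eta> has_vector_derivative f (\<eta> t)) (at t within {0..h})"
    using local_solution_exists[OF r(1,3)] by blast
  \<comment> \<open>Negative times keep the values of \<psi>, since the conclusion asks for
    agreement at all \<open>t < T\<close>.\<close>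
  define \<phi> where "\<phi> = (\<lambda>t. if t \<in> {0..T} then \<psi>b t else if t < T then \<psi> t else \<eta> (t - T))"
  have shift: "((\<lambda>t. \<eta> (t - T)) has_vector_derivative f (\<eta> (t - T))) (at t within {T..T+h})" if "T \<le> t" "t \<le> T + h" for t
  proof -
    have "((\<eta> \<circ> (\<lambda>t. t - T)) has_vector_derivative 1 *\<^sub>R f (\<eta> (t - T))) (at t within {T..T+h})"
    proof (rule vector_diff_chain_within)
      show "((\<lambda>t. t - T) has_vector_derivative 1) (at t within {T..T+h})"
        by (auto intro!: derivative_eq_intros)
      have "(\<lambda>t. t - T) ` {T..T+h} \<subseteq> {0..h}" by auto
      then show "(\<eta> has_vector_derivative f (\<eta> (t - T))) (at (t - T) within (\<lambda>t. t - T) ` {T..T+h})"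
        by (rule has_vector_derivative_within_subset[OF h(4), rotated 2]) (use that in auto)
    qed
    then show ?thesis by (simp add: o_def)
  qed
  have glue: "((\<lambda>t. if t \<in> {0..T} then \<psi>b t else \<eta> (t - T)) has_vector_derivative
      (if t \<in> {0..T} then f (\<psi>b t) else f (\<eta> (t - T)))) (at t within {0..T+h})"
    if "t \<in> {0..T+h}" for t
  proof (rule has_vector_derivative_If_within_closures)
    show "t \<in> {0..T} \<union> {T..T+h}" using that by auto
    show "{0..T+h} = {0..T} \<union> {T..T+h}" using t1 h by auto
    have ST: "{0..T} \<union> (closure {0..T} \<inter> closure {T..T+h}) = {0..T}"
      "{T..T+h} \<union> (closure {0..T} \<inter> closure {T..T+h}) = {T..T+h}" using t1 h by auto
    show "(\<psi>b has_vector_derivative f (\<psi>b t)) (at t within {0..T} \<union> (closure {0..T} \<inter> closure {T..T+h}))"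
      if "t \<in> {0..T} \<union> (closure {0..T} \<inter> closure {T..T+h})"
      using that inner[of t] derT unfolding ST by (cases "t = T") (auto simp: psiT)
    show "((\<lambda>t. \<eta> (t - T)) has_vector_derivative f (\<eta> (t - T))) (at t within {T..T+h} \<union> (closure {0..T} \<inter> closure {T..T+h}))"
      if "t \<in> {T..T+h} \<union> (closure {0..T} \<inter> closure {T..T+h})"
      using that shift[of t] unfolding ST by auto
  next
    assume "t \<in> closure {0..T}" "t \<in> closure {T..T+h}"
    then have "t = T" by auto
    then show "\<psi>b t = \<eta> (t - T)" "f (\<psi>b t) = f (\<eta> (t - T))" by (auto simp: psiT h)
  qed
  show thesis
  proof (rule that[of h \<phi>])
    show "h > 0" by (fact h)
    show "\<phi> t = \<psi> t" if "t < T" for t using that by (simp add: \<phi>_def psib)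
    show "\<phi> t \<in> U" if "T \<le> t" "t < T + h" for t
      using that r(2) h(3)[of "t - T"] h(2) h(3)[of 0] h(1) t1 by (cases "t = T") (auto simp: \<phi>_def psiT)
    show "(\<phi> has_vector_derivative f (\<phi> t)) (at t within {0..<T + h})" if "0 \<le> t" "t < T + h" for t
    proof -
      have ivl_subset: "{0..<T+h} \<subseteq> {0..T+h}" by auto
      have "((\<lambda>t. if t \<in> {0..T} then \<psi>b t else \<eta> (t - T)) has_vector_derivative f (\<phi> t)) (at t within {0..<T+h})"
        using has_vector_derivative_within_subset[OF glue[of t] ivl_subset] that
        by (auto simp: \<phi>_def split: if_splits)
      then show ?thesis
        by (rule has_vector_derivative_transform[rotated 2]) (use that in \<open>auto simp: \<phi>_def\<close>)
    qed
  qed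
qed

subsection \<open>The Hill vector field\<close>

lemma vector_4 [simp]:
  "(vector [a, b, c, d] :: 'a::zero ^ 4) $ 1 = a"
  "(vector [a, b, c, d] :: 'a::zero ^ 4) $ 2 = b"
  "(vector [a, b, c, d] :: 'a::zero ^ 4) $ 3 = c"
  "(vector [a, b, c, d] :: 'a::zero ^ 4) $ 4 = d"
  unfolding vector_def by simp_all

lemma vec4_eq_iff: "(u :: 'a ^ 4) = v \<longleftrightarrow> u $ 1 = v $ 1 \<and> u $ 2 = v $ 2 \<and> u $ 3 = v $ 3 \<and> u $ 4 = v $ 4"
  by (simp add: vec_eq_iff forall_4)

lemma inner_4: "(u :: real ^ 4) \<bullet> v = u $ 1 * v $ 1 + u $ 2 * v $ 2 + u $ 3 * v $ 3 + u $ 4 * v $ 4"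
  by (simp add: inner_vec_def sum_4)

lemma norm_sq_4: "(norm (u :: real ^ 4))\<^sup>2 = (u $ 1)\<^sup>2 + (u $ 2)\<^sup>2 + (u $ 3)\<^sup>2 + (u $ 4)\<^sup>2"
  unfolding power2_norm_eq_inner inner_4 by (simp add: power2_eq_square)

lemma Jmat_mult: "Jmat *v u = vector [u $ 3, u $ 4, - u $ 1, - u $ 2]"
  by (simp add: vec4_eq_iff Jmat_def matrix_vector_mult_def sum_4)

lemma Omega_eq: "Omega u v = u $ 3 * v $ 1 + u $ 4 * v $ 2 - u $ 1 * v $ 3 - u $ 2 * v $ 4"
  by (simp add: Omega_def Jmat_mult inner_4)

definition wsq :: "phase \<Rightarrow> real"
  where "wsq \<phi> = (\<phi> $ 1)\<^sup>2 + (\<phi> $ 2)\<^sup>2"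

text \<open>The factor of the central force: the gradient of
  \<open>- (\<alpha> + 2) / r powr \<alpha>\<close> is \<open>hforce\<close> times the position. It
  is written in the squared radius so that no square root is differentiated.\<close>

definition hforce :: "real \<Rightarrow> phase \<Rightarrow> real"
  where "hforce \<alpha> \<phi> = \<alpha> * (\<alpha> + 2) * wsq \<phi> powr (-(\<alpha> + 2) / 2)"

definition gradE :: "real \<Rightarrow> phase \<Rightarrow> phase"
  where "gradE \<alpha> \<phi> = vector
    [- (\<phi> $ 4 - \<phi> $ 1) - (\<alpha> + 2) * \<phi> $ 1 + hforce \<alpha> \<phi> * \<phi> $ 1,
     (\<phi> $ 3 + \<phi> $ 2) + hforce \<alpha> \<phi> * \<phi> $ 2,
     \<phi> $ 3 + \<phi> $ 2, \<phi> $ 4 - \<phi> $ 1]"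

definition field :: "real \<Rightarrow> phase \<Rightarrow> phase"
  where "field \<alpha> \<phi> = Jmat *v gradE \<alpha> \<phi>"

lemma field_nth:
  "field \<alpha> \<phi> $ 1 = \<phi> $ 3 + \<phi> $ 2"
  "field \<alpha> \<phi> $ 2 = \<phi> $ 4 - \<phi> $ 1"
  "field \<alpha> \<phi> $ 3 = (\<phi> $ 4 - \<phi> $ 1) + (\<alpha> + 2) * \<phi> $ 1 - hforce \<alpha> \<phi> * \<phi> $ 1"
  "field \<alpha> \<phi> $ 4 = - (\<phi> $ 3 + \<phi> $ 2) - hforce \<alpha> \<phi> * \<phi> $ 2"
  unfolding field_def Jmat_mult gradE_def vector_4 by simp_all

lemma phase_space_iff: "\<phi> \<in> phase_space \<longleftrightarrow> 0 < wsq \<phi>"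
  by (auto simp: phase_space_def wsq_def sum_power2_gt_zero_iff)

lemma wsq_nonneg: "0 \<le> wsq \<phi>"
  by (simp add: wsq_def)

lemma open_phase_space: "open phase_space"
proof -
  have "phase_space = {\<phi>. 0 < wsq \<phi>}" by (auto simp: phase_space_iff)
  moreover have "open {\<phi>. 0 < wsq \<phi>}" unfolding wsq_def
    by (intro open_Collect_less continuous_intros)
  ultimately show ?thesis by simp
qed

lemma V_eq:
  assumes "0 < x\<^sup>2 + y\<^sup>2"
  shows "V \<alpha> x y = - (\<alpha> + 2) / 2 * x\<^sup>2 - (\<alpha> + 2) * (x\<^sup>2 + y\<^sup>2) powr (- \<alpha> / 2)"
proof -
  define w where "w = x\<^sup>2 + y\<^sup>2"
  have "sqrt w = w powr (1/2)" using assms by (simp add: powr_half_sqrt w_def)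
  then have "sqrt w powr \<alpha> = w powr (\<alpha> / 2)" by (simp add: powr_powr)
  moreover have "w powr (- \<alpha> / 2) = inverse (w powr (\<alpha> / 2))" using powr_minus[of w "\<alpha> / 2"] by simp
  ultimately have "(\<alpha> + 2) / sqrt w powr \<alpha> = (\<alpha> + 2) * w powr (- \<alpha> / 2)"
    by (metis divide_inverse)
  then show ?thesis unfolding V_def w_def by simp
qed

lemma energy_eq:
  assumes "\<phi> \<in> phase_space"
  shows "energy \<alpha> \<phi> = ((\<phi> $ 3 + \<phi> $ 2)\<^sup>2 + (\<phi> $ 4 - \<phi> $ 1)\<^sup>2) / 2
    - (\<alpha> + 2) / 2 * (\<phi> $ 1)\<^sup>2 - (\<alpha> + 2) * wsq \<phi> powr (- \<alpha> / 2)"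
  using assms by (simp add: energy_def V_eq phase_space_iff wsq_def field_simps)

lemma component_has_derivative [derivative_intros]:
  "((\<lambda>\<phi>. (\<phi> :: real ^ 'n) $ i) has_derivative (\<lambda>H. H $ i)) F"
  by (rule bounded_linear_imp_has_derivative[OF bounded_linear_vec_nth])

lemmas component_derivative_rules = component_has_derivative has_derivative_const
  has_derivative_mult_right has_derivative_power has_derivative_add has_derivative_diff
  has_derivative_minus

lemma wsq_powr_has_derivative:
  assumes "\<phi> \<in> phase_space"
  shows "((\<lambda>\<phi>. wsq \<phi> powr c) has_derivative
    (\<lambda>H. c * wsq \<phi> powr (c - 1) * (2 * \<phi> $ 1 * H $ 1 + 2 * \<phi> $ 2 * H $ 2))) (at \<phi>)"
proof -
  have w: "0 < wsq \<phi>" using assms by (simp add: phase_space_iff)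
  have "(wsq has_derivative (\<lambda>H. 2 * \<phi> $ 1 * H $ 1 + 2 * \<phi> $ 2 * H $ 2)) (at \<phi>)"
    unfolding wsq_def[abs_def]
    by (rule has_derivative_eq_rhs, (rule component_derivative_rules)+) auto
  then have "((\<lambda>x. wsq x powr c) has_derivative
      (\<lambda>H. (2 * \<phi> $ 1 * H $ 1 + 2 * \<phi> $ 2 * H $ 2) * (c * wsq \<phi> powr (c - 1)))) (at \<phi>)"
    by (rule DERIV_compose_FDERIV[rotated]) (rule has_real_derivative_powr[OF w])
  then show ?thesis by (simp add: mult.commute)
qed

lemma energy_has_derivative:
  assumes "\<phi> \<in> phase_space"
  shows "(energy \<alpha> has_derivative (\<lambda>H. H \<bullet> gradE \<alpha> \<phi>)) (at \<phi>)"
proof -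
  have "((\<lambda>\<phi>. 1 / 2 * ((\<phi> $ 3 + \<phi> $ 2)\<^sup>2 + (\<phi> $ 4 - \<phi> $ 1)\<^sup>2)
    - (\<alpha> + 2) / 2 * (\<phi> $ 1)\<^sup>2 - (\<alpha> + 2) * wsq \<phi> powr (- \<alpha> / 2)) has_derivative
     (\<lambda>H. H \<bullet> gradE \<alpha> \<phi>)) (at \<phi>)"
  proof -
    define P where "P = wsq \<phi> powr (-(\<alpha> + 2) / 2)"
    have e: "wsq \<phi> powr (- \<alpha> / 2 - 1) = P" unfolding P_def by (rule arg_cong2[of _ _ _ _ "(powr)"]) (auto simp: field_simps)
    show ?thesis
      by (rule has_derivative_eq_rhs, (rule component_derivative_rules wsq_powr_has_derivative[OF assms])+, rule ext)
        (unfold e gradE_def inner_4 vector_4 hforce_def P_def[symmetric], simp add: field_simps)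
  qed
  then show ?thesis
    by (rule has_derivative_transform_within_open[OF _ open_phase_space assms]) (simp add: energy_eq)
qed

lemma grad_energy:
  assumes "\<phi> \<in> phase_space"
  shows "grad (energy \<alpha>) \<phi> = gradE \<alpha> \<phi>"
  unfolding grad_def
proof (rule the_equality)
  show g: "GDERIV (energy \<alpha>) \<phi> :> gradE \<alpha> \<phi>"
    using energy_has_derivative[OF assms] by (simp add: gderiv_def)
  fix g assume "GDERIV (energy \<alpha>) \<phi> :> g"
  then have "(\<lambda>H. H \<bullet> g) = (\<lambda>H. H \<bullet> gradE \<alpha> \<phi>)"
    using energy_has_derivative[OF assms] by (auto simp: gderiv_def intro: has_derivative_unique)
  then have "H \<bullet> g = H \<bullet> gradE \<alpha> \<phi>" for H by metis
  then show "g = gradE \<alpha> \<phi>" by (metis vector_eq_ldot)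
qed

lemma hforce_mult_has_derivative:
  assumes "\<phi> \<in> phase_space"
  shows "((\<lambda>\<phi>. hforce \<alpha> \<phi> * \<phi> $ j) has_derivative
    (\<lambda>H. hforce \<alpha> \<phi> * H $ j - (\<alpha> + 2) * hforce \<alpha> \<phi> / wsq \<phi> * (\<phi> $ 1 * H $ 1 + \<phi> $ 2 * H $ 2) * \<phi> $ j)) (at \<phi>)"
proof -
  have w: "0 < wsq \<phi>" using assms by (simp add: phase_space_iff)
  define c where "c = -(\<alpha> + 2) / 2"
  define P where "P = wsq \<phi> powr c"
  have e: "wsq \<phi> powr (c - 1) = P / wsq \<phi>"
    using w by (simp add: powr_diff P_def)
  have a: "\<alpha> + 2 = -2 * c" by (simp add: c_def)
  have "((\<lambda>\<phi>. (\<alpha> * (\<alpha> + 2) * wsq \<phi> powr c) * \<phi> $ j) has_derivative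
      (\<lambda>H. (\<alpha> * (\<alpha> + 2) * P) * H $ j + (\<alpha> * (\<alpha> + 2) * (c * (P / wsq \<phi>) * (2 * \<phi> $ 1 * H $ 1 + 2 * \<phi> $ 2 * H $ 2))) * \<phi> $ j)) (at \<phi>)"
    using has_derivative_mult[OF has_derivative_mult_right[OF wsq_powr_has_derivative[OF assms, of c]]
      component_has_derivative[of j], of "\<alpha> * (\<alpha> + 2)"] unfolding e P_def[symmetric] .
  moreover have "(\<lambda>H::phase. (\<alpha> * (\<alpha> + 2) * P) * H $ j + (\<alpha> * (\<alpha> + 2) * (c * (P / wsq \<phi>) * (2 * \<phi> $ 1 * H $ 1 + 2 * \<phi> $ 2 * H $ 2))) * \<phi> $ j)
     = (\<lambda>H. hforce \<alpha> \<phi> * H $ j - (\<alpha> + 2) * hforce \<alpha> \<phi> / wsq \<phi> * (\<phi> $ 1 * H $ 1 + \<phi> $ 2 * H $ 2) * \<phi> $ j)"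
    unfolding hforce_def c_def[symmetric] unfolding P_def[symmetric] unfolding a by (simp add: fun_eq_iff algebra_simps)
  moreover have "hforce \<alpha> = (\<lambda>\<phi>. \<alpha> * (\<alpha> + 2) * wsq \<phi> powr c)" by (simp add: hforce_def[abs_def] c_def)
  ultimately show ?thesis by (simp only:)
qed

lemma hforce_mult_lipschitz:
  assumes "compact K" "convex K" "K \<subseteq> phase_space"
  shows "\<exists>B\<ge>0. \<forall>a\<in>K. \<forall>b\<in>K. \<bar>hforce \<alpha> a * a $ j - hforce \<alpha> b * b $ j\<bar> \<le> B * norm (a - b)"
proof -
  define B0 where "B0 = (\<lambda>\<phi>. \<bar>hforce \<alpha> \<phi>\<bar> + \<bar>(\<alpha> + 2) * hforce \<alpha> \<phi> / wsq \<phi>\<bar> * (\<bar>\<phi> $ 1\<bar> + \<bar>\<phi> $ 2\<bar>) * \<bar>\<phi> $ j\<bar>)"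
  have w: "wsq \<phi> \<noteq> 0" if "\<phi> \<in> K" for \<phi> using that assms(3) phase_space_iff by force
  have "continuous_on K B0" unfolding B0_def hforce_def wsq_def
    using w by (intro continuous_intros) (auto simp: wsq_def)
  then have "bounded (B0 ` K)" using assms by (intro compact_imp_bounded compact_continuous_image)
  then obtain B where B: "B > 0" "\<And>\<phi>. \<phi> \<in> K \<Longrightarrow> \<bar>B0 \<phi>\<bar> \<le> B" unfolding bounded_pos by auto
  have "norm (hforce \<alpha> a * a $ j - hforce \<alpha> b * b $ j) \<le> B * norm (a - b)" if "a \<in> K" "b \<in> K" for a b
  proof (rule differentiable_bound[OF assms(2) _ _ that])
    fix \<phi> assume \<phi>: "\<phi> \<in> K"
    show "((\<lambda>\<phi>. hforce \<alpha> \<phi> * \<phi> $ j) has_derivative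
      (\<lambda>H. hforce \<alpha> \<phi> * H $ j - (\<alpha> + 2) * hforce \<alpha> \<phi> / wsq \<phi> * (\<phi> $ 1 * H $ 1 + \<phi> $ 2 * H $ 2) * \<phi> $ j)) (at \<phi> within K)"
      using \<phi> assms(3) by (intro has_derivative_at_withinI[OF hforce_mult_has_derivative]) auto
    show "onorm (\<lambda>H. hforce \<alpha> \<phi> * H $ j - (\<alpha> + 2) * hforce \<alpha> \<phi> / wsq \<phi> * (\<phi> $ 1 * H $ 1 + \<phi> $ 2 * H $ 2) * \<phi> $ j) \<le> B"
    proof (rule onorm_bound)
      fix H :: phase
      have c: "\<bar>H $ i\<bar> \<le> norm H" for i by (rule component_le_norm_cart)
      have "\<bar>hforce \<alpha> \<phi> * H $ j\<bar> \<le> \<bar>hforce \<alpha> \<phi>\<bar> * norm H"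
        unfolding abs_mult by (intro mult_left_mono c) auto
      moreover have "\<bar>\<phi> $ 1 * H $ 1 + \<phi> $ 2 * H $ 2\<bar> \<le> \<bar>\<phi> $ 1\<bar> * norm H + \<bar>\<phi> $ 2\<bar> * norm H"
        using mult_left_mono[OF c[of 1], of "\<bar>\<phi> $ 1\<bar>"] mult_left_mono[OF c[of 2], of "\<bar>\<phi> $ 2\<bar>"]
          abs_triangle_ineq[of "\<phi> $ 1 * H $ 1" "\<phi> $ 2 * H $ 2"] by (simp add: abs_mult)
      then have "\<bar>(\<alpha> + 2) * hforce \<alpha> \<phi> / wsq \<phi> * (\<phi> $ 1 * H $ 1 + \<phi> $ 2 * H $ 2) * \<phi> $ j\<bar>
        \<le> \<bar>(\<alpha> + 2) * hforce \<alpha> \<phi> / wsq \<phi>\<bar> * (\<bar>\<phi> $ 1\<bar> * norm H + \<bar>\<phi> $ 2\<bar> * norm H) * \<bar>\<phi> $ j\<bar>"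
        unfolding abs_mult[of _ "\<phi> $ j"] abs_mult[of _ "(\<phi> $ 1 * H $ 1 + \<phi> $ 2 * H $ 2)"]
        by (intro mult_right_mono mult_left_mono) auto
      ultimately have "\<bar>hforce \<alpha> \<phi> * H $ j - (\<alpha> + 2) * hforce \<alpha> \<phi> / wsq \<phi> * (\<phi> $ 1 * H $ 1 + \<phi> $ 2 * H $ 2) * \<phi> $ j\<bar>
        \<le> \<bar>hforce \<alpha> \<phi>\<bar> * norm H + \<bar>(\<alpha> + 2) * hforce \<alpha> \<phi> / wsq \<phi>\<bar> * (\<bar>\<phi> $ 1\<bar> * norm H + \<bar>\<phi> $ 2\<bar> * norm H) * \<bar>\<phi> $ j\<bar>"
        by (meson abs_triangle_ineq4 add_mono order_trans)
      also have "\<dots> = B0 \<phi> * norm H" unfolding B0_def by (simp only: distrib_left distrib_right mult_ac)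
      also have "\<dots> \<le> B * norm H" using B(2)[OF \<phi>] by (intro mult_right_mono) auto
      finally show "norm (hforce \<alpha> \<phi> * H $ j - (\<alpha> + 2) * hforce \<alpha> \<phi> / wsq \<phi> * (\<phi> $ 1 * H $ 1 + \<phi> $ 2 * H $ 2) * \<phi> $ j)
        \<le> B * norm H" by simp
    qed (use B in auto)
  qed
  then show ?thesis using B(1) by (intro exI[of _ B]) auto
qed

lemma field_locally_lipschitz:
  assumes "z \<in> phase_space"
  shows "\<exists>r>0. \<exists>L. cball z r \<subseteq> phase_space \<and> L-lipschitz_on (cball z r) (field \<alpha>)"
proof -
  obtain r where r: "r > 0" "cball z r \<subseteq> phase_space"
    using open_phase_space assms open_contains_cball by blast
  obtain B1 where B1: "B1 \<ge> 0" "\<And>a b. a \<in> cball z r \<Longrightarrow> b \<in> cball z r \<Longrightarrow> \<bar>hforce \<alpha> a * a $ 1 - hforce \<alpha> b * b $ 1\<bar> \<le> B1 * norm (a - b)"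
    using hforce_mult_lipschitz[OF compact_cball convex_cball r(2), of \<alpha> 1] by blast
  obtain B2 where B2: "B2 \<ge> 0" "\<And>a b. a \<in> cball z r \<Longrightarrow> b \<in> cball z r \<Longrightarrow> \<bar>hforce \<alpha> a * a $ 2 - hforce \<alpha> b * b $ 2\<bar> \<le> B2 * norm (a - b)"
    using hforce_mult_lipschitz[OF compact_cball convex_cball r(2), of \<alpha> 2] by blast
  have regroup: "(p - q + x - h) - (p' - q' + x' - h') = ((p - p') - (q - q')) + ((x - x') - (h - h'))"
    and regroup': "(- (p + q) - h) - (- (p' + q') - h') = - ((p - p') + (q - q')) - (h - h')"
    for p q x h p' q' x' h' :: real by simp_all
  define L where "L = 2 + 2 + (2 + \<bar>\<alpha> + 2\<bar> + B1) + (2 + B2)"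
  have "norm (field \<alpha> a - field \<alpha> b) \<le> L * norm (a - b)" if ab: "a \<in> cball z r" "b \<in> cball z r" for a b
  proof -
    define n where "n = norm (a - b)"
    have c: "\<bar>a $ i - b $ i\<bar> \<le> n" for i using component_le_norm_cart[of "a - b" i] by (simp add: n_def)
    have c1: "\<bar>(\<alpha> + 2) * a $ 1 - (\<alpha> + 2) * b $ 1\<bar> \<le> \<bar>\<alpha> + 2\<bar> * n"
      using mult_left_mono[OF c[of 1], of "\<bar>\<alpha> + 2\<bar>"] unfolding right_diff_distrib[symmetric] abs_mult by simp
    have f1: "\<bar>(field \<alpha> a - field \<alpha> b) $ 1\<bar> \<le> n + n"
      using c[of 2] c[of 3] unfolding vector_minus_component field_nth by linarith
    have f2: "\<bar>(field \<alpha> a - field \<alpha> b) $ 2\<bar> \<le> n + n"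
      using c[of 1] c[of 4] unfolding vector_minus_component field_nth by linarith
    have "(field \<alpha> a - field \<alpha> b) $ 3 = ((a $ 4 - b $ 4) - (a $ 1 - b $ 1))
        + (((\<alpha> + 2) * a $ 1 - (\<alpha> + 2) * b $ 1) - (hforce \<alpha> a * a $ 1 - hforce \<alpha> b * b $ 1))"
      unfolding vector_minus_component field_nth by (rule regroup)
    then have f3: "\<bar>(field \<alpha> a - field \<alpha> b) $ 3\<bar> \<le> 2 * n + \<bar>\<alpha> + 2\<bar> * n + B1 * n"
      using c[of 4] c[of 1] c1 B1(2)[OF ab] unfolding n_def[symmetric] by linarith
    have "(field \<alpha> a - field \<alpha> b) $ 4 = - ((a $ 3 - b $ 3) + (a $ 2 - b $ 2))
        - (hforce \<alpha> a * a $ 2 - hforce \<alpha> b * b $ 2)"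
      unfolding vector_minus_component field_nth by (rule regroup')
    then have f4: "\<bar>(field \<alpha> a - field \<alpha> b) $ 4\<bar> \<le> 2 * n + B2 * n"
      using c[of 3] c[of 2] B2(2)[OF ab] unfolding n_def[symmetric] by linarith
    have "norm (field \<alpha> a - field \<alpha> b) \<le> (\<Sum>i\<in>UNIV. \<bar>(field \<alpha> a - field \<alpha> b) $ i\<bar>)"
      by (rule norm_le_l1_cart)
    also have "\<dots> \<le> (n + n) + (n + n) + (2 * n + \<bar>\<alpha> + 2\<bar> * n + B1 * n) + (2 * n + B2 * n)"
      unfolding sum_4 by (rule add_mono[OF add_mono[OF add_mono[OF f1 f2] f3] f4])
    also have "\<dots> = L * n" by (simp add: L_def algebra_simps)
    finally show ?thesis by (simp add: n_def)
  qed
  then have "L-lipschitz_on (cball z r) (field \<alpha>)"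
    using B1(1) B2(1) by (auto simp: lipschitz_on_def dist_norm L_def)
  then show ?thesis using r by blast
qed

lemma gradE_has_derivative:
  assumes "\<phi> \<in> phase_space"
  shows "(gradE \<alpha> has_derivative (\<lambda>H. vector
    [- (H $ 4 - H $ 1) - (\<alpha> + 2) * H $ 1 + (hforce \<alpha> \<phi> * H $ 1 - (\<alpha> + 2) * hforce \<alpha> \<phi> / wsq \<phi> * (\<phi> $ 1 * H $ 1 + \<phi> $ 2 * H $ 2) * \<phi> $ 1),
     (H $ 3 + H $ 2) + (hforce \<alpha> \<phi> * H $ 2 - (\<alpha> + 2) * hforce \<alpha> \<phi> / wsq \<phi> * (\<phi> $ 1 * H $ 1 + \<phi> $ 2 * H $ 2) * \<phi> $ 2),
     H $ 3 + H $ 2, H $ 4 - H $ 1])) (at \<phi>)" (is "(_ has_derivative ?D) _")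
proof (subst has_derivative_componentwise_within, safe)
  fix b :: phase assume "b \<in> Basis"
  then obtain i where b: "b = axis i 1" by (auto simp: Basis_vec_def)
  note c = component_has_derivative
  have "((\<lambda>x. gradE \<alpha> x $ 1) has_derivative (\<lambda>H. ?D H $ 1)) (at \<phi>)"
    unfolding gradE_def vector_4
    by (rule has_derivative_add[OF has_derivative_diff[OF has_derivative_minus[OF has_derivative_diff[OF c c]]
      has_derivative_mult_right[OF c]] hforce_mult_has_derivative[OF assms]])
  moreover have "((\<lambda>x. gradE \<alpha> x $ 2) has_derivative (\<lambda>H. ?D H $ 2)) (at \<phi>)"
    unfolding gradE_def vector_4
    by (rule has_derivative_add[OF has_derivative_add[OF c c] hforce_mult_has_derivative[OF assms]])
  moreover have "((\<lambda>x. gradE \<alpha> x $ 3) has_derivative (\<lambda>H. ?D H $ 3)) (at \<phi>)"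
    unfolding gradE_def vector_4
    by (rule has_derivative_add[OF c c])
  moreover have "((\<lambda>x. gradE \<alpha> x $ 4) has_derivative (\<lambda>H. ?D H $ 4)) (at \<phi>)"
    unfolding gradE_def vector_4
    by (rule has_derivative_diff[OF c c])
  ultimately have "((\<lambda>x. gradE \<alpha> x $ i) has_derivative (\<lambda>H. ?D H $ i)) (at \<phi>)"
    using exhaust_4[of i] by (elim disjE) (simp_all only:)
  then show "((\<lambda>x. gradE \<alpha> x \<bullet> b) has_derivative (\<lambda>H. ?D H \<bullet> b)) (at \<phi>)"
    unfolding b inner_axis by simp
qed

section \<open>Continuation of maximal solutions and conservation of energy\<close>

lemma solution_field:
  assumes "is_solution \<alpha> \<psi> T" "0 \<le> t" "ereal t < T"
  shows "\<psi> t \<in> phase_space"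
    "(\<psi> has_vector_derivative field \<alpha> (\<psi> t)) (at t within {s. 0 \<le> s \<and> ereal s < T})"
  using assms grad_energy[of "\<psi> t" \<alpha>] unfolding is_solution_def field_def by auto

text \<open>A finite \<open>T\<close> would let \<open>solution_extends\<close> continue the
  solution, against maximality.\<close>

lemma maximal_solution_leaves_compact:
  assumes sol: "is_maximal_solution \<alpha> \<psi> T" and K: "compact K" "K \<subseteq> phase_space"
    and t1: "0 \<le> t1" "ereal t1 < T" and inK: "\<And>t. t1 \<le> t \<Longrightarrow> ereal t < T \<Longrightarrow> \<psi> t \<in> K"
  shows "T = \<infinity>"
proof (rule ccontr)
  assume "T \<noteq> \<infinity>"
  then obtain b where b: "T = ereal b" using t1 by (cases T) auto
  have s: "is_solution \<alpha> \<psi> T" using sol by (simp add: is_maximal_solution_def)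
  have set: "{s. 0 \<le> s \<and> ereal s < ereal c} = {0..<c}" for c by auto
  obtain h \<phi> where h: "h > 0" "\<And>t. t < b \<Longrightarrow> \<phi> t = \<psi> t"
    "\<And>t. b \<le> t \<Longrightarrow> t < b + h \<Longrightarrow> \<phi> t \<in> phase_space"
    "\<And>t. 0 \<le> t \<Longrightarrow> t < b + h \<Longrightarrow> (\<phi> has_vector_derivative field \<alpha> (\<phi> t)) (at t within {0..<b + h})"
  proof (rule solution_extends[of t1 b K \<psi> "field \<alpha>" phase_space])
    show "0 \<le> t1" "t1 < b" "compact K" using t1 K b by auto
    show "\<psi> t \<in> K" if "t1 \<le> t" "t < b" for t using inK that b by auto
    show "(\<psi> has_vector_derivative field \<alpha> (\<psi> t)) (at t within {0..<b})" if "0 \<le> t" "t < b" for t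
      using solution_field(2)[OF s that(1)] that unfolding b set by simp
    show "\<exists>r>0. \<exists>L. cball z r \<subseteq> phase_space \<and> L-lipschitz_on (cball z r) (field \<alpha>)" if "z \<in> K" for z
      using that K by (intro field_locally_lipschitz) auto
  qed blast
  have ps: "\<phi> t \<in> phase_space" if "0 \<le> t" "t < b + h" for t
    using that h(2)[of t] h(3)[of t] solution_field(1)[OF s, of t] b by (cases "t < b") auto
  have "is_solution \<alpha> \<phi> (ereal (b + h))" unfolding is_solution_def set
    using h(1,4) ps t1 b by (auto simp: grad_energy field_def)
  moreover have "T < ereal (b + h)" using h(1) b by simp
  moreover have "\<forall>t. 0 \<le> t \<and> ereal t < T \<longrightarrow> \<phi> t = \<psi> t" using h(2) b by simp
  ultimately have "\<exists>\<phi> T'. T < T' \<and> is_solution \<alpha> \<phi> T' \<and> (\<forall>t. 0 \<le> t \<and> ereal t < T \<longrightarrow> \<phi> t = \<psi> t)"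
    by (intro exI conjI)
  then show False using conjunct2[OF sol[unfolded is_maximal_solution_def]] by (rule notE[rotated])
qed

lemma energy_conserved:
  assumes s: "is_solution \<alpha> \<psi> T" and t: "0 \<le> t" "ereal t < T"
  shows "energy \<alpha> (\<psi> t) = energy \<alpha> (\<psi> 0)"
proof -
  let ?S = "{s. 0 \<le> s \<and> ereal s < T}"
  have S: "convex ?S"
    unfolding is_interval_convex_1[symmetric] is_interval_1
    by (auto intro: le_less_trans[of "ereal _" "ereal _"])
  have d: "((\<lambda>t. energy \<alpha> (\<psi> t)) has_derivative (\<lambda>h. 0)) (at t within ?S)" if "t \<in> ?S" for t
  proof -
    have p: "\<psi> t \<in> phase_space" and v: "(\<psi> has_derivative (\<lambda>h. h *\<^sub>R field \<alpha> (\<psi> t))) (at t within ?S)"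
      using solution_field[OF s, of t] that by (auto simp: has_vector_derivative_def)
    have "field \<alpha> (\<psi> t) \<bullet> gradE \<alpha> (\<psi> t) = 0"
      unfolding field_def Jmat_mult inner_4 vector_4 by simp
    then show ?thesis
      using has_derivative_compose[OF v energy_has_derivative[OF p, of \<alpha>]] by simp
  qed
  obtain c where "\<And>t. t \<in> ?S \<Longrightarrow> energy \<alpha> (\<psi> t) = c"
    using has_derivative_zero_constant[OF S d] by blast
  then show ?thesis using t s by (simp add: is_solution_def zero_ereal_def)
qed

section \<open>The equilibrium and its linearization in coordinates\<close>

lemma q0_pos: "0 < \<alpha> \<Longrightarrow> 0 < q0 \<alpha>"
  by (simp add: q0_def)

lemma q0_powr: "0 < \<alpha> \<Longrightarrow> (q0 \<alpha>)\<^sup>2 powr (-(\<alpha> + 2) / 2) = 1 / \<alpha>"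
proof -
  assume a: "0 < \<alpha>"
  have "(q0 \<alpha>)\<^sup>2 = \<alpha> powr (2 / (\<alpha> + 2))"
    using a by (simp add: q0_def powr_power)
  then have "(q0 \<alpha>)\<^sup>2 powr (-(\<alpha> + 2) / 2) = \<alpha> powr ((2 / (\<alpha> + 2)) * (-(\<alpha> + 2) / 2))"
    by (simp only: powr_powr)
  also have "(2 / (\<alpha> + 2)) * (-(\<alpha> + 2) / 2) = -1" using a by (simp add: field_simps)
  also have "\<alpha> powr -1 = 1 / \<alpha>" using a by (rule powr_neg_one)
  finally show ?thesis .
qed

lemma ground_nth [simp]:
  "ground \<alpha> $ 1 = q0 \<alpha>" "ground \<alpha> $ 2 = 0" "ground \<alpha> $ 3 = 0" "ground \<alpha> $ 4 = q0 \<alpha>"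
  by (simp_all add: ground_def)

lemma wsq_ground: "wsq (ground \<alpha>) = (q0 \<alpha>)\<^sup>2"
  by (simp add: wsq_def)

lemma ground_phase_space: "0 < \<alpha> \<Longrightarrow> ground \<alpha> \<in> phase_space"
  using q0_pos[of \<alpha>] by (simp add: phase_space_iff wsq_ground)

lemma hforce_ground: "0 < \<alpha> \<Longrightarrow> hforce \<alpha> (ground \<alpha>) = \<alpha> + 2"
  unfolding hforce_def wsq_ground q0_powr by simp

text \<open>At the ground state \<open>hforce\<close> equals \<open>\<alpha> + 2\<close>, so the
  second derivatives of V are \<open>- (\<alpha> + 2)\<^sup>2\<close> in x and
  \<open>\<alpha> + 2\<close> in y, without a mixed term. These are the two coefficients that appear
  here.\<close>

lemma linop_mult:
  assumes a: "0 < \<alpha>"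
  shows "linop \<alpha> *v X = vector [X $ 3 + X $ 2, X $ 4 - X $ 1,
    (X $ 4 - X $ 1) + (\<alpha> + 2)\<^sup>2 * X $ 1, - (X $ 3 + X $ 2) - (\<alpha> + 2) * X $ 2]"
proof -
  let ?D = "\<lambda>H::phase. vector [- (H $ 4 - H $ 1) - (\<alpha> + 2)\<^sup>2 * H $ 1,
     (H $ 3 + H $ 2) + (\<alpha> + 2) * H $ 2, H $ 3 + H $ 2, H $ 4 - H $ 1] :: phase"
  have q: "q0 \<alpha> > 0" using a by (rule q0_pos)
  have s: "(\<alpha> + 2) * (\<alpha> + 2) / (q0 \<alpha>)\<^sup>2 * (q0 \<alpha> * x) * q0 \<alpha> = (\<alpha> + 2)\<^sup>2 * x" for x
    using q by (simp add: power2_eq_square)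
  have "(gradE \<alpha> has_derivative ?D) (at (ground \<alpha>))"
  proof (rule has_derivative_eq_rhs[OF gradE_has_derivative[OF ground_phase_space[OF a]]], rule ext)
    fix H :: phase
    show "vector [- (H $ 4 - H $ 1) - (\<alpha> + 2) * H $ 1 + (hforce \<alpha> (ground \<alpha>) * H $ 1 - (\<alpha> + 2) * hforce \<alpha> (ground \<alpha>) / wsq (ground \<alpha>) * (ground \<alpha> $ 1 * H $ 1 + ground \<alpha> $ 2 * H $ 2) * ground \<alpha> $ 1),
     (H $ 3 + H $ 2) + (hforce \<alpha> (ground \<alpha>) * H $ 2 - (\<alpha> + 2) * hforce \<alpha> (ground \<alpha>) / wsq (ground \<alpha>) * (ground \<alpha> $ 1 * H $ 1 + ground \<alpha> $ 2 * H $ 2) * ground \<alpha> $ 2),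
     H $ 3 + H $ 2, H $ 4 - H $ 1] = ?D H"
      unfolding hforce_ground[OF a] wsq_ground ground_nth mult_zero_left mult_zero_right add_0_right s by (simp add: algebra_simps)
  qed
  then have D: "(grad (energy \<alpha>) has_derivative ?D) (at (ground \<alpha>))"
    by (rule has_derivative_transform_within_open[OF _ open_phase_space ground_phase_space[OF a]])
      (simp add: grad_energy)
  then have "frechet_derivative (grad (energy \<alpha>)) (at (ground \<alpha>)) = ?D"
    by (rule frechet_derivative_at[symmetric])
  then have "hessian (energy \<alpha>) (ground \<alpha>) *v X = ?D X"
    unfolding hessian_def using matrix_works[OF has_derivative_linear[OF D, folded linear_matrix_vector_mul_eq]] by simp
  then have "linop \<alpha> *v X = Jmat *v ?D X"
    by (simp add: linop_def matrix_vector_mul_assoc[symmetric])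
  then show ?thesis unfolding Jmat_mult vec4_eq_iff by simp
qed

lemma linop_nth:
  assumes a: "0 < \<alpha>"
  shows "(linop \<alpha> *v X) $ 1 = X $ 3 + X $ 2"
    "(linop \<alpha> *v X) $ 2 = X $ 4 - X $ 1"
    "(linop \<alpha> *v X) $ 3 = (X $ 4 - X $ 1) + (\<alpha> + 2)\<^sup>2 * X $ 1"
    "(linop \<alpha> *v X) $ 4 = - (X $ 3 + X $ 2) - (\<alpha> + 2) * X $ 2"
  unfolding linop_mult[OF a] vector_4 by simp_all

lemma Omega_linear:
  "Omega (x + y) z = Omega x z + Omega y z" "Omega z (x + y) = Omega z x + Omega z y"
  "Omega (x - y) z = Omega x z - Omega y z" "Omega z (x - y) = Omega z x - Omega z y"
  "Omega (c *\<^sub>R x) z = c * Omega x z" "Omega z (c *\<^sub>R x) = c * Omega z x"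
  unfolding Omega_eq by (simp_all add: algebra_simps)

lemma Omega_swap: "Omega x y = - Omega y x"
  unfolding Omega_eq by simp

text \<open>\<open>linop\<close> is J times a symmetric matrix, hence skew for \<Omega>; the
  orthogonality of the invariant subspaces rests on this.\<close>

lemma Omega_linop:
  assumes "0 < \<alpha>"
  shows "Omega (linop \<alpha> *v x) y = - Omega x (linop \<alpha> *v y)"
  unfolding Omega_eq linop_nth[OF assms] by (simp add: algebra_simps)

lemma cmat_cvec: "cmat M *v cvec x = cvec (M *v x)"
  by (simp add: vec_eq_iff cmat_def cvec_def matrix_vector_mult_def)

lemma cvec_inject: "cvec x = cvec y \<longleftrightarrow> x = y"
  by (simp add: vec_eq_iff cvec_def)

lemma cmat_mult_smult: "cmat M *v (c *s x) = c *s (cmat M *v x)"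
  by (simp add: vec_eq_iff matrix_vector_mult_def sum_distrib_left mult_ac)

text \<open>Removes the complex numbers: the plane is the kernel of A^2 + \<omega>^2. For the
  converse, \<gamma> is half the sum of \<gamma> - (i/\<omega>) A \<gamma> and \<gamma> +
  (i/\<omega>) A \<gamma>, which are eigenvectors.\<close>

lemma center_plane_iff:
  assumes w: "freq F > 0"
  shows "\<gamma> \<in> center_plane \<alpha> F \<longleftrightarrow> linop \<alpha> *v (linop \<alpha> *v \<gamma>) = - (freq F)\<^sup>2 *\<^sub>R \<gamma>"
proof
  let ?w = "complex_of_real (freq F)" and ?A = "cmat (linop \<alpha>)"
  assume "\<gamma> \<in> center_plane \<alpha> F"
  then obtain u v where u: "?A *v u = (\<i> * ?w) *s u" and v: "?A *v v = (- \<i> * ?w) *s v" and g: "cvec \<gamma> = u + v"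
    unfolding center_plane_def eigenspace_def by auto
  have "cvec (linop \<alpha> *v (linop \<alpha> *v \<gamma>)) = ?A *v (?A *v cvec \<gamma>)" by (simp add: cmat_cvec)
  also have "\<dots> = (\<i> * ?w) *s ((\<i> * ?w) *s u) + (- \<i> * ?w) *s ((- \<i> * ?w) *s v)"
    unfolding g matrix_vector_right_distrib u v cmat_mult_smult by simp
  also have "\<dots> = (- ?w\<^sup>2) *s cvec \<gamma>"
    unfolding g by (simp add: vec_eq_iff power2_eq_square algebra_simps)
  also have "\<dots> = cvec (- (freq F)\<^sup>2 *\<^sub>R \<gamma>)" by (simp add: vec_eq_iff cvec_def)
  finally show "linop \<alpha> *v (linop \<alpha> *v \<gamma>) = - (freq F)\<^sup>2 *\<^sub>R \<gamma>" by (simp only: cvec_inject)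
next
  let ?w = "complex_of_real (freq F)" and ?A = "cmat (linop \<alpha>)"
  assume g: "linop \<alpha> *v (linop \<alpha> *v \<gamma>) = - (freq F)\<^sup>2 *\<^sub>R \<gamma>"
  have w0: "?w \<noteq> 0" using w by simp
  define y where "y = linop \<alpha> *v \<gamma>"
  have Ag: "?A *v cvec \<gamma> = cvec y" by (simp add: cmat_cvec y_def)
  have Ay: "?A *v cvec y = (- ?w\<^sup>2) *s cvec \<gamma>"
    unfolding cmat_cvec y_def g by (simp add: vec_eq_iff cvec_def)
  define u where "u = (1/2) *s cvec \<gamma> + (- \<i> / (2 * ?w)) *s cvec y"
  define v where "v = (1/2) *s cvec \<gamma> + (\<i> / (2 * ?w)) *s cvec y"
  have "?A *v u = (\<i> * ?w) *s u"
    unfolding u_def matrix_vector_right_distrib cmat_mult_smult Ag Ay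
    using w0 by (simp add: vec_eq_iff field_simps power2_eq_square)
  moreover have "?A *v v = (- \<i> * ?w) *s v"
    unfolding v_def matrix_vector_right_distrib cmat_mult_smult Ag Ay
    using w0 by (simp add: vec_eq_iff field_simps power2_eq_square)
  moreover have "cvec \<gamma> = u + v" unfolding u_def v_def by (simp add: vec_eq_iff)
  ultimately show "\<gamma> \<in> center_plane \<alpha> F" unfolding center_plane_def eigenspace_def by blast
qed

subsection \<open>Linearization at the ground state\<close>

locale hill_frame =
  fixes \<alpha> :: real and F :: frame
  assumes alpha: "2 \<le> \<alpha>" and frame: "is_frame \<alpha> F"
begin

abbreviation m :: real where "m \<equiv> \<alpha> + 2"
abbreviation k :: real where "k \<equiv> rate F"

lemma alpha_pos: "0 < \<alpha>" using alpha by simp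

text \<open>The ratio of the y component to the x component of \<open>\<xi>\<^sub>+\<close>.
  Together with \<open>slope\<close>, which equals \<open>m\<^sup>2 / k\<close>, it expresses
  \<open>\<lambda>\<^sub>1\<close> through the x displacement and the y velocity alone.\<close>

definition mu :: real where "mu = (k\<^sup>2 - m\<^sup>2) / (2 * k)"
definition amp :: real where "amp = xi_plus F $ 1"
definition slope :: real where "slope = k - 2 * mu"

lemma k_pos: "0 < k" and freq_pos: "0 < freq F"
  using frame by (simp_all add: is_frame_def)

lemma m2: "m\<^sup>2 = k * slope"
  using k_pos by (simp add: mu_def slope_def field_simps power2_eq_square)

lemma xi_eigen: "linop \<alpha> *v xi_plus F = k *\<^sub>R xi_plus F" "linop \<alpha> *v xi_minus F = - k *\<^sub>R xi_minus F"
  and xi_Omega: "Omega (xi_plus F) (xi_minus F) = 1"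
  and xi_norm: "norm (xi_plus F) = norm (xi_minus F)"
  and xi_sign: "0 < Omega (Q0 \<alpha>) (xi_plus F)"
  using frame by (simp_all add: is_frame_def)

text \<open>Stated for both \<open>c = k\<close> and \<open>c = - k\<close>. The first three rows of
  the eigenvalue equation determine the vector from its x component; the fourth row is a further
  condition, the characteristic equation.\<close>

lemma eigenvector_components:
  assumes e: "linop \<alpha> *v u = c *\<^sub>R u" and c: "c\<^sup>2 = k\<^sup>2"
  shows "u $ 2 = c / k * mu * u $ 1" "u $ 3 = c / k * (k - mu) * u $ 1" "u $ 4 = (k * mu + 1) * u $ 1"
    "k\<^sup>2 * u $ 2 = - 2 * c * u $ 1 - m * u $ 2"
proof -
  have "u $ 3 + u $ 2 = c * u $ 1" "u $ 4 - u $ 1 = c * u $ 2"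
    "(u $ 4 - u $ 1) + m\<^sup>2 * u $ 1 = c * u $ 3" "- (u $ 3 + u $ 2) - m * u $ 2 = c * u $ 4"
    using e unfolding vec4_eq_iff linop_nth[OF alpha_pos] by simp_all
  then have 1: "u $ 3 = c * u $ 1 - u $ 2" and 2: "u $ 4 = c * u $ 2 + u $ 1"
    and 3: "2 * c * u $ 2 = (c\<^sup>2 - m\<^sup>2) * u $ 1" and 4: "c\<^sup>2 * u $ 2 = - 2 * c * u $ 1 - m * u $ 2"
    by algebra+
  show "k\<^sup>2 * u $ 2 = - 2 * c * u $ 1 - m * u $ 2" using 4 c by simp
  have k: "k \<noteq> 0" using k_pos by simp
  have c0: "c \<noteq> 0" using c k by auto
  have mu: "2 * k * mu = k\<^sup>2 - m\<^sup>2" using k by (simp add: mu_def)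
  have "2 * c * (k * u $ 2 - c * mu * u $ 1) = 0" using 3 mu c by algebra
  then have 5: "k * u $ 2 = c * mu * u $ 1" using c0 by simp
  then show 6: "u $ 2 = c / k * mu * u $ 1" using k by (simp add: field_simps)
  have "k * u $ 3 = c * (k - mu) * u $ 1" using 1 5 by algebra
  then show "u $ 3 = c / k * (k - mu) * u $ 1" using k by (simp add: field_simps)
  have "k * (c * u $ 2) = k * (k * mu * u $ 1)" using 5 c by algebra
  then show "u $ 4 = (k * mu + 1) * u $ 1" using 2 k by (simp add: algebra_simps)
qed

lemma amp_nz: "amp \<noteq> 0"
proof
  assume "amp = 0"
  then have "xi_plus F = 0"
    using eigenvector_components[OF xi_eigen(1) refl] by (simp add: vec4_eq_iff amp_def)
  then show False using xi_Omega by (simp add: Omega_def)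
qed

text \<open>The fourth row of the eigenvalue equation, divided by the amplitude. It says
  \<open>mu = - 2 * k / (k\<^sup>2 + m)\<close>, from which the bounds on \<open>mu\<close>
  follow.\<close>

lemma mu_eq: "k\<^sup>2 * mu = - 2 * k - m * mu"
proof -
  have "amp * (k\<^sup>2 * mu) = amp * (- 2 * k - m * mu)"
    using eigenvector_components(1,4)[OF xi_eigen(1) refl] k_pos by (simp add: amp_def algebra_simps)
  then show ?thesis using amp_nz by simp
qed

lemma mu_bounds: "mu < 0" "-1 \<le> mu"
proof -
  have p: "k\<^sup>2 + m > 0" using k_pos alpha by (simp add: add_pos_pos)
  have e: "(k\<^sup>2 + m) * mu = - 2 * k" using mu_eq by (simp add: algebra_simps)
  then have "(k\<^sup>2 + m) * mu < 0" using k_pos by simp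
  then show "mu < 0" using p by (simp add: mult_less_0_iff)
  have "(k - 1)\<^sup>2 \<ge> 0" by simp
  then have "(k\<^sup>2 + m) * (-1) \<le> (k\<^sup>2 + m) * mu" unfolding e using alpha
    by (simp add: power2_diff)
  then show "-1 \<le> mu" using p by (simp only: mult_le_cancel_left_pos)
qed

text \<open>\<open>2 * amp\<^sup>2 * disc\<close> is
  \<open>\<Omega>(\<xi>\<^sub>+, \<xi>\<^sub>-)\<close>, so the normalization of the frame turns
  into \<open>amp_sq\<close>.\<close>

definition disc :: real where "disc = slope - k * mu\<^sup>2"

lemma slope_pos: "0 < slope"
  using k_pos mu_bounds by (simp add: slope_def)

lemma disc_pos: "0 < disc"
proof -
  have "mu\<^sup>2 \<le> 1" using mu_bounds by (simp add: abs_square_le_1)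
  then have "k * mu\<^sup>2 \<le> k * 1" using k_pos by (intro mult_left_mono) auto
  then show ?thesis using mu_bounds by (simp add: disc_def slope_def)
qed

text \<open>\<open>\<xi>\<^sub>-\<close> is the time reversal of \<open>\<xi>\<^sub>+\<close>. Equal
  norms fix its first component up to sign, \<open>\<Omega> = 1\<close> with \<open>disc > 0\<close>
  excludes the minus sign and fixes the size, and the condition on \<open>Q0\<close> makes the
  common amplitude positive.\<close>

lemma xi_minus_amp: "xi_minus F $ 1 = amp"
  and amp_pos: "0 < amp" and amp_sq: "2 * amp\<^sup>2 * disc = 1"
proof -
  define s where "s = xi_minus F $ 1"
  have k: "k \<noteq> 0" using k_pos by simp
  have c: "(-k)\<^sup>2 = k\<^sup>2" by simp
  note p = eigenvector_components[OF xi_eigen(1) refl, folded amp_def]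
  note n = eigenvector_components[OF xi_eigen(2) c, folded s_def]
  have P: "xi_plus F $ 2 = mu * amp" "xi_plus F $ 3 = (k - mu) * amp" "xi_plus F $ 4 = (k * mu + 1) * amp"
    using p k by auto
  have N: "xi_minus F $ 2 = - mu * s" "xi_minus F $ 3 = - (k - mu) * s" "xi_minus F $ 4 = (k * mu + 1) * s"
    using n k by auto
  have O: "2 * (amp * s) * disc = 1"
    using xi_Omega unfolding Omega_eq P N amp_def[symmetric] s_def[symmetric] disc_def slope_def by algebra
  have "(norm (xi_plus F))\<^sup>2 = (norm (xi_minus F))\<^sup>2" using xi_norm by simp
  then have "amp\<^sup>2 * (1 + mu\<^sup>2 + (k - mu)\<^sup>2 + (k * mu + 1)\<^sup>2) = s\<^sup>2 * (1 + mu\<^sup>2 + (k - mu)\<^sup>2 + (k * mu + 1)\<^sup>2)"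
    unfolding norm_sq_4 P N amp_def[symmetric] s_def[symmetric] by algebra
  moreover have "1 + mu\<^sup>2 + (k - mu)\<^sup>2 + (k * mu + 1)\<^sup>2 > 0" by (simp add: add_pos_nonneg)
  ultimately have "amp\<^sup>2 = s\<^sup>2" by simp
  then have "s = amp \<or> s = - amp" by (auto simp: power2_eq_iff)
  moreover have "s \<noteq> - amp"
  proof
    assume "s = - amp"
    then have "- (2 * amp\<^sup>2 * disc) = 1" using O by (simp add: power2_eq_square)
    moreover have "2 * amp\<^sup>2 * disc \<ge> 0" using disc_pos by simp
    ultimately show False by linarith
  qed
  ultimately have s: "s = amp" by blast
  then show "xi_minus F $ 1 = amp" by (simp add: s_def)
  show "2 * amp\<^sup>2 * disc = 1" using O s by (simp add: power2_eq_square)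
  have "Omega (Q0 \<alpha>) (xi_plus F) = q0 \<alpha> * (k * amp)"
    unfolding Omega_eq P Q0_def vector_4 by algebra
  then have "q0 \<alpha> * (k * amp) > 0" using xi_sign by simp
  then show "0 < amp" using q0_pos[OF alpha_pos] k_pos by (simp add: zero_less_mult_iff)
qed

lemma xi_nth:
  "xi_plus F $ 1 = amp" "xi_plus F $ 2 = mu * amp" "xi_plus F $ 3 = (k - mu) * amp" "xi_plus F $ 4 = (k * mu + 1) * amp"
  "xi_minus F $ 1 = amp" "xi_minus F $ 2 = - mu * amp" "xi_minus F $ 3 = - (k - mu) * amp" "xi_minus F $ 4 = (k * mu + 1) * amp"
proof -
  have k: "k \<noteq> 0" using k_pos by simp
  have c: "(-k)\<^sup>2 = k\<^sup>2" by simp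
  show "xi_plus F $ 1 = amp" by (simp add: amp_def)
  show "xi_plus F $ 2 = mu * amp" "xi_plus F $ 3 = (k - mu) * amp" "xi_plus F $ 4 = (k * mu + 1) * amp"
    using eigenvector_components[OF xi_eigen(1) refl, folded amp_def] k by auto
  show "xi_minus F $ 1 = amp" by (fact xi_minus_amp)
  show "xi_minus F $ 2 = - mu * amp" "xi_minus F $ 3 = - (k - mu) * amp" "xi_minus F $ 4 = (k * mu + 1) * amp"
    using eigenvector_components[OF xi_eigen(2) c, unfolded xi_minus_amp] k by auto
qed

text \<open>The constant is \<omega>^2 in disguise, since det A = - k^2 \<omega>^2 = - m^3. It is
  computed from \<open>k\<close> by components because the given frequency is tied to
  \<open>k\<close> only in \<open>freq_sq\<close>, with the help of this lemma.\<close>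

lemma plane_linop_sq:
  assumes g: "Omega g (xi_plus F) = 0" "Omega g (xi_minus F) = 0"
  shows "linop \<alpha> *v (linop \<alpha> *v g) = - (m ^ 3 / k\<^sup>2) *\<^sub>R g"
proof -
  have k: "k \<noteq> 0" and a: "amp \<noteq> 0" and mu: "mu \<noteq> 0" using k_pos amp_pos mu_bounds by auto
  have "2 * amp * (g $ 3 - g $ 2 * (k * mu + 1)) = 0" "2 * amp * ((k - mu) * g $ 1 - mu * g $ 4) = 0"
    using g unfolding Omega_eq xi_nth by algebra+
  then have 3: "g $ 3 = g $ 2 * (k * mu + 1)" and 4: "mu * g $ 4 = (k - mu) * g $ 1" using a by simp_all
  have m2': "m\<^sup>2 = k\<^sup>2 - 2 * k * mu" using m2 by (simp add: slope_def power2_eq_square algebra_simps)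
  have mu': "k\<^sup>2 * mu = - 2 * k - m * mu" by (rule mu_eq)
  have "k * (k * (k * mu + 2)) = k * (- m * mu)" using mu' by algebra
  then have mu2: "k * (k * mu + 2) = - m * mu" using k by simp
  \<comment> \<open>Clears the denominator and allows an extra factor \<open>mu\<close>, so that
    each component becomes a polynomial identity.\<close>
  have e: "x = - (m ^ 3 / k\<^sup>2) * y" if "(mu * k\<^sup>2) * (k\<^sup>2 * x + m ^ 3 * y) = 0" for x y :: real
  proof -
    have "k\<^sup>2 * x + m ^ 3 * y = 0" using that k mu by simp
    then have "k\<^sup>2 * x = k\<^sup>2 * (- (m ^ 3 / k\<^sup>2) * y)" using k by simp
    then show ?thesis using k by (simp only: mult_cancel_left) auto
  qed
  show ?thesis unfolding vec4_eq_iff linop_nth[OF alpha_pos] vector_scaleR_component real_scaleR_def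
  proof (intro conjI; rule e)
    show "mu * k\<^sup>2 * (k\<^sup>2 * (g $ 4 - g $ 1 + m\<^sup>2 * g $ 1 + (g $ 4 - g $ 1)) + m ^ 3 * g $ 1) = 0"
      using 4 m2' mu2 mu' by algebra
    show "mu * k\<^sup>2 * (k\<^sup>2 * (- (g $ 3 + g $ 2) - m * g $ 2 - (g $ 3 + g $ 2)) + m ^ 3 * g $ 2) = 0"
      using 3 m2' mu2 mu' by algebra
    show "mu * k\<^sup>2 * (k\<^sup>2 * (- (g $ 3 + g $ 2) - m * g $ 2 - (g $ 3 + g $ 2) + m\<^sup>2 * (g $ 3 + g $ 2)) + m ^ 3 * g $ 3) = 0"
      using 3 m2' mu2 mu' by algebra
    show "mu * k\<^sup>2 * (k\<^sup>2 * (- (g $ 4 - g $ 1 + m\<^sup>2 * g $ 1 + (g $ 4 - g $ 1)) - m * (g $ 4 - g $ 1)) + m ^ 3 * g $ 4) = 0"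
      using 4 m2' mu2 mu' by algebra
  qed
qed

lemma linop_scaleR: "linop \<alpha> *v (c *\<^sub>R x) = c *\<^sub>R (linop \<alpha> *v x)"
  by (rule matrix_vector_mult_scaleR)

text \<open>A^2 is self-adjoint for \<Omega>, and it takes the different values -\<omega>^2 and k^2
  on the two vectors.\<close>

lemma center_Omega_zero:
  assumes g: "linop \<alpha> *v (linop \<alpha> *v g) = - (freq F)\<^sup>2 *\<^sub>R g"
  shows "Omega g (xi_plus F) = 0" "Omega g (xi_minus F) = 0"
proof -
  have *: "Omega g x = 0" if x: "linop \<alpha> *v (linop \<alpha> *v x) = k\<^sup>2 *\<^sub>R x" for x
  proof -
    have "- (freq F)\<^sup>2 * Omega g x = Omega (linop \<alpha> *v (linop \<alpha> *v g)) x" by (simp only: g Omega_linear)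
    also have "\<dots> = Omega g (linop \<alpha> *v (linop \<alpha> *v x))" by (simp add: Omega_linop[OF alpha_pos])
    also have "\<dots> = k\<^sup>2 * Omega g x" by (simp only: x Omega_linear)
    finally have "(k\<^sup>2 + (freq F)\<^sup>2) * Omega g x = 0" by (simp add: algebra_simps)
    moreover have "k\<^sup>2 + (freq F)\<^sup>2 > 0" using k_pos by (simp add: add_pos_nonneg)
    ultimately show ?thesis by (metis mult_eq_0_iff less_irrefl)
  qed
  show "Omega g (xi_plus F) = 0"
    by (rule *) (simp only: xi_eigen linop_scaleR scaleR_scaleR power2_eq_square)
  show "Omega g (xi_minus F) = 0"
    by (rule *) (simp only: xi_eigen linop_scaleR scaleR_scaleR power2_eq_square minus_mult_minus)
qed

text \<open>An eigenvector for i\<omega> has a nonzero real or imaginary part. On it A^2 acts as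
  -\<omega>^2 by choice, and as the constant of \<open>plane_linop_sq\<close> by
  orthogonality.\<close>

lemma freq_sq: "(freq F)\<^sup>2 = m ^ 3 / k\<^sup>2"
proof -
  have "\<i> * complex_of_real (freq F) \<in> eigenvalues (linop \<alpha>)"
    using frame by (simp add: is_frame_def)
  then obtain v where v: "cmat (linop \<alpha>) *v v = (\<i> * complex_of_real (freq F)) *s v" "v \<noteq> 0"
    unfolding eigenvalues_def eigenspace_def by auto
  define g where "g = (\<chi> i. Re (v $ i))"
  define h where "h = (\<chi> i. Im (v $ i))"
  have "(\<Sum>j\<in>UNIV. complex_of_real (linop \<alpha> $ i $ j) * v $ j) = \<i> * complex_of_real (freq F) * v $ i" for i
    using arg_cong[OF v(1), of "\<lambda>u. u $ i"] by (simp add: matrix_vector_mult_def cmat_def)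
  from arg_cong[OF this, of Re] arg_cong[OF this, of Im]
  have Ag: "linop \<alpha> *v g = - freq F *\<^sub>R h" and Ah: "linop \<alpha> *v h = freq F *\<^sub>R g"
    by (simp_all add: vec_eq_iff matrix_vector_mult_def g_def h_def)
  have g2: "linop \<alpha> *v (linop \<alpha> *v g) = - (freq F)\<^sup>2 *\<^sub>R g"
    unfolding Ag linop_scaleR Ah by (simp add: power2_eq_square)
  have h2: "linop \<alpha> *v (linop \<alpha> *v h) = - (freq F)\<^sup>2 *\<^sub>R h"
    unfolding Ah linop_scaleR Ag by (simp add: power2_eq_square)
  have "g \<noteq> 0 \<or> h \<noteq> 0" using v(2) by (auto simp: vec_eq_iff g_def h_def complex_eq_iff)
  then obtain x where x: "x \<noteq> 0" "linop \<alpha> *v (linop \<alpha> *v x) = - (freq F)\<^sup>2 *\<^sub>R x"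
    using g2 h2 by blast
  have "- (freq F)\<^sup>2 *\<^sub>R x = - (m ^ 3 / k\<^sup>2) *\<^sub>R x"
    using plane_linop_sq[OF center_Omega_zero[OF x(2)]] x(2) by simp
  then show ?thesis using x(1) by simp
qed

text \<open>Each coordinate is a pairing with the opposite eigenvector, because
  \<open>\<Omega>(\<xi>\<^sub>+, \<xi>\<^sub>-) = 1\<close> and the centre plane is
  \<Omega>-orthogonal to both.\<close>

lemma coords_eq:
  "coords \<alpha> F X = (Omega X (xi_minus F), - Omega X (xi_plus F),
    X - Omega X (xi_minus F) *\<^sub>R xi_plus F + Omega X (xi_plus F) *\<^sub>R xi_minus F)"
  unfolding coords_def
proof (rule the_equality)
  have s: "Omega (xi_minus F) (xi_plus F) = -1" using xi_Omega Omega_swap by metis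
  have z: "Omega u u = 0" for u unfolding Omega_eq by simp
  let ?g = "X - Omega X (xi_minus F) *\<^sub>R xi_plus F + Omega X (xi_plus F) *\<^sub>R xi_minus F"
  have "?g \<in> center_plane \<alpha> F"
    unfolding center_plane_iff[OF freq_pos] freq_sq
    by (rule plane_linop_sq) (simp_all add: Omega_linear s z xi_Omega)
  then show "case (Omega X (xi_minus F), - Omega X (xi_plus F), ?g) of (a, b, \<gamma>) \<Rightarrow>
    \<gamma> \<in> center_plane \<alpha> F \<and> X = a *\<^sub>R xi_plus F + b *\<^sub>R xi_minus F + \<gamma>" by simp
  fix t assume "case t of (a, b, \<gamma>) \<Rightarrow>
    \<gamma> \<in> center_plane \<alpha> F \<and> X = a *\<^sub>R xi_plus F + b *\<^sub>R xi_minus F + \<gamma>"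
  then obtain a b \<gamma> where t: "t = (a, b, \<gamma>)" and g: "\<gamma> \<in> center_plane \<alpha> F"
    and X: "X = a *\<^sub>R xi_plus F + b *\<^sub>R xi_minus F + \<gamma>" by (cases t) auto
  note g0 = center_Omega_zero[OF g[unfolded center_plane_iff[OF freq_pos]]]
  have "Omega X (xi_minus F) = a" "Omega X (xi_plus F) = - b"
    unfolding X Omega_linear g0 xi_Omega s z by simp_all
  then show "t = (Omega X (xi_minus F), - Omega X (xi_plus F), ?g)" using X t by simp
qed

section \<open>The linearized energy norm in positions and velocities\<close>

lemma lam1_eq: "lam1 \<alpha> F X = amp * (slope * X $ 1 - mu * (X $ 4 - X $ 1))"
  unfolding lam1_def lam_plus_def lam_minus_def coords_eq fst_conv snd_conv Omega_eq xi_nth slope_def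
  by (simp add: field_simps)

text \<open>\<Omega>(X, A X) is the Hessian form of the energy. In the frame it reads \<open>- 2 * k
  * \<lambda>\<^sub>+ * \<lambda>\<^sub>- + \<Omega>(\<gamma>, A \<gamma>)\<close>, and adding
  \<open>k * (\<lambda>\<^sub>+ + \<lambda>\<^sub>-)\<^sup>2\<close> turns the indefinite product
  into a sum of squares. This avoids a basis of the centre plane.\<close>

lemma normE_sq_eq:
  "normE_sq \<alpha> F X = ((X $ 3 + X $ 2)\<^sup>2 + (X $ 4 - X $ 1)\<^sup>2 - m\<^sup>2 * (X $ 1)\<^sup>2 + m * (X $ 2)\<^sup>2) / 2
    + 2 * k * (lam1 \<alpha> F X)\<^sup>2"
proof -
  define p where "p = lam_plus \<alpha> F X"
  define n where "n = lam_minus \<alpha> F X"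
  define g where "g = center_part \<alpha> F X"
  let ?u = "xi_plus F" and ?s = "xi_minus F" and ?A = "linop \<alpha>"
  have s: "Omega ?s ?u = -1" using xi_Omega Omega_swap by metis
  have z: "Omega u u = 0" for u unfolding Omega_eq by simp
  have p: "p = Omega X ?s" and n: "n = - Omega X ?u"
    and g: "g = X - Omega X ?s *\<^sub>R ?u + Omega X ?u *\<^sub>R ?s"
    unfolding p_def n_def g_def lam_plus_def lam_minus_def center_part_def coords_eq by simp_all
  have X: "X = p *\<^sub>R ?u + n *\<^sub>R ?s + g" unfolding p n g by simp
  have gu: "Omega g ?u = 0" "Omega g ?s = 0" unfolding g by (simp_all add: Omega_linear s z xi_Omega)
  have ug: "Omega ?u (?A *v g) = 0" "Omega ?s (?A *v g) = 0"
    using gu Omega_linop[OF alpha_pos, of ?u g, unfolded xi_eigen Omega_linear]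
      Omega_linop[OF alpha_pos, of ?s g, unfolded xi_eigen Omega_linear]
      Omega_swap[of ?u g] Omega_swap[of ?s g] by simp_all
  have AX: "?A *v X = (p * k) *\<^sub>R ?u + (- n * k) *\<^sub>R ?s + ?A *v g"
    by (subst X) (simp add: matrix_vector_right_distrib linop_scaleR xi_eigen)
  have "Omega X (?A *v X) = Omega (p *\<^sub>R ?u + n *\<^sub>R ?s + g) ((p * k) *\<^sub>R ?u + (- n * k) *\<^sub>R ?s + ?A *v g)"
    using X AX by simp
  also have "\<dots> = - 2 * k * p * n + Omega g (?A *v g)"
    unfolding Omega_linear gu ug z s xi_Omega by (simp add: algebra_simps)
  finally have "Omega g (?A *v g) = Omega X (?A *v X) + 2 * k * p * n" by simp
  then have "normE_sq \<alpha> F X = Omega X (?A *v X) / 2 + k / 2 * (p + n)\<^sup>2"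
    unfolding normE_sq_def p_def[symmetric] n_def[symmetric] g_def[symmetric]
    by (simp add: power2_sum field_simps)
  also have "k / 2 * (p + n)\<^sup>2 = 2 * k * (lam1 \<alpha> F X)\<^sup>2"
    unfolding lam1_def p_def[symmetric] n_def[symmetric] by (simp add: power_divide)
  also have "Omega X (?A *v X) = (X $ 3 + X $ 2)\<^sup>2 + (X $ 4 - X $ 1)\<^sup>2 - m\<^sup>2 * (X $ 1)\<^sup>2 + m * (X $ 2)\<^sup>2"
    unfolding Omega_eq linop_nth[OF alpha_pos] by (simp add: power2_eq_square algebra_simps)
  finally show ?thesis .
qed

text \<open>The form splits into a part in x and the y velocity and a part in y and the x velocity.
  The second is visibly positive; the work lies in the first.\<close>

lemma normE_sq_lower: "\<exists>c>0. \<forall>X. c * (norm X)\<^sup>2 \<le> normE_sq \<alpha> F X"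
proof -
  \<comment> \<open>The smaller eigenvalue of the first part relative to
    \<open>v\<^sup>2 + m\<^sup>2 * x\<^sup>2\<close>: the defect in \<open>q\<close> below is a
    multiple of \<open>(v + m * x)\<^sup>2\<close>. Positivity comes from a difference of two
    squares that equals \<open>disc\<^sup>2\<close>.\<close>
  define c0 where "c0 = (slope + k * mu\<^sup>2 + 2 * m * mu) / (2 * disc)"
  have c0: "c0 > 0"
  proof -
    have "(slope + k * mu\<^sup>2)\<^sup>2 - (- 2 * m * mu)\<^sup>2 = disc\<^sup>2"
      using m2 unfolding disc_def by algebra
    then have "(- 2 * m * mu)\<^sup>2 < (slope + k * mu\<^sup>2)\<^sup>2" using disc_pos
      by (smt (verit) zero_less_power)
    moreover have "0 \<le> slope + k * mu\<^sup>2" using slope_pos k_pos by simp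
    ultimately have "- 2 * m * mu < slope + k * mu\<^sup>2" by (rule power_less_imp_less_base)
    then have "0 < slope + k * mu\<^sup>2 + 2 * m * mu" by (simp add: algebra_simps)
    then show ?thesis using disc_pos by (simp add: c0_def)
  qed
  have q: "c0 * (v\<^sup>2 + m\<^sup>2 * x\<^sup>2) \<le> (v\<^sup>2 - m\<^sup>2 * x\<^sup>2) / 2 + 2 * k * (amp * (slope * x - mu * v))\<^sup>2" for x v
  proof -
    have "2 * disc * (2 * k * (amp * (slope * x - mu * v))\<^sup>2) = 2 * k * (2 * amp\<^sup>2 * disc) * (slope * x - mu * v)\<^sup>2"
      by algebra
    then have e: "2 * disc * (2 * k * (amp * (slope * x - mu * v))\<^sup>2) = 2 * k * (slope * x - mu * v)\<^sup>2"
      unfolding amp_sq by simp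
    have "0 \<le> (2 * m) * (- mu) * (v + m * x)\<^sup>2" using mu_bounds alpha by (intro mult_nonneg_nonneg) auto
    also have "\<dots> = disc * (v\<^sup>2 - m\<^sup>2 * x\<^sup>2) + 2 * k * (slope * x - mu * v)\<^sup>2
       - (slope + k * mu\<^sup>2 + 2 * m * mu) * (v\<^sup>2 + m\<^sup>2 * x\<^sup>2)"
      using m2 unfolding disc_def by algebra
    finally have "(slope + k * mu\<^sup>2 + 2 * m * mu) * (v\<^sup>2 + m\<^sup>2 * x\<^sup>2)
      \<le> disc * (v\<^sup>2 - m\<^sup>2 * x\<^sup>2) + 2 * disc * (2 * k * (amp * (slope * x - mu * v))\<^sup>2)"
      using e by linarith
    also have "\<dots> = 2 * disc * ((v\<^sup>2 - m\<^sup>2 * x\<^sup>2) / 2 + 2 * k * (amp * (slope * x - mu * v))\<^sup>2)"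
      by (simp add: ring_distribs)
    finally have "(slope + k * mu\<^sup>2 + 2 * m * mu) * (v\<^sup>2 + m\<^sup>2 * x\<^sup>2)
      \<le> 2 * disc * ((v\<^sup>2 - m\<^sup>2 * x\<^sup>2) / 2 + 2 * k * (amp * (slope * x - mu * v))\<^sup>2)" .
    then show ?thesis using disc_pos unfolding c0_def by (simp add: field_simps)
  qed
  define c where "c = min (c0 / 3) (1/6)"
  have "c * (norm X)\<^sup>2 \<le> normE_sq \<alpha> F X" for X
  proof -
    define x y a b where "x = X $ 1" and "y = X $ 2" and "a = X $ 3 + X $ 2" and "b = X $ 4 - X $ 1"
    have m1: "m \<ge> 1" "m\<^sup>2 \<ge> 1" using alpha by auto
    have "(norm X)\<^sup>2 = x\<^sup>2 + y\<^sup>2 + (a - y)\<^sup>2 + (b + x)\<^sup>2"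
      unfolding norm_sq_4 x_def y_def a_def b_def by simp
    also have "\<dots> \<le> 3 * (b\<^sup>2 + x\<^sup>2) + 3 * (a\<^sup>2 + y\<^sup>2)"
    proof -
      have "0 \<le> (a + y)\<^sup>2 + (b - x)\<^sup>2 + a\<^sup>2 + b\<^sup>2" by simp
      then show ?thesis by (simp add: power2_eq_square algebra_simps)
    qed
    finally have "c * (norm X)\<^sup>2 \<le> c * (3 * (b\<^sup>2 + x\<^sup>2) + 3 * (a\<^sup>2 + y\<^sup>2))"
      using c0 by (intro mult_left_mono) (auto simp: c_def)
    also have "\<dots> = c * (3 * (b\<^sup>2 + x\<^sup>2)) + c * (3 * (a\<^sup>2 + y\<^sup>2))" by (simp add: algebra_simps)
    also have "\<dots> \<le> (c0 / 3) * (3 * (b\<^sup>2 + x\<^sup>2)) + (1/6) * (3 * (a\<^sup>2 + y\<^sup>2))"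
      by (intro add_mono mult_right_mono) (auto simp: c_def)
    also have "\<dots> \<le> c0 * (b\<^sup>2 + m\<^sup>2 * x\<^sup>2) + (a\<^sup>2 + m * y\<^sup>2) / 2"
    proof -
      have "c0 * (b\<^sup>2 + 1 * x\<^sup>2) \<le> c0 * (b\<^sup>2 + m\<^sup>2 * x\<^sup>2)" using c0 m1
        by (intro mult_left_mono add_left_mono mult_right_mono) auto
      moreover have "1 * y\<^sup>2 \<le> m * y\<^sup>2" using m1 by (intro mult_right_mono) auto
      moreover have "(c0 / 3) * (3 * (b\<^sup>2 + x\<^sup>2)) = c0 * (b\<^sup>2 + 1 * x\<^sup>2)" by simp
      ultimately show ?thesis by argo
    qed
    also have "\<dots> \<le> normE_sq \<alpha> F X"
      using q[of b x] unfolding normE_sq_eq lam1_eq a_def[symmetric] b_def[symmetric]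
      unfolding x_def[symmetric] y_def[symmetric] by argo
    finally show ?thesis .
  qed
  moreover have "c > 0" using c0 by (simp add: c_def)
  ultimately show ?thesis by blast
qed

lemma normE_sq_upper: "\<exists>C>0. \<forall>X. normE_sq \<alpha> F X \<le> C * (norm X)\<^sup>2"
proof -
  define C where "C = 4 + m + 2 * k * (amp * (slope - 2 * mu))\<^sup>2"
  have "normE_sq \<alpha> F X \<le> C * (norm X)\<^sup>2" for X
  proof -
    define n where "n = norm X"
    have c: "\<bar>X $ i\<bar> \<le> n" for i unfolding n_def by (rule component_le_norm_cart)
    have sq: "t\<^sup>2 \<le> (s * n)\<^sup>2" if "\<bar>t\<bar> \<le> s * n" for t s :: real
      using that by (simp add: abs_le_square_iff[symmetric])
    have 1: "(X $ 3 + X $ 2)\<^sup>2 \<le> (2 * n)\<^sup>2" using c[of 3] c[of 2] by (intro sq) linarith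
    have 2: "(X $ 4 - X $ 1)\<^sup>2 \<le> (2 * n)\<^sup>2" using c[of 4] c[of 1] by (intro sq) linarith
    have 3: "m * (X $ 2)\<^sup>2 \<le> m * n\<^sup>2" using sq[of "X $ 2" 1] c[of 2] alpha by (intro mult_left_mono) auto
    have "\<bar>slope * X $ 1 - mu * (X $ 4 - X $ 1)\<bar> \<le> \<bar>slope * X $ 1\<bar> + \<bar>mu * (X $ 4 - X $ 1)\<bar>"
      by (rule abs_triangle_ineq4)
    also have "\<dots> \<le> slope * n + (- mu) * (2 * n)"
    proof (rule add_mono)
      show "\<bar>slope * X $ 1\<bar> \<le> slope * n"
        using mult_left_mono[OF c[of 1], of slope] slope_pos by (simp add: abs_mult)
      have "\<bar>X $ 4 - X $ 1\<bar> \<le> 2 * n" using c[of 4] c[of 1] by linarith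
      then show "\<bar>mu * (X $ 4 - X $ 1)\<bar> \<le> - mu * (2 * n)"
        using mult_left_mono[of "\<bar>X $ 4 - X $ 1\<bar>" "2 * n" "- mu"] mu_bounds by (simp add: abs_mult)
    qed
    finally have "\<bar>amp * (slope * X $ 1 - mu * (X $ 4 - X $ 1))\<bar> \<le> amp * (slope * n + (- mu) * (2 * n))"
      unfolding abs_mult using amp_pos by (simp add: mult_left_mono)
    then have "(lam1 \<alpha> F X)\<^sup>2 \<le> ((amp * (slope - 2 * mu)) * n)\<^sup>2"
      unfolding lam1_eq by (intro sq) (simp add: algebra_simps)
    then have 4: "2 * k * (lam1 \<alpha> F X)\<^sup>2 \<le> 2 * k * ((amp * (slope - 2 * mu)) * n)\<^sup>2"
      using k_pos by (intro mult_left_mono) auto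
    have 5: "0 \<le> m\<^sup>2 * (X $ 1)\<^sup>2" "0 \<le> m * n\<^sup>2" using alpha by auto
    have combine: "(p + q - r + s) / 2 + t \<le> (P + Q + S) / 2 + T"
      if "p \<le> P" "q \<le> Q" "0 \<le> r" "s \<le> S" "t \<le> T" for p q r s t P Q S T :: real
      using that by argo
    have "normE_sq \<alpha> F X \<le> ((2 * n)\<^sup>2 + (2 * n)\<^sup>2 + m * n\<^sup>2) / 2 + 2 * k * ((amp * (slope - 2 * mu)) * n)\<^sup>2"
      unfolding normE_sq_eq by (rule combine[OF 1 2 5(1) 3 4])
    also have "\<dots> \<le> C * n\<^sup>2" using 5 unfolding C_def power_mult_distrib by (simp add: algebra_simps)
    finally show ?thesis by (simp add: n_def)
  qed
  moreover have "C > 0" using k_pos alpha unfolding C_def by (intro add_pos_nonneg) auto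
  ultimately show ?thesis by blast
qed

end

subsection \<open>Virial estimates\<close>

lemma abs_le_of_sq_le:
  fixes a b :: real
  assumes "a\<^sup>2 \<le> b\<^sup>2" "0 \<le> b"
  shows "\<bar>a\<bar> \<le> b"
  using assms by (metis abs_of_nonneg abs_le_square_iff)

context hill_frame
begin

abbreviation q :: real where "q \<equiv> q0 \<alpha>"

lemma q_pos: "0 < q" by (rule q0_pos[OF alpha_pos])

definition vsq :: "phase \<Rightarrow> real"
  where "vsq \<phi> = (\<phi> $ 3 + \<phi> $ 2)\<^sup>2 + (\<phi> $ 4 - \<phi> $ 1)\<^sup>2"

text \<open>Positive in the disc r < q0 and zero on its boundary circle, which carries both ground
  states. \<open>1 - gap\<close> is the normalized squared radius, and \<open>Zed\<close> is the
  potential \<open>r powr (-\<alpha>)\<close> normalized to 1 on the circle.\<close>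

definition gap :: "phase \<Rightarrow> real" where "gap \<phi> = 1 - wsq \<phi> / q\<^sup>2"

definition Zed :: "phase \<Rightarrow> real" where "Zed \<phi> = (1 - gap \<phi>) powr (- (\<alpha> / 2))"

definition excess :: "phase \<Rightarrow> real" where "excess \<phi> = energy \<alpha> \<phi> - E_star \<alpha>"

text \<open>Along the flow, \<open>wsq / 2\<close> has first derivative \<open>radial\<close> and second derivative \<open>virial\<close>.\<close>

definition radial :: "phase \<Rightarrow> real"
  where "radial \<phi> = \<phi> $ 1 * (\<phi> $ 3 + \<phi> $ 2) + \<phi> $ 2 * (\<phi> $ 4 - \<phi> $ 1)"

definition virial :: "phase \<Rightarrow> real"
  where "virial \<phi> = vsq \<phi> + 2 * (\<phi> $ 1 * (\<phi> $ 4 - \<phi> $ 1) - \<phi> $ 2 * (\<phi> $ 3 + \<phi> $ 2))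
    + m * (\<phi> $ 1)\<^sup>2 - hforce \<alpha> \<phi> * wsq \<phi>"

lemma wsq_gap: "wsq \<phi> = q\<^sup>2 * (1 - gap \<phi>)"
  using q_pos by (simp add: gap_def)

lemma gap_lt_1: "\<phi> \<in> phase_space \<Longrightarrow> 0 < 1 - gap \<phi>"
  using q_pos by (simp add: gap_def phase_space_iff)

lemma q_powr: "q\<^sup>2 powr (- \<alpha> / 2) = q\<^sup>2 / \<alpha>"
proof -
  have "q\<^sup>2 powr (- \<alpha> / 2) = q\<^sup>2 powr (1 + -(\<alpha> + 2) / 2)"
    by (rule arg_cong[of _ _ "\<lambda>t. q\<^sup>2 powr t"]) (simp add: field_simps)
  also have "\<dots> = q\<^sup>2 powr 1 * q\<^sup>2 powr (-(\<alpha> + 2) / 2)" by (rule powr_add)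
  finally show ?thesis unfolding q0_powr[OF alpha_pos] using q_pos by simp
qed

lemma wsq_powr:
  assumes "\<phi> \<in> phase_space"
  shows "wsq \<phi> powr (- \<alpha> / 2) = q\<^sup>2 / \<alpha> * Zed \<phi>"
proof -
  have "wsq \<phi> powr (- \<alpha> / 2) = q\<^sup>2 powr (- \<alpha> / 2) * (1 - gap \<phi>) powr (- \<alpha> / 2)"
    unfolding wsq_gap using gap_lt_1[OF assms] by (simp add: powr_mult)
  then show ?thesis unfolding q_powr Zed_def by simp
qed

lemma hforce_gap:
  assumes "\<phi> \<in> phase_space"
  shows "hforce \<alpha> \<phi> = m * (1 - gap \<phi>) powr (- (m / 2))"
proof -
  have "wsq \<phi> powr (- m / 2) = q\<^sup>2 powr (- m / 2) * (1 - gap \<phi>) powr (- m / 2)"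
    unfolding wsq_gap using gap_lt_1[OF assms] by (simp add: powr_mult)
  moreover have "- m / 2 = - (m / 2)" by (simp only: minus_divide_left)
  ultimately have "wsq \<phi> powr (- m / 2) = 1 / \<alpha> * (1 - gap \<phi>) powr (- (m / 2))"
    unfolding q0_powr[OF alpha_pos] by (simp only:)
  then show ?thesis unfolding hforce_def using alpha_pos by simp
qed

lemma hforce_wsq:
  assumes "\<phi> \<in> phase_space"
  shows "hforce \<alpha> \<phi> * wsq \<phi> = m * q\<^sup>2 * Zed \<phi>"
proof -
  have p: "0 < 1 - gap \<phi>" by (rule gap_lt_1[OF assms])
  have e: "- (m / 2) + 1 = - (\<alpha> / 2)" by (simp add: field_simps)
  have "(1 - gap \<phi>) powr (- (m / 2)) * (1 - gap \<phi>) = (1 - gap \<phi>) powr (- (m / 2)) * (1 - gap \<phi>) powr 1"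
    using p by simp
  also have "\<dots> = Zed \<phi>" unfolding Zed_def powr_add[symmetric] e ..
  finally show ?thesis unfolding hforce_gap[OF assms] wsq_gap by (simp add: mult_ac)
qed

lemma E_star_eq: "E_star \<alpha> = - m / 2 * q\<^sup>2 - m * (q\<^sup>2 / \<alpha>)"
  unfolding E_star_def energy_eq[OF ground_phase_space[OF alpha_pos]] wsq_ground q_powr by (simp add: field_simps)

lemma vsq_eq:
  assumes "\<phi> \<in> phase_space"
  shows "vsq \<phi> = 2 * excess \<phi> + m * (\<phi> $ 1)\<^sup>2 + 2 * m * (q\<^sup>2 / \<alpha> * Zed \<phi>) - m * q\<^sup>2 - 2 * m * (q\<^sup>2 / \<alpha>)"
  unfolding excess_def E_star_eq energy_eq[OF assms] wsq_powr[OF assms] vsq_def by argo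

lemma virial_eq:
  assumes "\<phi> \<in> phase_space"
  shows "virial \<phi> = vsq \<phi> + 2 * (\<phi> $ 1 * (\<phi> $ 4 - \<phi> $ 1) - \<phi> $ 2 * (\<phi> $ 3 + \<phi> $ 2))
    + m * (\<phi> $ 1)\<^sup>2 - m * q\<^sup>2 * Zed \<phi>"
  unfolding virial_def hforce_wsq[OF assms] ..

lemma Zed_ge_1:
  assumes "\<phi> \<in> phase_space" "0 \<le> gap \<phi>"
  shows "1 \<le> Zed \<phi>"
proof -
  have "1 powr (- (\<alpha> / 2)) \<le> (1 - gap \<phi>) powr (- (\<alpha> / 2))"
    using gap_lt_1[OF assms(1)] assms(2) alpha_pos by (intro powr_mono2') auto
  then show ?thesis by (simp add: Zed_def)
qed

text \<open>Lagrange's identity: the defect is the square of \<open>radial\<close>.\<close>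

lemma cross_sq_le: "(\<phi> $ 1 * (\<phi> $ 4 - \<phi> $ 1) - \<phi> $ 2 * (\<phi> $ 3 + \<phi> $ 2))\<^sup>2 \<le> wsq \<phi> * vsq \<phi>"
proof -
  have "wsq \<phi> * vsq \<phi> - (\<phi> $ 1 * (\<phi> $ 4 - \<phi> $ 1) - \<phi> $ 2 * (\<phi> $ 3 + \<phi> $ 2))\<^sup>2 = (radial \<phi>)\<^sup>2"
    unfolding wsq_def vsq_def radial_def by algebra
  then show ?thesis using zero_le_power2[of "radial \<phi>"] by linarith
qed

text \<open>
  Below the ground state energy, the Coriolis term in the virial identity is dominated by the
  remaining terms inside the disc \<open>r \<le> q\<^sub>0\<close>; this is where \<open>\<alpha> \<ge> 2\<close> enters.
\<close>

lemma virial_inside: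
  assumes ps: "\<phi> \<in> phase_space" and g: "0 \<le> gap \<phi>" and e: "excess \<phi> \<le> \<epsilon>\<^sup>2" "0 \<le> \<epsilon>" "\<epsilon> \<le> 1"
  shows "virial \<phi> \<le> - (m * q\<^sup>2 * gap \<phi>) + (2 + 4 * q) * \<epsilon>"
proof -
  define s p Z \<theta> where "s = gap \<phi>" and "p = 1 - s" and "Z = Zed \<phi>" and "\<theta> = 2 / \<alpha>"
  have p: "0 < p" "p \<le> 1" using gap_lt_1[OF ps] g by (simp_all add: p_def s_def)
  \<comment> \<open>The first use of \<alpha> \<ge> 2.\<close>
  have th: "0 < \<theta>" "\<theta> \<le> 1" using alpha by (simp_all add: \<theta>_def)
  have Z: "1 \<le> Z" using Zed_ge_1[OF ps g] by (simp add: Z_def)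
  have s: "0 \<le> s" using g by (simp add: s_def)
  \<comment> \<open>Without the Coriolis term the virial is at most
    \<open>2 * \<epsilon> - m * q\<^sup>2 * f\<close>. It remains to bound the Coriolis term by half
    of \<open>m * q\<^sup>2 * f\<close>, up to O(\<epsilon>).\<close>
  define f where "f = 2 * s + (1 - \<theta>) * (Z - 1)"
  have f: "2 * s \<le> f" "0 \<le> f" using th Z s by (auto simp: f_def)
  \<comment> \<open>Convexity with the exponent \<open>\<alpha> / 2 - 1\<close>, which is
    nonnegative. Multiplied by \<theta>, its coefficient becomes \<open>1 - \<theta>\<close>, the
    one that occurs in \<open>f\<close>.\<close>
  have pZ: "p * Z - 1 \<le> (\<alpha> / 2 - 1) * Z * s"
  proof -
    have "p * Z = p powr 1 * p powr (- (\<alpha> / 2))" using p by (simp add: Z_def Zed_def p_def s_def)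
    also have "\<dots> = p powr (1 + - (\<alpha> / 2))" by (rule powr_add[symmetric])
    also have "1 + - (\<alpha> / 2) = - (\<alpha> / 2 - 1)" by simp
    finally have "p * Z - 1 \<le> (\<alpha> / 2 - 1) * p powr (- (\<alpha> / 2 - 1) - 1) * (1 - p)"
      using powr_convex_tangent[of "\<alpha> / 2 - 1" p] alpha p by simp
    also have "- (\<alpha> / 2 - 1) - 1 = - (\<alpha> / 2)" by simp
    finally show ?thesis by (simp add: Z_def Zed_def p_def s_def)
  qed
  have "\<theta> * (p * Z - 1) \<le> \<theta> * ((\<alpha> / 2 - 1) * Z * s)" using pZ th by (intro mult_left_mono) auto
  also have "\<dots> = (\<theta> * (\<alpha> / 2 - 1)) * Z * s" by simp
  also have "\<theta> * (\<alpha> / 2 - 1) = 1 - \<theta>" using alpha_pos by (simp add: \<theta>_def field_simps)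
  finally have pZ': "\<theta> * (p * Z) \<le> \<theta> + (1 - \<theta>) * Z * s" by (simp add: algebra_simps)
  \<comment> \<open>The left side bounds \<open>wsq * vsq\<close> in units of
    \<open>m * (q\<^sup>2)\<^sup>2\<close> when \<epsilon> = 0. The last bound,
    \<open>f\<^sup>2 / 4\<close>, exceeds the middle one by the square of
    \<open>(1 - \<theta>) * (Z - 1) / 2\<close>.\<close>
  have "p\<^sup>2 + \<theta> * (p * Z) - (1 + \<theta>) * p \<le> s\<^sup>2 + (1 - \<theta>) * s * (Z - 1)"
    using pZ' unfolding p_def by (simp add: power2_eq_square algebra_simps)
  also have "\<dots> \<le> f\<^sup>2 / 4"
  proof -
    have "f\<^sup>2 / 4 = s\<^sup>2 + (1 - \<theta>) * s * (Z - 1) + ((1 - \<theta>) * (Z - 1))\<^sup>2 / 4"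
      unfolding f_def by (simp add: power2_eq_square field_simps)
    then show ?thesis by simp
  qed
  finally have G: "p\<^sup>2 + \<theta> * (p * Z) - (1 + \<theta>) * p \<le> f\<^sup>2 / 4" .
  have x2: "(\<phi> $ 1)\<^sup>2 \<le> q\<^sup>2 * p" using wsq_gap[of \<phi>] zero_le_power2[of "\<phi> $ 2"]
    unfolding wsq_def p_def s_def by linarith
  have m: "4 \<le> m" using alpha by simp
  have v: "vsq \<phi> = 2 * excess \<phi> + m * (\<phi> $ 1)\<^sup>2 + m * q\<^sup>2 * (\<theta> * Z - 1 - \<theta>)"
    unfolding vsq_eq[OF ps] Z_def \<theta>_def using alpha_pos by (simp add: field_simps)
  have "vsq \<phi> \<le> 2 * \<epsilon>\<^sup>2 + m * (q\<^sup>2 * p) + m * q\<^sup>2 * (\<theta> * Z - 1 - \<theta>)"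
    unfolding v using e x2 m by (intro add_mono mult_left_mono) auto
  then have "wsq \<phi> * vsq \<phi> \<le> (q\<^sup>2 * p) * (2 * \<epsilon>\<^sup>2 + m * (q\<^sup>2 * p) + m * q\<^sup>2 * (\<theta> * Z - 1 - \<theta>))"
    using p wsq_gap[of \<phi>] by (simp add: mult_left_mono p_def s_def)
  also have "\<dots> = 2 * q\<^sup>2 * \<epsilon>\<^sup>2 * p + m * (q\<^sup>2)\<^sup>2 * (p\<^sup>2 + \<theta> * (p * Z) - (1 + \<theta>) * p)"
    by (simp add: power2_eq_square algebra_simps)
  also have "\<dots> \<le> 2 * q\<^sup>2 * \<epsilon>\<^sup>2 * 1 + m * (q\<^sup>2)\<^sup>2 * (f\<^sup>2 / 4)"
    using G p m by (intro add_mono mult_left_mono) auto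
  also have "\<dots> \<le> 2 * q\<^sup>2 * \<epsilon>\<^sup>2 * 1 + m * (q\<^sup>2)\<^sup>2 * (m * f\<^sup>2 / 16)"
  proof -
    \<comment> \<open>The second use of \<alpha> \<ge> 2: \<open>m \<ge> 4\<close> replaces sqrt m
      by m / 2, so that the root of the main term is at most
      \<open>m * q\<^sup>2 * f / 4\<close>.\<close>
    have "4 * f\<^sup>2 \<le> m * f\<^sup>2" using m by (intro mult_right_mono) auto
    then have "f\<^sup>2 / 4 \<le> m * f\<^sup>2 / 16" by linarith
    then show ?thesis using m by (intro add_left_mono mult_left_mono) auto
  qed
  also have "\<dots> \<le> (2 * q * \<epsilon> + m * q\<^sup>2 * f / 4)\<^sup>2"
  proof -
    have "0 \<le> 2 * q\<^sup>2 * \<epsilon>\<^sup>2 + 2 * (2 * q * \<epsilon>) * (m * q\<^sup>2 * f / 4)" using q_pos e m f by simp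
    also have "\<dots> = (2 * q * \<epsilon> + m * q\<^sup>2 * f / 4)\<^sup>2 - (2 * q\<^sup>2 * \<epsilon>\<^sup>2 * 1 + m * (q\<^sup>2)\<^sup>2 * (m * f\<^sup>2 / 16))"
      by (simp add: power2_eq_square field_simps)
    finally show ?thesis by linarith
  qed
  finally have "wsq \<phi> * vsq \<phi> \<le> (2 * q * \<epsilon> + m * q\<^sup>2 * f / 4)\<^sup>2" .
  then have "\<bar>\<phi> $ 1 * (\<phi> $ 4 - \<phi> $ 1) - \<phi> $ 2 * (\<phi> $ 3 + \<phi> $ 2)\<bar> \<le> 2 * q * \<epsilon> + m * q\<^sup>2 * f / 4"
    using order_trans[OF cross_sq_le] q_pos e m f by (intro abs_le_of_sq_le) auto
  from mult_left_mono[OF abs_le_D1[OF this], of 2]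
  have c: "2 * (\<phi> $ 1 * (\<phi> $ 4 - \<phi> $ 1) - \<phi> $ 2 * (\<phi> $ 3 + \<phi> $ 2)) \<le> 4 * q * \<epsilon> + m * q\<^sup>2 * f / 2"
    by argo
  have "vsq \<phi> + m * (\<phi> $ 1)\<^sup>2 - m * q\<^sup>2 * Z = 2 * excess \<phi> + 2 * m * (\<phi> $ 1)\<^sup>2 - m * q\<^sup>2 * (1 + \<theta> + (1 - \<theta>) * Z)"
    unfolding v by (simp add: algebra_simps)
  also have "\<dots> \<le> 2 * \<epsilon> + 2 * m * (q\<^sup>2 * p) - m * q\<^sup>2 * (1 + \<theta> + (1 - \<theta>) * Z)"
  proof -
    have "\<epsilon>\<^sup>2 \<le> 1 * \<epsilon>" unfolding power2_eq_square using e by (intro mult_right_mono) auto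
    then show ?thesis using e x2 m by (intro diff_right_mono add_mono mult_left_mono) auto
  qed
  also have "\<dots> = 2 * \<epsilon> - m * q\<^sup>2 * f" unfolding f_def p_def by (simp add: algebra_simps)
  finally have "virial \<phi> \<le> 2 * \<epsilon> + 4 * q * \<epsilon> - m * q\<^sup>2 * f / 2"
    using c unfolding virial_eq[OF ps] Z_def by argo
  moreover have "m * q\<^sup>2 * s \<le> m * q\<^sup>2 * (f / 2)" using m f by (intro mult_left_mono) auto
  ultimately show ?thesis unfolding s_def by argo
qed

text \<open>Close to the circle r = q0 the terms linear in \<open>gap\<close> cancel in the energy
  identity, because \<open>m * x\<^sup>2 = m * q\<^sup>2 * (1 - gap) - m * y\<^sup>2\<close>. What
  is left bounds \<open>vsq + m * y\<^sup>2\<close> by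
  \<open>2 * \<epsilon>\<^sup>2 + K * gap\<^sup>2\<close>, so velocity and y are small with
  \<open>gap\<close> and \<epsilon>. The sign of x selects the ground state.\<close>

lemma near_circle_bound:
  "\<exists>C>0. \<forall>\<phi> \<epsilon>. \<phi> \<in> phase_space \<and> \<bar>gap \<phi>\<bar> \<le> 1/2 \<and> excess \<phi> \<le> \<epsilon>\<^sup>2 \<and> 0 \<le> \<epsilon> \<and> \<epsilon> \<le> 1 \<and> 0 \<le> \<phi> $ 1
    \<longrightarrow> norm (\<phi> - ground \<alpha>) \<le> C * (\<bar>gap \<phi>\<bar> + \<epsilon>)"
proof -
  obtain C0 where C0: "C0 > 0"
    "\<And>p. 1/2 \<le> p \<Longrightarrow> p \<le> 3/2 \<Longrightarrow> \<bar>p powr (- (\<alpha> / 2)) - 1 - (\<alpha> / 2) * (1 - p)\<bar> \<le> C0 * (1 - p)\<^sup>2"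
    using powr_neg_taylor2[of "\<alpha> / 2"] alpha_pos by auto
  define K where "K = m * q\<^sup>2 * (2 / \<alpha>) * C0"
  have K: "K > 0" unfolding K_def using C0 q_pos alpha by simp
  define C where "C = 2 * ((q\<^sup>2 + 2 + K) / q) + 4 * (2 + (K + 1))"
  have "norm (\<phi> - ground \<alpha>) \<le> C * (\<bar>gap \<phi>\<bar> + \<epsilon>)"
    if ps: "\<phi> \<in> phase_space" and g: "\<bar>gap \<phi>\<bar> \<le> 1/2" and e: "excess \<phi> \<le> \<epsilon>\<^sup>2" "0 \<le> \<epsilon>" "\<epsilon> \<le> 1" and x: "0 \<le> \<phi> $ 1"
    for \<phi> \<epsilon>
  proof -
    define s where "s = gap \<phi>"
    define y where "y = \<phi> $ 2"
    have w: "(\<phi> $ 1)\<^sup>2 + y\<^sup>2 = q\<^sup>2 * (1 - s)" using wsq_gap[of \<phi>] by (simp add: wsq_def y_def s_def)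
    have Z: "Zed \<phi> \<le> 1 + (\<alpha> / 2) * s + C0 * s\<^sup>2"
    proof -
      have "1/2 \<le> 1 - s" "1 - s \<le> 3/2" using g unfolding s_def by (simp_all add: abs_le_iff)
      from C0(2)[OF this] show ?thesis unfolding Zed_def s_def[symmetric] by (simp add: abs_le_iff)
    qed
    have "m * (2 * (q\<^sup>2 / \<alpha>)) * Zed \<phi> \<le> m * (2 * (q\<^sup>2 / \<alpha>)) * (1 + (\<alpha> / 2) * s + C0 * s\<^sup>2)"
      using Z alpha by (intro mult_left_mono) auto
    also have "\<dots> = m * (2 * (q\<^sup>2 / \<alpha>)) + m * q\<^sup>2 * s + K * s\<^sup>2"
      unfolding K_def using alpha_pos by (simp add: field_simps)
    finally have "vsq \<phi> \<le> 2 * \<epsilon>\<^sup>2 + m * (\<phi> $ 1)\<^sup>2 + m * q\<^sup>2 * s + K * s\<^sup>2 - m * q\<^sup>2"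
      unfolding vsq_eq[OF ps] using e by argo
    also have "\<dots> = 2 * \<epsilon>\<^sup>2 + K * s\<^sup>2 - m * y\<^sup>2"
    proof -
      have "(\<phi> $ 1)\<^sup>2 = q\<^sup>2 * (1 - s) - y\<^sup>2" using w by simp
      then have "m * (\<phi> $ 1)\<^sup>2 = m * (q\<^sup>2 * (1 - s) - y\<^sup>2)" by (simp only:)
      then show ?thesis by argo
    qed
    finally have v: "vsq \<phi> + m * y\<^sup>2 \<le> 2 * \<epsilon>\<^sup>2 + K * s\<^sup>2" by simp
    have "1 * y\<^sup>2 \<le> m * y\<^sup>2" using alpha by (intro mult_right_mono) auto
    moreover have "0 \<le> vsq \<phi>" by (simp add: vsq_def)
    ultimately have y2: "y\<^sup>2 \<le> 2 * \<epsilon>\<^sup>2 + K * s\<^sup>2" and v2: "vsq \<phi> \<le> 2 * \<epsilon>\<^sup>2 + K * s\<^sup>2"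
      using v zero_le_power2[of y] by linarith+
    define B where "B = 2 * \<epsilon> + (K + 1) * \<bar>s\<bar>"
    have B0: "0 \<le> B" using e K by (simp add: B_def)
    have BB: "2 * \<epsilon>\<^sup>2 + K * s\<^sup>2 \<le> B\<^sup>2"
    proof -
      have "B\<^sup>2 = 4 * \<epsilon>\<^sup>2 + (K\<^sup>2 + 2 * K + 1) * \<bar>s\<bar>\<^sup>2 + 4 * (K + 1) * \<epsilon> * \<bar>s\<bar>"
        unfolding B_def by algebra
      moreover have "0 \<le> 4 * (K + 1) * \<epsilon> * \<bar>s\<bar>" using K e by simp
      moreover have "0 \<le> (K\<^sup>2 + K + 1) * \<bar>s\<bar>\<^sup>2" using K by simp
      moreover have "(K\<^sup>2 + 2 * K + 1) * \<bar>s\<bar>\<^sup>2 = (K\<^sup>2 + K + 1) * \<bar>s\<bar>\<^sup>2 + K * s\<^sup>2" by (simp add: algebra_simps)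
      ultimately show ?thesis by (simp add: add_increasing)
    qed
    have by1: "\<bar>y\<bar> \<le> B" using order_trans[OF y2 BB] B0 by (rule abs_le_of_sq_le)
    have bv1: "\<bar>\<phi> $ 3 + \<phi> $ 2\<bar> \<le> B"
      using v2 BB zero_le_power2[of "\<phi> $ 4 - \<phi> $ 1"] B0 unfolding vsq_def by (intro abs_le_of_sq_le) linarith+
    have bv2: "\<bar>\<phi> $ 4 - \<phi> $ 1\<bar> \<le> B"
      using v2 BB zero_le_power2[of "\<phi> $ 3 + \<phi> $ 2"] B0 unfolding vsq_def by (intro abs_le_of_sq_le) linarith+
    have sa: "s\<^sup>2 \<le> \<bar>s\<bar>" "\<epsilon>\<^sup>2 \<le> \<epsilon>"
    proof -
      have "\<bar>s\<bar> * \<bar>s\<bar> \<le> 1 * \<bar>s\<bar>" using g by (intro mult_right_mono) (auto simp: s_def)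
      then show "s\<^sup>2 \<le> \<bar>s\<bar>" by (simp add: power2_eq_square)
      have "\<epsilon> * \<epsilon> \<le> 1 * \<epsilon>" using e by (intro mult_right_mono) auto
      then show "\<epsilon>\<^sup>2 \<le> \<epsilon>" by (simp add: power2_eq_square)
    qed
    have yy: "y\<^sup>2 \<le> 2 * \<epsilon> + K * \<bar>s\<bar>" using y2 sa mult_left_mono[OF sa(1), of K] K by linarith
    \<comment> \<open>x - q is recovered from x^2 - q^2, dividing by x + q \<ge> q.\<close>
    have "(\<phi> $ 1 - q) * (\<phi> $ 1 + q) = - (q\<^sup>2 * s) - y\<^sup>2" using w by (simp add: power2_eq_square algebra_simps)
    then have "\<bar>\<phi> $ 1 - q\<bar> * \<bar>\<phi> $ 1 + q\<bar> = \<bar>- (q\<^sup>2 * s) - y\<^sup>2\<bar>" by (simp add: abs_mult[symmetric])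
    also have "\<dots> \<le> q\<^sup>2 * \<bar>s\<bar> + y\<^sup>2"
      using abs_triangle_ineq4[of "- (q\<^sup>2 * s)" "y\<^sup>2"] by (simp add: abs_mult)
    also have "\<dots> \<le> (q\<^sup>2 + 2 + K) * (\<bar>s\<bar> + \<epsilon>)"
    proof -
      have "0 \<le> q\<^sup>2 * \<epsilon>" "0 \<le> K * \<epsilon>" using K e by simp_all
      then show ?thesis using yy by (simp add: algebra_simps)
    qed
    finally have "\<bar>\<phi> $ 1 - q\<bar> * \<bar>\<phi> $ 1 + q\<bar> \<le> (q\<^sup>2 + 2 + K) * (\<bar>s\<bar> + \<epsilon>)" .
    moreover have "\<bar>\<phi> $ 1 - q\<bar> * q \<le> \<bar>\<phi> $ 1 - q\<bar> * \<bar>\<phi> $ 1 + q\<bar>"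
      using x q_pos by (intro mult_left_mono) auto
    ultimately have "\<bar>\<phi> $ 1 - q\<bar> * q \<le> (q\<^sup>2 + 2 + K) * (\<bar>s\<bar> + \<epsilon>)" by linarith
    then have bx: "\<bar>\<phi> $ 1 - q\<bar> \<le> ((q\<^sup>2 + 2 + K) / q) * (\<bar>s\<bar> + \<epsilon>)"
      using q_pos by (simp add: field_simps)
    have Bs: "B \<le> (2 + (K + 1)) * (\<bar>s\<bar> + \<epsilon>)"
    proof -
      have "0 \<le> K * \<epsilon>" using K e by simp
      then show ?thesis using e unfolding B_def by (simp add: algebra_simps)
    qed
    have "norm (\<phi> - ground \<alpha>) \<le> \<bar>\<phi> $ 1 - q\<bar> + \<bar>\<phi> $ 2\<bar> + \<bar>\<phi> $ 3\<bar> + \<bar>\<phi> $ 4 - q\<bar>"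
      using norm_le_l1_cart[of "\<phi> - ground \<alpha>"] by (simp add: sum_4)
    also have "\<dots> \<le> 2 * \<bar>\<phi> $ 1 - q\<bar> + 4 * B"
    proof -
      have "\<bar>\<phi> $ 3\<bar> \<le> 2 * B" using by1 bv1 unfolding y_def by linarith
      moreover have "\<bar>\<phi> $ 4 - q\<bar> \<le> \<bar>\<phi> $ 1 - q\<bar> + B" using bv2 by linarith
      ultimately show ?thesis using by1 unfolding y_def by argo
    qed
    also have "\<dots> \<le> 2 * (((q\<^sup>2 + 2 + K) / q) * (\<bar>s\<bar> + \<epsilon>)) + 4 * ((2 + (K + 1)) * (\<bar>s\<bar> + \<epsilon>))"
      using bx Bs by (intro add_mono mult_left_mono) auto
    also have "\<dots> = C * (\<bar>s\<bar> + \<epsilon>)" unfolding C_def by (simp add: algebra_simps)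
    finally show ?thesis by (simp add: s_def)
  qed
  moreover have "C > 0"
  proof -
    have "0 < q\<^sup>2 + 2 + K" using K zero_le_power2[of q] by linarith
    then show ?thesis unfolding C_def using K q_pos by (intro add_pos_pos mult_pos_pos divide_pos_pos) auto
  qed
  ultimately show ?thesis by blast
qed

end

section \<open>Expansions at the ground state\<close>

context hill_frame
begin

text \<open>Time derivatives of \<open>\<lambda>\<^sub>1\<close> along the flow.\<close>

definition dlam :: "phase \<Rightarrow> real"
  where "dlam \<phi> = amp * (k * (\<phi> $ 3 + \<phi> $ 2) + mu * (hforce \<alpha> \<phi> * \<phi> $ 2))"

definition ddlam :: "phase \<Rightarrow> real"
  where "ddlam \<phi> = amp * (k * (2 * (\<phi> $ 4 - \<phi> $ 1) + (m - hforce \<alpha> \<phi>) * \<phi> $ 1)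
    + mu * (hforce \<alpha> \<phi> * (\<phi> $ 4 - \<phi> $ 1) - m * hforce \<alpha> \<phi> / wsq \<phi> * radial \<phi> * \<phi> $ 2))"

text \<open>First and second order expansions with a single constant. The decisive one is the last:
  \<open>\<lambda>\<^sub>1\<close> is the mean of the coordinates along eigenvectors for k and -k,
  so the linear part of its second derivative is \<open>k\<^sup>2\<close> times itself.\<close>

lemma near_ground:
  obtains \<rho> C where "\<rho> > 0" "C > 0" "\<rho> \<le> 1"
    "\<And>\<phi>. norm (\<phi> - ground \<alpha>) \<le> \<rho> \<Longrightarrow>
      \<phi> \<in> phase_space \<and> \<bar>gap \<phi>\<bar> \<le> 1/2 \<and> 0 < \<phi> $ 1 \<and>
      \<bar>gap \<phi>\<bar> \<le> C * norm (\<phi> - ground \<alpha>) \<and>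
      \<bar>gap \<phi> + 2 / q * (\<phi> $ 1 - q)\<bar> \<le> C * (norm (\<phi> - ground \<alpha>))\<^sup>2 \<and>
      \<bar>radial \<phi>\<bar> \<le> C * norm (\<phi> - ground \<alpha>) \<and>
      virial \<phi> \<le> C * norm (\<phi> - ground \<alpha>) \<and>
      \<bar>dlam \<phi>\<bar> \<le> C * norm (\<phi> - ground \<alpha>) \<and>
      \<bar>ddlam \<phi> - k\<^sup>2 * lam1 \<alpha> F (\<phi> - ground \<alpha>)\<bar> \<le> C * (norm (\<phi> - ground \<alpha>))\<^sup>2"
proof -
  obtain C0 where C0: "C0 > 0"
    "\<And>p. 1/2 \<le> p \<Longrightarrow> p \<le> 3/2 \<Longrightarrow> \<bar>p powr (- (\<alpha> / 2)) - 1 - (\<alpha> / 2) * (1 - p)\<bar> \<le> C0 * (1 - p)\<^sup>2"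
    using powr_neg_taylor2[of "\<alpha> / 2"] alpha_pos by auto
  obtain C2 where C2: "C2 > 0"
    "\<And>p. 1/2 \<le> p \<Longrightarrow> p \<le> 3/2 \<Longrightarrow> \<bar>p powr (- (m / 2)) - 1 - (m / 2) * (1 - p)\<bar> \<le> C2 * (1 - p)\<^sup>2"
    using powr_neg_taylor2[of "m / 2"] alpha_pos by auto
  have m: "4 \<le> m" using alpha by simp
  \<comment> \<open>\<open>C1\<close> bounds \<open>gap\<close>, \<open>A0\<close> its second order
    error, \<open>A1\<close> bounds \<open>radial\<close>, \<open>A2\<close> the virial,
    \<open>C3\<close> the variation of \<open>hforce\<close>, \<open>A3\<close> bounds
    \<open>dlam\<close>, and \<open>A4\<close>, \<open>A5\<close>, \<open>A6\<close> build the
    quadratic error of \<open>ddlam\<close>.\<close>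
  define C1 where "C1 = (2 * q + 2) / q\<^sup>2"
  define A0 where "A0 = 2 / q\<^sup>2"
  define A1 where "A1 = 2 * q + 4"
  define A2 where "A2 = 8 + 2 * A1 + m * q\<^sup>2 * ((1 + \<alpha> / 2 + C0) * C1)"
  define C3 where "C3 = m * (m / 2 + C2) * C1"
  define A3 where "A3 = amp * (2 * k - mu * (m + C3))"
  define A4 where "A4 = C3 + q * (m * C2 * C1\<^sup>2) + q * m\<^sup>2 / 2 * A0"
  define A5 where "A5 = 2 * C3 + m * (m + C3) * (2 / q\<^sup>2) * A1"
  define A6 where "A6 = amp * (k * A4 - mu * A5)"
  have C1: "C1 > 0" using q_pos by (simp add: C1_def)
  have C3: "C3 > 0" using C1 C2 m by (simp add: C3_def add_pos_pos)
  have A: "A0 > 0" "A1 > 0" using q_pos by (simp_all add: A0_def A1_def)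
  have "A2 > 0" unfolding A2_def using A C1 C0 alpha m by (intro add_pos_nonneg) auto
  have A4: "A4 > 0" unfolding A4_def using A C1 C2 C3 q_pos m by (intro add_pos_nonneg) auto
  have A5: "A5 > 0" unfolding A5_def using A C3 m by (intro add_pos_nonneg) auto
  have "A3 > 0" unfolding A3_def using amp_pos k_pos mu_bounds C3 m
    by (intro mult_pos_pos) (simp_all add: mult_neg_pos less_trans[of _ 0])
  have "A6 > 0" unfolding A6_def using amp_pos k_pos mu_bounds A4 A5
    by (intro mult_pos_pos) (simp_all add: mult_neg_pos less_trans[of _ 0])
  define C where "C = C1 + A0 + A1 + A2 + A3 + A6"
  have CA: "C1 \<le> C" "A0 \<le> C" "A1 \<le> C" "A2 \<le> C" "A3 \<le> C" "A6 \<le> C" and C: "C > 0"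
    using C1 A \<open>A2 > 0\<close> \<open>A3 > 0\<close> \<open>A6 > 0\<close> unfolding C_def by linarith+
  \<comment> \<open>Keeps x at least q / 2 and \<open>gap\<close> at most 1/2 in absolute value, the
    range of the Taylor bounds.\<close>
  define \<rho> where "\<rho> = min 1 (min (q / 2) (1 / (2 * C1)))"
  have rho: "\<rho> > 0" "\<rho> \<le> 1" "\<rho> \<le> q / 2" "\<rho> \<le> 1 / (2 * C1)"
    unfolding \<rho>_def using q_pos C1 by auto
  show thesis
  proof (rule that[of \<rho> C, OF rho(1) C rho(2)])
    fix \<phi> :: phase assume n\<rho>: "norm (\<phi> - ground \<alpha>) \<le> \<rho>"
    define n where "n = norm (\<phi> - ground \<alpha>)"
    have n: "0 \<le> n" "n \<le> 1" "n \<le> q / 2" "n \<le> 1 / (2 * C1)" using n\<rho> rho by (auto simp: n_def)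
    have comp: "\<bar>(\<phi> - ground \<alpha>) $ i\<bar> \<le> n" for i unfolding n_def by (rule component_le_norm_cart)
    define \<xi> y v1 v2 s h where "\<xi> = \<phi> $ 1 - q" and "y = \<phi> $ 2" and "v1 = \<phi> $ 3 + \<phi> $ 2"
      and "v2 = \<phi> $ 4 - \<phi> $ 1" and "s = gap \<phi>" and "h = hforce \<alpha> \<phi>"
    have x: "\<phi> $ 1 = q + \<xi>" by (simp add: \<xi>_def)
    have b: "\<bar>\<xi>\<bar> \<le> n" "\<bar>y\<bar> \<le> n" "\<bar>v1\<bar> \<le> 2 * n" "\<bar>v2\<bar> \<le> 2 * n"
      using comp[of 1] comp[of 2] comp[of 3] comp[of 4] unfolding \<xi>_def y_def v1_def v2_def by simp_all
    have n2: "n\<^sup>2 \<le> n" using n mult_right_mono[of n 1 n] by (simp add: power2_eq_square)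
    have sqb: "a\<^sup>2 \<le> n\<^sup>2" if "\<bar>a\<bar> \<le> n" for a using that n by (simp add: abs_le_square_iff[symmetric])
    have xpos: "0 < \<phi> $ 1" using b n q_pos unfolding x by linarith
    have ps: "\<phi> \<in> phase_space" using xpos by (simp add: phase_space_def)
    have s: "q\<^sup>2 * s = - (2 * q * \<xi> + \<xi>\<^sup>2 + y\<^sup>2)"
      using wsq_gap[of \<phi>] unfolding wsq_def x y_def[symmetric] s_def[symmetric] by (simp add: power2_sum algebra_simps)
    have q2: "q\<^sup>2 > 0" using q_pos by simp
    have xy: "\<xi>\<^sup>2 + y\<^sup>2 \<le> 2 * n\<^sup>2" using sqb[OF b(1)] sqb[OF b(2)] by simp
    have "q\<^sup>2 * \<bar>s\<bar> = \<bar>2 * q * \<xi> + (\<xi>\<^sup>2 + y\<^sup>2)\<bar>" using s q2 by (metis abs_minus_cancel abs_mult abs_of_pos add.assoc)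
    also have "\<dots> \<le> \<bar>2 * q * \<xi>\<bar> + \<bar>\<xi>\<^sup>2 + y\<^sup>2\<bar>" by (rule abs_triangle_ineq)
    also have "\<dots> = 2 * q * \<bar>\<xi>\<bar> + (\<xi>\<^sup>2 + y\<^sup>2)" using q_pos by (simp add: abs_mult)
    also have "\<dots> \<le> 2 * q * n + 2 * n" using b xy n2 q_pos by (intro add_mono mult_left_mono) auto
    finally have gC: "\<bar>s\<bar> \<le> C1 * n" using q2 by (simp add: C1_def field_simps)
    have "C1 * n \<le> C1 * (1 / (2 * C1))" using n C1 by (intro mult_left_mono) auto
    then have half: "\<bar>s\<bar> \<le> 1/2" using gC C1 by simp
    have sn2: "s\<^sup>2 \<le> C1\<^sup>2 * n\<^sup>2"
      using gC C1 n by (metis abs_le_square_iff abs_of_nonneg mult_nonneg_nonneg less_imp_le power_mult_distrib)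
    have "q\<^sup>2 * (s + 2 / q * \<xi>) = - (\<xi>\<^sup>2 + y\<^sup>2)" using s q_pos by (simp add: power2_eq_square algebra_simps)
    then have "q\<^sup>2 * \<bar>s + 2 / q * \<xi>\<bar> = \<xi>\<^sup>2 + y\<^sup>2"
      using q2 by (metis abs_minus_cancel abs_mult abs_of_nonneg abs_of_pos sum_power2_ge_zero)
    then have g2: "\<bar>s + 2 / q * \<xi>\<bar> \<le> A0 * n\<^sup>2" 
    proof -
      have "\<bar>s + 2 / q * \<xi>\<bar> * q\<^sup>2 \<le> 2 * n\<^sup>2"
        using \<open>q\<^sup>2 * \<bar>s + 2 / q * \<xi>\<bar> = \<xi>\<^sup>2 + y\<^sup>2\<close> xy by (simp only: mult.commute)
      then have "\<bar>s + 2 / q * \<xi>\<bar> \<le> 2 * n\<^sup>2 / q\<^sup>2" by (simp only: pos_le_divide_eq[OF q2])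
      then show ?thesis by (simp add: A0_def)
    qed
    have xb: "\<bar>\<phi> $ 1\<bar> \<le> q + 1" using b n q_pos unfolding x by linarith
    have cross: "\<bar>a * c + y * d\<bar> \<le> A1 * n" if "\<bar>a\<bar> \<le> q + 1" "\<bar>c\<bar> \<le> 2 * n" "\<bar>d\<bar> \<le> 2 * n" for a c d
    proof -
      have "\<bar>a * c + y * d\<bar> \<le> \<bar>a\<bar> * \<bar>c\<bar> + \<bar>y\<bar> * \<bar>d\<bar>"
        using abs_triangle_ineq[of "a * c" "y * d"] by (simp add: abs_mult)
      also have "\<dots> \<le> (q + 1) * (2 * n) + 1 * (2 * n)" using that b n by (intro add_mono mult_mono) auto
      finally show ?thesis by (simp add: A1_def algebra_simps)
    qed
    have rad: "\<bar>radial \<phi>\<bar> \<le> A1 * n"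
      unfolding radial_def v1_def[symmetric] v2_def[symmetric] unfolding y_def[symmetric] using xb b by (intro cross)
    have crs: "\<bar>\<phi> $ 1 * v2 + y * (- v1)\<bar> \<le> A1 * n" using xb b by (intro cross) auto
    have p: "1/2 \<le> 1 - s" "1 - s \<le> 3/2" using half by (simp_all add: abs_le_iff)
    have Z: "1 + (\<alpha> / 2) * s - C0 * s\<^sup>2 \<le> Zed \<phi>"
      using C0(2)[OF p] unfolding Zed_def s_def[symmetric] by (simp add: abs_le_iff)
    have vir: "virial \<phi> \<le> A2 * n"
    proof -
      have "vsq \<phi> = v1\<^sup>2 + v2\<^sup>2" by (simp add: vsq_def v1_def v2_def)
      moreover have "v1\<^sup>2 \<le> (2 * n)\<^sup>2" "v2\<^sup>2 \<le> (2 * n)\<^sup>2" using b n by (simp_all only: power2_le_iff_abs_le mult_nonneg_nonneg zero_le_numeral)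
      ultimately have 1: "vsq \<phi> \<le> 8 * n" using n2 by (simp add: power2_eq_square)
      have 2: "2 * (\<phi> $ 1 * v2 - y * v1) \<le> 2 * (A1 * n)" using abs_le_D1[OF crs] by simp
      have x2: "(\<phi> $ 1)\<^sup>2 \<le> q\<^sup>2 * (1 - s)" using wsq_gap[of \<phi>] zero_le_power2[of "\<phi> $ 2"]
        unfolding wsq_def s_def by linarith
      have "s\<^sup>2 \<le> \<bar>s\<bar>" using half mult_right_mono[of "\<bar>s\<bar>" 1 "\<bar>s\<bar>"] by (simp add: power2_eq_square)
      then have "C0 * s\<^sup>2 \<le> C0 * \<bar>s\<bar>" using C0 by (intro mult_left_mono) auto
      moreover have "- ((\<alpha> / 2) * s) \<le> (\<alpha> / 2) * \<bar>s\<bar>" using alpha_pos mult_left_mono[of "- s" "\<bar>s\<bar>" "\<alpha> / 2"] by simp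
      ultimately have "1 - s - Zed \<phi> \<le> (1 + \<alpha> / 2 + C0) * \<bar>s\<bar>" using Z by (simp add: algebra_simps)
      also have "\<dots> \<le> (1 + \<alpha> / 2 + C0) * (C1 * n)" using gC alpha C0 by (intro mult_left_mono) auto
      finally have "m * q\<^sup>2 * (1 - s - Zed \<phi>) \<le> m * q\<^sup>2 * ((1 + \<alpha> / 2 + C0) * (C1 * n))"
        using m by (intro mult_left_mono) auto
      moreover have "m * (\<phi> $ 1)\<^sup>2 \<le> m * (q\<^sup>2 * (1 - s))" using x2 m by (intro mult_left_mono) auto
      ultimately have 3: "m * (\<phi> $ 1)\<^sup>2 - m * q\<^sup>2 * Zed \<phi> \<le> m * q\<^sup>2 * ((1 + \<alpha> / 2 + C0) * (C1 * n))"
        by (simp only: right_diff_distrib mult.assoc)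
      have "virial \<phi> \<le> 8 * n + 2 * (A1 * n) + m * q\<^sup>2 * ((1 + \<alpha> / 2 + C0) * (C1 * n))"
        unfolding virial_eq[OF ps] v1_def[symmetric] v2_def[symmetric] unfolding y_def[symmetric] using 1 2 3 by linarith
      also have "\<dots> = A2 * n" unfolding A2_def by (simp only: distrib_right mult.assoc)
      finally show ?thesis .
    qed
    have h: "h = m * (1 - s) powr (- (m / 2))" unfolding h_def s_def by (rule hforce_gap[OF ps])
    have "\<bar>h - m - m * (m / 2) * s\<bar> = m * \<bar>(1 - s) powr (- (m / 2)) - 1 - (m / 2) * s\<bar>"
    proof -
      have "h - m - m * (m / 2) * s = m * ((1 - s) powr (- (m / 2)) - 1 - (m / 2) * s)"
        unfolding h by (simp add: right_diff_distrib)
      then show ?thesis using m by (simp only: abs_mult)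
    qed
    also have "\<dots> \<le> m * (C2 * s\<^sup>2)" using C2(2)[OF p] m by (intro mult_left_mono) auto
    finally have h2: "\<bar>h - m - m * (m / 2) * s\<bar> \<le> m * C2 * s\<^sup>2" by simp
    have h1: "\<bar>h - m\<bar> \<le> C3 * n"
    proof -
      have "s\<^sup>2 \<le> \<bar>s\<bar>" using half mult_right_mono[of "\<bar>s\<bar>" 1 "\<bar>s\<bar>"] by (simp add: power2_eq_square)
      then have "m * C2 * s\<^sup>2 \<le> m * C2 * \<bar>s\<bar>" using C2 m by (intro mult_left_mono) auto
      moreover have "\<bar>m * (m / 2) * s\<bar> = m * (m / 2) * \<bar>s\<bar>" using m by (simp add: abs_mult)
      ultimately have "\<bar>h - m\<bar> \<le> m * (m / 2) * \<bar>s\<bar> + m * C2 * \<bar>s\<bar>" using h2 by linarith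
      also have "\<dots> = m * (m / 2 + C2) * \<bar>s\<bar>" by argo
      also have "\<dots> \<le> m * (m / 2 + C2) * (C1 * n)" using gC m C2 by (intro mult_left_mono) auto
      finally show ?thesis by (simp add: C3_def mult.assoc)
    qed
    have hb: "0 \<le> h" "h \<le> m + C3"
    proof -
      show "0 \<le> h" unfolding h using m by simp
      have "C3 * n \<le> C3 * 1" using n C3 by (intro mult_left_mono) auto
      then show "h \<le> m + C3" using h1 by linarith
    qed
    have hy: "\<bar>mu * (h * y)\<bar> \<le> - mu * ((m + C3) * n)"
    proof -
      have "\<bar>mu * (h * y)\<bar> = - mu * (h * \<bar>y\<bar>)" using mu_bounds hb by (simp add: abs_mult)
      also have "\<dots> \<le> - mu * ((m + C3) * n)" using mu_bounds hb b C3 m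
        by (intro mult_left_mono mult_mono) auto
      finally show ?thesis .
    qed
    have dl: "\<bar>dlam \<phi>\<bar> \<le> A3 * n"
    proof -
      have "\<bar>k * v1\<bar> \<le> k * (2 * n)" using b k_pos by (simp add: abs_mult)
      then have "\<bar>k * v1 + mu * (h * y)\<bar> \<le> k * (2 * n) + - mu * ((m + C3) * n)"
        using hy abs_triangle_ineq[of "k * v1" "mu * (h * y)"] by linarith
      then have "amp * \<bar>k * v1 + mu * (h * y)\<bar> \<le> amp * (k * (2 * n) + - mu * ((m + C3) * n))"
        using amp_pos by (intro mult_left_mono) auto
      also have "\<dots> = A3 * n" unfolding A3_def by argo
      finally show ?thesis unfolding dlam_def v1_def[symmetric] h_def[symmetric] unfolding y_def[symmetric]
        using amp_pos by (simp add: abs_mult)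
    qed
    have ddl: "\<bar>ddlam \<phi> - k\<^sup>2 * lam1 \<alpha> F (\<phi> - ground \<alpha>)\<bar> \<le> A6 * n\<^sup>2"
    proof -
      \<comment> \<open>\<open>amp * (k * U + mu * T)\<close> will be the whole error;
        \<open>U\<close> and \<open>T\<close> are each quadratic.\<close>
      define U where "U = (m - h) * (q + \<xi>) - m\<^sup>2 * \<xi>"
      define G where "G = m * h / wsq \<phi> * radial \<phi> * y"
      define T where "T = (h - m) * v2 - G"
      have nn: "n * n = n\<^sup>2" by (simp add: power2_eq_square)
      have ks: "k\<^sup>2 * slope = k * m\<^sup>2" using m2 by (simp add: power2_eq_square)
      have km: "k\<^sup>2 * mu = - 2 * k - m * mu" by (rule mu_eq)
      have lam: "lam1 \<alpha> F (\<phi> - ground \<alpha>) = amp * (slope * \<xi> - mu * v2)"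
        unfolding lam1_eq by (simp add: \<xi>_def v2_def)
      have "ddlam \<phi> - k\<^sup>2 * lam1 \<alpha> F (\<phi> - ground \<alpha>) = amp * (k * U + mu * T)
         + amp * (k * m\<^sup>2 * \<xi> + 2 * k * v2 + mu * m * v2 - (k\<^sup>2 * slope) * \<xi> + (k\<^sup>2 * mu) * v2)"
      proof -
        have gen: "a * (K * (2 * v2 + (M - h) * (q + \<xi>)) + u * (h * v2 - G)) - K\<^sup>2 * (a * (S * \<xi> - u * v2))
          = a * (K * ((M - h) * (q + \<xi>) - M\<^sup>2 * \<xi>) + u * ((h - M) * v2 - G))
            + a * (K * M\<^sup>2 * \<xi> + 2 * K * v2 + u * M * v2 - (K\<^sup>2 * S) * \<xi> + (K\<^sup>2 * u) * v2)"
          for a K M u S :: real by (simp add: algebra_simps)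
        have "ddlam \<phi> = amp * (k * (2 * v2 + (m - h) * (q + \<xi>)) + mu * (h * v2 - G))"
          unfolding ddlam_def G_def h_def v2_def y_def x[symmetric] ..
        then show ?thesis unfolding lam U_def T_def by (simp only: gen)
      qed
      also have "\<dots> = amp * (k * U + mu * T)"
      proof -
        \<comment> \<open>The linear terms cancel by the eigenvalue equation, in the form of
          \<open>m2\<close> and \<open>mu_eq\<close>.\<close>
        have "k * m\<^sup>2 * \<xi> + 2 * k * v2 + mu * m * v2 - (k\<^sup>2 * slope) * \<xi> + (k\<^sup>2 * mu) * v2 = 0"
          unfolding ks km by (simp add: left_diff_distrib)
        then show ?thesis by simp
      qed
      finally have e: "ddlam \<phi> - k\<^sup>2 * lam1 \<alpha> F (\<phi> - ground \<alpha>) = amp * (k * U + mu * T)" .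
      have U: "\<bar>U\<bar> \<le> A4 * n\<^sup>2"
      proof -
        \<comment> \<open>\<open>s\<close> is \<open>- 2 / q * \<xi>\<close> to first order, so the
          linear part of \<open>(m - h) * q\<close> cancels
          \<open>m\<^sup>2 * \<xi>\<close>.\<close>
        have gen: "(M - h) * (q + \<xi>) - M\<^sup>2 * \<xi> = - ((h - M) * \<xi>) - q * (h - M - M * (M / 2) * s) - (q * M\<^sup>2 / 2 * s + M\<^sup>2 * \<xi>)"
          for M by (simp add: power2_eq_square algebra_simps)
        have "q * m\<^sup>2 / 2 * (s + 2 / q * \<xi>) = q * m\<^sup>2 / 2 * s + m\<^sup>2 * \<xi>"
          using q_pos by (simp add: distrib_left)
        then have "U = - ((h - m) * \<xi>) - q * (h - m - m * (m / 2) * s) - q * m\<^sup>2 / 2 * (s + 2 / q * \<xi>)"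
          unfolding U_def gen by (simp only:)
        then have "\<bar>U\<bar> \<le> \<bar>(h - m) * \<xi>\<bar> + \<bar>q * (h - m - m * (m / 2) * s)\<bar> + \<bar>q * m\<^sup>2 / 2 * (s + 2 / q * \<xi>)\<bar>"
          by linarith
        also have "\<dots> \<le> (C3 * n) * n + q * (m * C2 * (C1\<^sup>2 * n\<^sup>2)) + q * m\<^sup>2 / 2 * (A0 * n\<^sup>2)"
        proof (intro add_mono)
          show "\<bar>(h - m) * \<xi>\<bar> \<le> (C3 * n) * n" unfolding abs_mult using h1 b n C3 by (intro mult_mono) auto
          have "m * C2 * s\<^sup>2 \<le> m * C2 * (C1\<^sup>2 * n\<^sup>2)" using sn2 m C2 by (intro mult_left_mono) auto
          then show "\<bar>q * (h - m - m * (m / 2) * s)\<bar> \<le> q * (m * C2 * (C1\<^sup>2 * n\<^sup>2))"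
            unfolding abs_mult[of q] using h2 q_pos by simp
          have "\<bar>q * m\<^sup>2 / 2 * (s + 2 / q * \<xi>)\<bar> = q * m\<^sup>2 / 2 * \<bar>s + 2 / q * \<xi>\<bar>"
            using q_pos by (simp only: abs_mult) simp
          also have "\<dots> \<le> q * m\<^sup>2 / 2 * (A0 * n\<^sup>2)" using g2 q_pos by (intro mult_left_mono) auto
          finally show "\<bar>q * m\<^sup>2 / 2 * (s + 2 / q * \<xi>)\<bar> \<le> q * m\<^sup>2 / 2 * (A0 * n\<^sup>2)" .
        qed
        also have "\<dots> = A4 * n\<^sup>2" unfolding A4_def nn[symmetric] by argo
        finally show ?thesis .
      qed
      have T: "\<bar>T\<bar> \<le> A5 * n\<^sup>2"
      proof -
        have w: "q\<^sup>2 / 2 \<le> wsq \<phi>" unfolding wsq_gap using p(1) q2 mult_left_mono[of "1/2" "1 - s" "q\<^sup>2"]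
          by (simp add: s_def)
        have "m * h / wsq \<phi> \<le> m * (m + C3) / (q\<^sup>2 / 2)"
          using w hb m q2 C3 by (intro frac_le mult_left_mono mult_nonneg_nonneg) auto
        then have mw: "\<bar>m * h / wsq \<phi>\<bar> \<le> m * (m + C3) * (2 / q\<^sup>2)"
          using hb m wsq_nonneg[of \<phi>] by simp
        have "\<bar>T\<bar> \<le> \<bar>(h - m) * v2\<bar> + \<bar>m * h / wsq \<phi> * radial \<phi> * y\<bar>"
          unfolding T_def G_def by (rule abs_triangle_ineq4)
        also have "\<dots> \<le> (C3 * n) * (2 * n) + (m * (m + C3) * (2 / q\<^sup>2)) * (A1 * n) * n"
        proof (rule add_mono)
          show "\<bar>(h - m) * v2\<bar> \<le> (C3 * n) * (2 * n)"
            unfolding abs_mult by (rule mult_mono[OF h1 b(4)]) (use C3 n in auto)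
          have "\<bar>m * h / wsq \<phi>\<bar> * \<bar>radial \<phi>\<bar> \<le> (m * (m + C3) * (2 / q\<^sup>2)) * (A1 * n)"
            by (rule mult_mono[OF mw rad]) (use C3 n m in auto)
          then show "\<bar>m * h / wsq \<phi> * radial \<phi> * y\<bar> \<le> (m * (m + C3) * (2 / q\<^sup>2)) * (A1 * n) * n"
            unfolding abs_mult[of _ y] abs_mult[of _ "radial \<phi>"]
            by (rule mult_mono[OF _ b(2)]) (use C3 n m A in auto)
        qed
        also have "\<dots> = A5 * n\<^sup>2" unfolding A5_def nn[symmetric] by argo
        finally show ?thesis .
      qed
      have "\<bar>k * U + mu * T\<bar> \<le> \<bar>k * U\<bar> + \<bar>mu * T\<bar>" by (rule abs_triangle_ineq)
      also have "\<dots> = k * \<bar>U\<bar> + (- mu) * \<bar>T\<bar>" using k_pos mu_bounds by (simp add: abs_mult)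
      also have "\<dots> \<le> k * (A4 * n\<^sup>2) + (- mu) * (A5 * n\<^sup>2)"
        using U T k_pos mu_bounds by (intro add_mono mult_left_mono) auto
      finally have "amp * \<bar>k * U + mu * T\<bar> \<le> amp * (k * (A4 * n\<^sup>2) + (- mu) * (A5 * n\<^sup>2))"
        using amp_pos by (intro mult_left_mono) auto
      also have "\<dots> = A6 * n\<^sup>2" unfolding A6_def by argo
      finally show ?thesis unfolding e abs_mult[of amp] using amp_pos by simp
    qed
    have mono1: "a \<le> C * n" if "a \<le> A * n" "A \<le> C" for a A
      using that n mult_right_mono[of A C n] by linarith
    have mono2: "a \<le> C * n\<^sup>2" if "a \<le> A * n\<^sup>2" "A \<le> C" for a A
      using that mult_right_mono[of A C "n\<^sup>2"] by fastforce
    show "\<phi> \<in> phase_space \<and> \<bar>gap \<phi>\<bar> \<le> 1/2 \<and> 0 < \<phi> $ 1 \<and>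
      \<bar>gap \<phi>\<bar> \<le> C * norm (\<phi> - ground \<alpha>) \<and>
      \<bar>gap \<phi> + 2 / q * (\<phi> $ 1 - q)\<bar> \<le> C * (norm (\<phi> - ground \<alpha>))\<^sup>2 \<and>
      \<bar>radial \<phi>\<bar> \<le> C * norm (\<phi> - ground \<alpha>) \<and>
      virial \<phi> \<le> C * norm (\<phi> - ground \<alpha>) \<and>
      \<bar>dlam \<phi>\<bar> \<le> C * norm (\<phi> - ground \<alpha>) \<and>
      \<bar>ddlam \<phi> - k\<^sup>2 * lam1 \<alpha> F (\<phi> - ground \<alpha>)\<bar> \<le> C * (norm (\<phi> - ground \<alpha>))\<^sup>2"
      unfolding n_def[symmetric] s_def[symmetric] \<xi>_def[symmetric]
      by (intro conjI ps half xpos mono1[OF gC CA(1)] mono2[OF g2 CA(2)] mono1[OF rad CA(3)]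
        mono1[OF vir CA(4)] mono1[OF dl CA(5)] mono2[OF ddl CA(6)])
  qed
qed

end

subsection \<open>The distance and sign functions\<close>

locale hill_distance = hill_frame +
  fixes chi :: "real \<Rightarrow> real" and \<delta>E :: real
  assumes cutoff: "is_cutoff chi" and deltaE: "is_delta_E \<alpha> F chi \<delta>E"
begin

abbreviation NQ :: "phase \<Rightarrow> real" where "NQ \<phi> \<equiv> normE_sq \<alpha> F (\<phi> - ground \<alpha>)"
abbreviation lamQ :: "phase \<Rightarrow> real" where "lamQ \<phi> \<equiv> lam1 \<alpha> F (\<phi> - ground \<alpha>)"
abbreviation D :: "phase \<Rightarrow> real" where "D \<equiv> d_sigma \<alpha> F chi \<delta>E 1"
abbreviation dQ :: "phase \<Rightarrow> real" where "dQ \<equiv> d_Q \<alpha> F chi \<delta>E"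

lemma deltaE_pos: "0 < \<delta>E" using deltaE by (simp add: is_delta_E_def)

lemma NQ_nonneg: "0 \<le> normE_sq \<alpha> F X"
proof -
  obtain c where "c > 0" "c * (norm X)\<^sup>2 \<le> normE_sq \<alpha> F X" using normE_sq_lower by blast
  then show ?thesis by (metis mult_nonneg_nonneg less_imp_le order_trans zero_le_power2)
qed

lemma minus_phase_space: "- \<phi> \<in> phase_space \<longleftrightarrow> \<phi> \<in> phase_space"
  by (simp add: phase_space_def)

lemma energy_minus: "energy \<alpha> (- \<phi>) = energy \<alpha> \<phi>"
proof -
  have "(- \<phi> $ 3 + - \<phi> $ 2)\<^sup>2 = (\<phi> $ 3 + \<phi> $ 2)\<^sup>2" "(- \<phi> $ 4 - - \<phi> $ 1)\<^sup>2 = (\<phi> $ 4 - \<phi> $ 1)\<^sup>2"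
    by algebra+
  then show ?thesis by (simp add: energy_def V_def)
qed

lemma energy_sign: "\<sigma> \<in> {1, -1} \<Longrightarrow> energy \<alpha> (\<sigma> *\<^sub>R \<phi>) = energy \<alpha> \<phi>"
  using energy_minus by auto

text \<open>The energy is even, so both distances are values of the single function
  \<open>D\<close>.\<close>

lemma d_sigma_sign:
  assumes "\<sigma> \<in> {1, -1}"
  shows "d_sigma \<alpha> F chi \<delta>E \<sigma> \<phi> = D (\<sigma> *\<^sub>R \<phi>)"
  using energy_sign[OF assms] by (simp add: d_sigma_def remainder_def displacement_def)

lemma dQ_eq: "dQ \<phi> = min (D \<phi>) (D (- \<phi>))"
  using d_sigma_sign[of "-1"] by (simp add: d_Q_def)

lemma dQ_minus: "dQ (- \<phi>) = dQ \<phi>"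
  by (simp add: dQ_eq min.commute)

lemma remainder_eq: "remainder \<alpha> F 1 \<phi> = excess \<phi> + 2 * k * (lamQ \<phi>)\<^sup>2 - NQ \<phi>"
  by (simp add: remainder_def displacement_def Let_def excess_def E_star_def lam1_def power_divide)

lemma remainder_bound:
  assumes "\<phi> \<in> phase_space" "NQ \<phi> \<le> (4 * \<delta>E)\<^sup>2"
  shows "\<bar>excess \<phi> + 2 * k * (lamQ \<phi>)\<^sup>2 - NQ \<phi>\<bar> \<le> NQ \<phi> / 10"
proof -
  have "normE \<alpha> F (displacement \<alpha> 1 \<phi>) \<le> 4 * \<delta>E"
    using assms(2) deltaE_pos by (simp add: normE_def displacement_def real_le_lsqrt)
  then have "\<bar>remainder \<alpha> F 1 \<phi>\<bar> \<le> normE_sq \<alpha> F (displacement \<alpha> 1 \<phi>) / 10"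
    using deltaE assms(1) unfolding is_delta_E_def by blast
  then show ?thesis unfolding remainder_eq by (simp add: displacement_def)
qed

lemma D_unfold: "D \<phi> = sqrt (NQ \<phi> + chi (sqrt (NQ \<phi>) / (2 * \<delta>E)) * remainder \<alpha> F 1 \<phi>)"
  by (simp add: d_sigma_def displacement_def normE_def Let_def)

text \<open>Either \<open>NQ\<close> is at most \<open>(4 * \<delta>E)\<^sup>2\<close> and the
  remainder is at most a tenth of it, or the cutoff vanishes.\<close>

lemma D_bounds:
  assumes ps: "\<phi> \<in> phase_space"
  shows "9/10 * NQ \<phi> \<le> (D \<phi>)\<^sup>2" "(D \<phi>)\<^sup>2 \<le> 11/10 * NQ \<phi>" "0 \<le> D \<phi>"
proof -
  define c where "c = chi (sqrt (NQ \<phi>) / (2 * \<delta>E))"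
  have N: "0 \<le> NQ \<phi>" by (rule NQ_nonneg)
  have c: "0 \<le> c" "c \<le> 1" using cutoff by (simp_all add: c_def is_cutoff_def)
  have *: "\<bar>c * remainder \<alpha> F 1 \<phi>\<bar> \<le> NQ \<phi> / 10"
  proof (cases "NQ \<phi> \<le> (4 * \<delta>E)\<^sup>2")
    case True
    have "\<bar>c * remainder \<alpha> F 1 \<phi>\<bar> \<le> 1 * (NQ \<phi> / 10)"
      unfolding abs_mult remainder_eq using c remainder_bound[OF ps True] by (intro mult_mono) auto
    then show ?thesis by simp
  next
    case False
    then have "4 * \<delta>E < sqrt (NQ \<phi>)" by (intro real_less_rsqrt) auto
    then have "2 \<le> \<bar>sqrt (NQ \<phi>) / (2 * \<delta>E)\<bar>" using deltaE_pos by (simp add: field_simps)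
    then have "c = 0" using cutoff unfolding c_def is_cutoff_def by blast
    then show ?thesis using N by simp
  qed
  then have b: "9/10 * NQ \<phi> \<le> NQ \<phi> + c * remainder \<alpha> F 1 \<phi>" "NQ \<phi> + c * remainder \<alpha> F 1 \<phi> \<le> 11/10 * NQ \<phi>"
    unfolding abs_le_iff by linarith+
  then have "0 \<le> NQ \<phi> + c * remainder \<alpha> F 1 \<phi>" using N by linarith
  then have "(D \<phi>)\<^sup>2 = NQ \<phi> + c * remainder \<alpha> F 1 \<phi>" "0 \<le> D \<phi>" unfolding D_unfold c_def by simp_all
  then show "9/10 * NQ \<phi> \<le> (D \<phi>)\<^sup>2" "(D \<phi>)\<^sup>2 \<le> 11/10 * NQ \<phi>" "0 \<le> D \<phi>" using b by simp_all
qed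

text \<open>By the lower bound in \<open>D_bounds\<close> the argument of the cutoff lies where the
  cutoff is 1; then \<open>NQ\<close> cancels against the remainder.\<close>

lemma D_sq:
  assumes ps: "\<phi> \<in> phase_space" and d: "D \<phi> \<le> \<delta>E"
  shows "(D \<phi>)\<^sup>2 = excess \<phi> + 2 * k * (lamQ \<phi>)\<^sup>2" "NQ \<phi> \<le> (2 * \<delta>E)\<^sup>2"
proof -
  have "(D \<phi>)\<^sup>2 \<le> \<delta>E\<^sup>2" using d D_bounds(3)[OF ps] by (intro power_mono)
  then have "9/10 * NQ \<phi> \<le> \<delta>E\<^sup>2" using D_bounds(1)[OF ps] by linarith
  moreover have "0 \<le> \<delta>E\<^sup>2" by simp
  ultimately have "NQ \<phi> \<le> 4 * \<delta>E\<^sup>2" by linarith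
  then show N: "NQ \<phi> \<le> (2 * \<delta>E)\<^sup>2" by (simp add: power_mult_distrib)
  then have "sqrt (NQ \<phi>) \<le> 2 * \<delta>E" using deltaE_pos by (intro real_le_lsqrt) auto
  then have "\<bar>sqrt (NQ \<phi>) / (2 * \<delta>E)\<bar> \<le> 1" using deltaE_pos NQ_nonneg by simp
  then have "chi (sqrt (NQ \<phi>) / (2 * \<delta>E)) = 1" using cutoff unfolding is_cutoff_def by blast
  then have D: "D \<phi> = sqrt (excess \<phi> + 2 * k * (lamQ \<phi>)\<^sup>2)" unfolding D_unfold remainder_eq by simp
  have "0 \<le> excess \<phi> + 2 * k * (lamQ \<phi>)\<^sup>2"
    using D D_bounds(3)[OF ps] by (simp add: real_sqrt_ge_0_iff)
  then show "(D \<phi>)\<^sup>2 = excess \<phi> + 2 * k * (lamQ \<phi>)\<^sup>2" unfolding D by simp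
qed

lemma D_norm_equiv:
  obtains c C where "c > 0" "C > 0"
    "\<And>\<phi>. \<phi> \<in> phase_space \<Longrightarrow> c * norm (\<phi> - ground \<alpha>) \<le> D \<phi>"
    "\<And>\<phi>. \<phi> \<in> phase_space \<Longrightarrow> D \<phi> \<le> C * norm (\<phi> - ground \<alpha>)"
proof -
  obtain c where c: "c > 0" "\<And>X. c * (norm X)\<^sup>2 \<le> normE_sq \<alpha> F X" using normE_sq_lower by blast
  obtain C where C: "C > 0" "\<And>X. normE_sq \<alpha> F X \<le> C * (norm X)\<^sup>2" using normE_sq_upper by blast
  have "sqrt (9/10 * c) * norm (\<phi> - ground \<alpha>) \<le> D \<phi>" if "\<phi> \<in> phase_space" for \<phi>
  proof (rule power2_le_imp_le)
    show "(sqrt (9/10 * c) * norm (\<phi> - ground \<alpha>))\<^sup>2 \<le> (D \<phi>)\<^sup>2"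
      using D_bounds(1)[OF that] c(1) c(2)[of "\<phi> - ground \<alpha>"] by (simp add: power_mult_distrib)
    show "0 \<le> D \<phi>" by (rule D_bounds(3)[OF that])
  qed
  moreover have "D \<phi> \<le> sqrt (11/10 * C) * norm (\<phi> - ground \<alpha>)" if "\<phi> \<in> phase_space" for \<phi>
  proof (rule power2_le_imp_le)
    show "(D \<phi>)\<^sup>2 \<le> (sqrt (11/10 * C) * norm (\<phi> - ground \<alpha>))\<^sup>2"
      using D_bounds(2)[OF that] C(1) C(2)[of "\<phi> - ground \<alpha>"] by (simp add: power_mult_distrib)
    show "0 \<le> sqrt (11/10 * C) * norm (\<phi> - ground \<alpha>)" using C(1) by simp
  qed
  moreover have "0 < sqrt (9/10 * c)" "0 < sqrt (11/10 * C)" using c C by simp_all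
  ultimately show thesis using that by blast
qed

text \<open>
  Slowing down \<open>y\<close>-motion until \<open>\<lambda>\<^sub>1\<close> vanishes decreases both the energy and the linearized norm,
  so a point whose \<open>\<lambda>\<^sub>1\<close> and \<open>x - q\<^sub>0\<close> have different signs is \<open>O(\<epsilon>)\<close>-close to the ground state.
\<close>

lemma sign_mismatch_close:
  obtains M \<epsilon>1 where "M > 0" "\<epsilon>1 > 0"
    "\<And>\<phi> \<epsilon>. \<phi> \<in> phase_space \<Longrightarrow> NQ \<phi> \<le> (4 * \<delta>E)\<^sup>2 \<Longrightarrow> excess \<phi> \<le> \<epsilon>\<^sup>2 \<Longrightarrow> 0 < \<epsilon> \<Longrightarrow> \<epsilon> \<le> \<epsilon>1 \<Longrightarrow>
      \<phi> $ 1 \<le> q \<and> 0 \<le> lamQ \<phi> \<or> q \<le> \<phi> $ 1 \<and> lamQ \<phi> \<le> 0 \<Longrightarrow> D \<phi> \<le> M * \<epsilon>"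
proof -
  obtain c where c: "c > 0" "\<And>X. c * (norm X)\<^sup>2 \<le> normE_sq \<alpha> F X" using normE_sq_lower by blast
  obtain \<rho> C where \<rho>: "\<rho> > 0" and C: "C > 0"
    and near: "\<And>\<phi>. norm (\<phi> - ground \<alpha>) \<le> \<rho> \<Longrightarrow> \<bar>gap \<phi>\<bar> \<le> 1/2 \<and> 0 < \<phi> $ 1 \<and> \<bar>gap \<phi>\<bar> \<le> C * norm (\<phi> - ground \<alpha>)"
    using near_ground by metis
  obtain B where B: "B > 0" "\<And>\<phi> \<epsilon>. \<phi> \<in> phase_space \<Longrightarrow> \<bar>gap \<phi>\<bar> \<le> 1/2 \<Longrightarrow> excess \<phi> \<le> \<epsilon>\<^sup>2 \<Longrightarrow> 0 \<le> \<epsilon> \<Longrightarrow> \<epsilon> \<le> 1 \<Longrightarrow> 0 \<le> \<phi> $ 1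
    \<Longrightarrow> norm (\<phi> - ground \<alpha>) \<le> B * (\<bar>gap \<phi>\<bar> + \<epsilon>)"
    using near_circle_bound by blast
  obtain c' C' where C': "C' > 0" "\<And>\<phi>. \<phi> \<in> phase_space \<Longrightarrow> D \<phi> \<le> C' * norm (\<phi> - ground \<alpha>)"
    using D_norm_equiv by metis
  define K where "K = sqrt (10 / (9 * c))"
  have K: "K > 0" using c by (simp add: K_def)
  define M where "M = C' * (B * (C * K + 1))"
  define \<epsilon>1 where "\<epsilon>1 = min 1 (\<rho> / K)"
  show thesis
  proof (rule that[of M \<epsilon>1])
    show "M > 0" using C' B C K by (simp add: M_def add_pos_pos)
    show "\<epsilon>1 > 0" using \<rho> K by (simp add: \<epsilon>1_def)
    fix \<phi> \<epsilon>
    assume ps: "\<phi> \<in> phase_space" and N: "NQ \<phi> \<le> (4 * \<delta>E)\<^sup>2" and e: "excess \<phi> \<le> \<epsilon>\<^sup>2" "0 < \<epsilon>" "\<epsilon> \<le> \<epsilon>1"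
      and sg: "\<phi> $ 1 \<le> q \<and> 0 \<le> lamQ \<phi> \<or> q \<le> \<phi> $ 1 \<and> lamQ \<phi> \<le> 0"
    define \<xi> v u where "\<xi> = \<phi> $ 1 - q" and "v = \<phi> $ 4 - \<phi> $ 1" and "u = slope * \<xi> / mu"
    have mu0: "mu \<noteq> 0" using mu_bounds by simp
    have mu_u: "mu * u = slope * \<xi>" using mu0 by (simp add: u_def)
    have lam: "lamQ \<phi> = amp * (slope * \<xi> - mu * v)" unfolding lam1_eq by (simp add: \<xi>_def v_def)
    \<comment> \<open>\<open>u\<close> is the y velocity at which \<open>\<lambda>\<^sub>1\<close>
      vanishes. Different signs put \<open>mu * v\<close> on the same side of 0 as
      \<open>slope * \<xi>\<close> and at least as far out.\<close>
    have "(mu * u)\<^sup>2 \<le> (mu * v)\<^sup>2"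
      using sg
    proof
      assume *: "\<phi> $ 1 \<le> q \<and> 0 \<le> lamQ \<phi>"
      then have "0 \<le> slope * \<xi> - mu * v" unfolding lam using amp_pos by (simp add: zero_le_mult_iff)
      moreover have "slope * \<xi> \<le> 0" using * slope_pos by (simp add: \<xi>_def mult_nonneg_nonpos)
      ultimately show ?thesis unfolding mu_u abs_le_square_iff[symmetric] by linarith
    next
      assume *: "q \<le> \<phi> $ 1 \<and> lamQ \<phi> \<le> 0"
      then have "slope * \<xi> - mu * v \<le> 0" unfolding lam using amp_pos by (simp add: mult_le_0_iff)
      moreover have "0 \<le> slope * \<xi>" using * slope_pos by (simp add: \<xi>_def)
      ultimately show ?thesis unfolding mu_u abs_le_square_iff[symmetric] by linarith
    qed
    then have uv: "u\<^sup>2 \<le> v\<^sup>2" using mu0 by (simp add: power_mult_distrib)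
    define \<phi>' :: phase where "\<phi>' = vector [\<phi> $ 1, \<phi> $ 2, \<phi> $ 3, \<phi> $ 1 + u]"
    have nth: "\<phi>' $ 1 = \<phi> $ 1" "\<phi>' $ 2 = \<phi> $ 2" "\<phi>' $ 3 = \<phi> $ 3" "\<phi>' $ 4 = \<phi> $ 1 + u"
      by (simp_all add: \<phi>'_def)
    have w: "wsq \<phi>' = wsq \<phi>" by (simp add: wsq_def nth)
    have ps': "\<phi>' \<in> phase_space" using ps by (simp add: phase_space_iff w)
    have lam': "lamQ \<phi>' = 0"
    proof -
      have "lamQ \<phi>' = amp * (slope * \<xi> - mu * u)" unfolding lam1_eq by (simp add: nth \<xi>_def)
      then show ?thesis by (simp add: mu_u)
    qed
    have e': "excess \<phi>' \<le> \<epsilon>\<^sup>2"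
    proof -
      have "excess \<phi> - excess \<phi>' = (v\<^sup>2 - u\<^sup>2) / 2"
        unfolding excess_def energy_eq[OF ps] energy_eq[OF ps'] w nth v_def by (simp add: field_simps)
      then show ?thesis using uv e(1) by argo
    qed
    have N': "NQ \<phi>' \<le> NQ \<phi>"
    proof -
      have "NQ \<phi> - NQ \<phi>' = (v\<^sup>2 - u\<^sup>2) / 2 + 2 * k * (lamQ \<phi>)\<^sup>2"
        unfolding normE_sq_eq lam' by (simp add: nth v_def field_simps)
      moreover have "0 \<le> 2 * k * (lamQ \<phi>)\<^sup>2" using k_pos by simp
      ultimately show ?thesis using uv by argo
    qed
    then have "NQ \<phi>' \<le> (4 * \<delta>E)\<^sup>2" using N by linarith
    \<comment> \<open>Where \<open>\<lambda>\<^sub>1\<close> is 0 the remainder bound compares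
      \<open>excess\<close> with \<open>NQ\<close> directly, so the energy alone controls the
      distance of \<phi>'.\<close>
    from abs_le_D2[OF remainder_bound[OF ps' this]] have "9/10 * NQ \<phi>' \<le> \<epsilon>\<^sup>2"
      using e' unfolding lam' zero_power2 mult_zero_right add_0_right by argo
    then have "9/10 * (c * (norm (\<phi>' - ground \<alpha>))\<^sup>2) \<le> \<epsilon>\<^sup>2" using c(2)[of "\<phi>' - ground \<alpha>"] by linarith
    then have "(norm (\<phi>' - ground \<alpha>))\<^sup>2 \<le> (K * \<epsilon>)\<^sup>2"
    proof -
      have "K\<^sup>2 = 10 / (9 * c)" using c(1) by (simp add: K_def)
      then have K2: "(K * \<epsilon>)\<^sup>2 = (10/9 * \<epsilon>\<^sup>2) / c" by (simp add: power_mult_distrib)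
      have "(norm (\<phi>' - ground \<alpha>))\<^sup>2 * c \<le> 10/9 * \<epsilon>\<^sup>2"
        using \<open>9/10 * (c * (norm (\<phi>' - ground \<alpha>))\<^sup>2) \<le> \<epsilon>\<^sup>2\<close> by argo
      then show ?thesis unfolding K2 pos_le_divide_eq[OF c(1)] .
    qed
    then have n': "norm (\<phi>' - ground \<alpha>) \<le> K * \<epsilon>" by (rule power2_le_imp_le) (use K e in simp)
    also have "\<dots> \<le> K * (\<rho> / K)" using e K by (intro mult_left_mono) (auto simp: \<epsilon>1_def)
    finally have "norm (\<phi>' - ground \<alpha>) \<le> \<rho>" using K by simp
    from near[OF this] have g': "\<bar>gap \<phi>'\<bar> \<le> 1/2" "0 < \<phi>' $ 1" "\<bar>gap \<phi>'\<bar> \<le> C * norm (\<phi>' - ground \<alpha>)" by auto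
    \<comment> \<open>\<phi> and \<phi>' have the same position. The closeness of \<phi>' therefore
      bounds the gap of \<phi>, and \<open>near_circle_bound\<close> turns this into closeness of
      \<phi>.\<close>
    have gap': "gap \<phi>' = gap \<phi>" by (simp add: gap_def w)
    have "\<bar>gap \<phi>\<bar> \<le> C * (K * \<epsilon>)" using g'(3) mult_left_mono[OF n', of C] C unfolding gap' by linarith
    then have "\<bar>gap \<phi>\<bar> + \<epsilon> \<le> (C * K + 1) * \<epsilon>" by (simp add: algebra_simps)
    then have "B * (\<bar>gap \<phi>\<bar> + \<epsilon>) \<le> B * ((C * K + 1) * \<epsilon>)" using B by (intro mult_left_mono) auto
    moreover have "norm (\<phi> - ground \<alpha>) \<le> B * (\<bar>gap \<phi>\<bar> + \<epsilon>)"
      using ps g' e unfolding gap' nth by (intro B(2)) (auto simp: \<epsilon>1_def)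
    ultimately have "C' * norm (\<phi> - ground \<alpha>) \<le> C' * (B * ((C * K + 1) * \<epsilon>))"
      using C' by (intro mult_left_mono) auto
    then show "D \<phi> \<le> M * \<epsilon>" using C'(2)[OF ps] unfolding M_def by (simp add: mult.assoc)
  qed
qed

lemma continuous_on_D: "continuous_on phase_space D"
proof -
  have chi: "continuous_on S chi" for S
  proof -
    have "\<forall>s. (deriv ^^ 0) chi field_differentiable at s" using cutoff unfolding is_cutoff_def by blast
    then have "chi field_differentiable at s" for s by simp
    then have "isCont chi s" for s by (rule field_differentiable_imp_continuous_at)
    then show ?thesis by (simp add: continuous_at_imp_continuous_on)
  qed
  have e: "continuous_on phase_space (energy \<alpha>)"
    using energy_has_derivative by (intro continuous_at_imp_continuous_on) (auto intro: has_derivative_continuous)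
  have l: "continuous_on phase_space lamQ" unfolding lam1_eq by (intro continuous_intros)
  have n: "continuous_on phase_space NQ" unfolding normE_sq_eq by (intro continuous_intros l) auto
  have "continuous_on phase_space (\<lambda>\<phi>. sqrt (NQ \<phi> + chi (sqrt (NQ \<phi>) / (2 * \<delta>E)) * (excess \<phi> + 2 * k * (lamQ \<phi>)\<^sup>2 - NQ \<phi>)))"
    unfolding excess_def
    by (intro continuous_intros n l e continuous_on_compose2[OF chi[of UNIV]]) (use deltaE_pos in auto)
  then show ?thesis unfolding D_unfold remainder_eq .
qed

lemma continuous_on_dQ: "continuous_on phase_space dQ"
proof -
  have "continuous_on phase_space (\<lambda>\<phi>. D (- \<phi>))"
    by (rule continuous_on_compose2[OF continuous_on_D]) (auto intro!: continuous_intros simp: minus_phase_space)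
  then show ?thesis unfolding dQ_eq by (intro continuous_intros continuous_on_D)
qed

end

section \<open>Estimates close to the ground states and away from them\<close>

lemma (in hill_frame) lam1_bound: "\<exists>L>0. \<forall>X. \<bar>lam1 \<alpha> F X\<bar> \<le> L * norm X"
proof (intro exI conjI allI)
  show "0 < amp * (slope - 2 * mu)" using amp_pos slope_pos mu_bounds by simp
  fix X :: phase
  have c: "\<bar>X $ i\<bar> \<le> norm X" for i by (rule component_le_norm_cart)
  have "\<bar>slope * X $ 1 - mu * (X $ 4 - X $ 1)\<bar> \<le> \<bar>slope * X $ 1\<bar> + \<bar>mu * (X $ 4 - X $ 1)\<bar>"
    by (rule abs_triangle_ineq4)
  also have "\<dots> \<le> slope * norm X + (- mu) * (2 * norm X)"
  proof (rule add_mono)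
    show "\<bar>slope * X $ 1\<bar> \<le> slope * norm X"
      using mult_left_mono[OF c[of 1], of slope] slope_pos by (simp add: abs_mult)
    have "\<bar>X $ 4 - X $ 1\<bar> \<le> 2 * norm X" using c[of 4] c[of 1] by linarith
    then show "\<bar>mu * (X $ 4 - X $ 1)\<bar> \<le> (- mu) * (2 * norm X)"
      using mult_left_mono[of "\<bar>X $ 4 - X $ 1\<bar>" "2 * norm X" "- mu"] mu_bounds by (simp add: abs_mult)
  qed
  finally have "amp * \<bar>slope * X $ 1 - mu * (X $ 4 - X $ 1)\<bar> \<le> amp * (slope * norm X + (- mu) * (2 * norm X))"
    using amp_pos by (intro mult_left_mono) auto
  also have "\<dots> = amp * (slope - 2 * mu) * norm X" by (simp add: algebra_simps)
  finally show "\<bar>lam1 \<alpha> F X\<bar> \<le> amp * (slope - 2 * mu) * norm X"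
    unfolding lam1_eq using amp_pos by (simp add: abs_mult)
qed

context hill_distance
begin

lemma gap_minus: "gap (- \<phi>) = gap \<phi>" and radial_minus: "radial (- \<phi>) = radial \<phi>"
  and excess_minus: "excess (- \<phi>) = excess \<phi>"
proof -
  show "gap (- \<phi>) = gap \<phi>" by (simp add: gap_def wsq_def)
  show "radial (- \<phi>) = radial \<phi>" unfolding radial_def vector_uminus_component by algebra
  show "excess (- \<phi>) = excess \<phi>" by (simp add: excess_def energy_minus)
qed

lemma D_small_NQ:
  assumes "\<phi> \<in> phase_space" "D \<phi> \<le> \<delta>E"
  shows "NQ \<phi> \<le> (4 * \<delta>E)\<^sup>2"
proof -
  have "(2 * \<delta>E)\<^sup>2 \<le> (4 * \<delta>E)\<^sup>2" using deltaE_pos by (intro power_mono) auto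
  then show ?thesis using D_sq(2)[OF assms] by (rule order_trans[rotated])
qed

text \<open>Collects the local constants for three regimes: \<open>D \<ge> 2 * \<epsilon>\<close>,
  where \<open>\<lambda>\<^sub>1\<close> dominates the energy slack;
  \<open>D \<le> M * \<epsilon>\<close>, where the virial is only known to be O(\<epsilon>); and
  \<open>D \<ge> M * \<epsilon>\<close> with \<open>\<lambda>\<^sub>1 < 0\<close>, where the point
  lies in the disc and the virial is negative of order \<open>D\<close>.\<close>

lemma near_facts:
  obtains dX M c1 C2 Cd cl cw where
    "0 < dX" "dX \<le> \<delta>E" "0 < M" "0 < c1" "0 < C2" "0 < Cd" "0 < cl" "0 < cw"
    "\<And>\<phi>. \<phi> \<in> phase_space \<Longrightarrow> D \<phi> \<le> dX \<Longrightarrow> dX < D (- \<phi>) \<and> cw \<le> wsq \<phi> \<and> norm \<phi> \<le> norm (ground \<alpha>) + 1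
      \<and> \<bar>radial \<phi>\<bar> \<le> Cd * D \<phi> \<and> \<bar>dlam \<phi>\<bar> \<le> Cd * D \<phi> \<and> \<bar>lamQ \<phi>\<bar> \<le> Cd * D \<phi>"
    "\<And>\<phi> \<epsilon>. \<phi> \<in> phase_space \<Longrightarrow> D \<phi> \<le> dX \<Longrightarrow> excess \<phi> \<le> \<epsilon>\<^sup>2 \<Longrightarrow> 0 < \<epsilon> \<Longrightarrow> \<epsilon> \<le> dX \<Longrightarrow> 2 * \<epsilon> \<le> D \<phi> \<Longrightarrow>
      cl * D \<phi> \<le> \<bar>lamQ \<phi>\<bar> \<and> k\<^sup>2 / 2 * (lamQ \<phi>)\<^sup>2 \<le> lamQ \<phi> * ddlam \<phi>
      \<and> (D \<phi> \<le> M * \<epsilon> \<longrightarrow> virial \<phi> \<le> C2 * \<epsilon>)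
      \<and> (M * \<epsilon> \<le> D \<phi> \<and> lamQ \<phi> < 0 \<longrightarrow> virial \<phi> \<le> - (c1 * D \<phi>) \<and> 0 < gap \<phi>)"
proof -
  obtain c C' where c: "c > 0" and C': "C' > 0"
    and lo: "\<And>\<phi>. \<phi> \<in> phase_space \<Longrightarrow> c * norm (\<phi> - ground \<alpha>) \<le> D \<phi>"
    and hi: "\<And>\<phi>. \<phi> \<in> phase_space \<Longrightarrow> D \<phi> \<le> C' * norm (\<phi> - ground \<alpha>)"
    using D_norm_equiv by metis
  obtain \<rho> C where \<rho>: "\<rho> > 0" "\<rho> \<le> 1" and C: "C > 0"
    and near: "\<And>\<phi>. norm (\<phi> - ground \<alpha>) \<le> \<rho> \<Longrightarrow>
      \<phi> \<in> phase_space \<and> \<bar>gap \<phi>\<bar> \<le> 1/2 \<and> 0 < \<phi> $ 1 \<and>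
      \<bar>gap \<phi>\<bar> \<le> C * norm (\<phi> - ground \<alpha>) \<and>
      \<bar>gap \<phi> + 2 / q * (\<phi> $ 1 - q)\<bar> \<le> C * (norm (\<phi> - ground \<alpha>))\<^sup>2 \<and>
      \<bar>radial \<phi>\<bar> \<le> C * norm (\<phi> - ground \<alpha>) \<and>
      virial \<phi> \<le> C * norm (\<phi> - ground \<alpha>) \<and>
      \<bar>dlam \<phi>\<bar> \<le> C * norm (\<phi> - ground \<alpha>) \<and>
      \<bar>ddlam \<phi> - k\<^sup>2 * lam1 \<alpha> F (\<phi> - ground \<alpha>)\<bar> \<le> C * (norm (\<phi> - ground \<alpha>))\<^sup>2"
    using near_ground by metis
  obtain B where B: "B > 0" and circ: "\<And>\<phi> \<epsilon>. \<phi> \<in> phase_space \<Longrightarrow> \<bar>gap \<phi>\<bar> \<le> 1/2 \<Longrightarrow> excess \<phi> \<le> \<epsilon>\<^sup>2 \<Longrightarrow> 0 \<le> \<epsilon> \<Longrightarrow> \<epsilon> \<le> 1 \<Longrightarrow> 0 \<le> \<phi> $ 1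
    \<Longrightarrow> norm (\<phi> - ground \<alpha>) \<le> B * (\<bar>gap \<phi>\<bar> + \<epsilon>)"
    using near_circle_bound by blast
  obtain M0 \<epsilon>1 where M0: "M0 > 0" and \<epsilon>1: "\<epsilon>1 > 0"
    and mis: "\<And>\<phi> \<epsilon>. \<phi> \<in> phase_space \<Longrightarrow> NQ \<phi> \<le> (4 * \<delta>E)\<^sup>2 \<Longrightarrow> excess \<phi> \<le> \<epsilon>\<^sup>2 \<Longrightarrow> 0 < \<epsilon> \<Longrightarrow> \<epsilon> \<le> \<epsilon>1 \<Longrightarrow>
      \<phi> $ 1 \<le> q \<and> 0 \<le> lamQ \<phi> \<or> q \<le> \<phi> $ 1 \<and> lamQ \<phi> \<le> 0 \<Longrightarrow> D \<phi> \<le> M0 * \<epsilon>"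
    using sign_mismatch_close by blast
  obtain L where L: "L > 0" and lamL: "\<And>X. \<bar>lam1 \<alpha> F X\<bar> \<le> L * norm X" using lam1_bound by blast
  \<comment> \<open>Half the inverse of the constant in \<open>D \<phi> \<le> C' * B * (\<bar>gap
    \<phi>\<bar> + \<epsilon>)\<close>, so that
    \<open>\<bar>gap \<phi>\<bar> \<ge> b * D \<phi>\<close> once
    \<open>\<epsilon> \<le> b * D \<phi>\<close>.\<close>
  define b where "b = 1 / (2 * (C' * B))"
  have b: "b > 0" using C' B by (simp add: b_def)
  define P where "P = m * q\<^sup>2 * b"
  have P: "P > 0" using q_pos alpha b by (simp add: P_def)
  \<comment> \<open>For \<open>D \<ge> M * \<epsilon>\<close> the first summand lets the sign of
    \<open>\<lambda>\<^sub>1\<close> decide that of x - q, the second gives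
    \<open>\<epsilon> \<le> b * D\<close>, and the third makes the error in
    \<open>virial_inside\<close> at most half of the main term.\<close>
  define M where "M = M0 + 1 / b + 2 * (2 + 4 * q) / P"
  have M: "M > 0" "M0 < M" "1 / b \<le> M" "2 * (2 + 4 * q) / P \<le> M"
    using M0 b P q_pos by (simp_all add: M_def add_pos_pos add_increasing2)
  \<comment> \<open>From \<open>2 * \<epsilon> \<le> D\<close> the excess is at most a quarter of
    D^2, so \<open>2 * k * \<lambda>\<^sub>1\<^sup>2\<close> makes up at least three
    quarters.\<close>
  define cl where "cl = sqrt (3 / (8 * k))"
  have cl: "cl > 0" using k_pos by (simp add: cl_def)
  define E where "E = C / c\<^sup>2 / cl\<^sup>2 * (L / c)"
  have E: "E > 0" using C c cl L by (simp add: E_def)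
  \<comment> \<open>In order: the exact formula for D^2, the range of \<open>near_ground\<close>,
    separation from the other ground state, two bounds on \<epsilon>, positivity of
    \<open>gap\<close>, and dominance of the linear term in \<open>ddlam\<close>.\<close>
  define dX where "dX = Min {\<delta>E, c * \<rho>, c * norm (ground \<alpha>) / 2, 1, \<epsilon>1, b * c\<^sup>2 / (2 * C), k\<^sup>2 / (2 * E)}"
  have g0: "norm (ground \<alpha>) > 0"
  proof -
    have "ground \<alpha> \<noteq> 0"
    proof
      assume "ground \<alpha> = 0"
      then have "ground \<alpha> $ 1 = 0" by simp
      then show False using q_pos by simp
    qed
    then show ?thesis by simp
  qed
  have dX: "0 < dX" "dX \<le> \<delta>E" "dX \<le> c * \<rho>" "dX \<le> c * norm (ground \<alpha>) / 2" "dX \<le> 1" "dX \<le> \<epsilon>1"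
    "dX \<le> b * c\<^sup>2 / (2 * C)" "dX \<le> k\<^sup>2 / (2 * E)"
  proof -
    have "\<forall>x\<in>{\<delta>E, c * \<rho>, c * norm (ground \<alpha>) / 2, 1, \<epsilon>1, b * c\<^sup>2 / (2 * C), k\<^sup>2 / (2 * E)}. 0 < x"
      using deltaE_pos c \<rho> g0 \<epsilon>1 b C k_pos E by simp
    then show "0 < dX" unfolding dX_def by (subst Min_gr_iff) auto
    show "dX \<le> \<delta>E" "dX \<le> c * \<rho>" "dX \<le> c * norm (ground \<alpha>) / 2" "dX \<le> 1" "dX \<le> \<epsilon>1"
      "dX \<le> b * c\<^sup>2 / (2 * C)" "dX \<le> k\<^sup>2 / (2 * E)"
      unfolding dX_def by (rule Min_le; simp)+
  qed
  have nb: "norm (\<phi> - ground \<alpha>) \<le> D \<phi> / c" "norm (\<phi> - ground \<alpha>) \<le> \<rho>" "norm (\<phi> - ground \<alpha>) \<le> norm (ground \<alpha>) / 2"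
    if "\<phi> \<in> phase_space" "D \<phi> \<le> dX" for \<phi>
  proof -
    have *: "norm (\<phi> - ground \<alpha>) * c \<le> D \<phi>" using lo[OF that(1)] by (simp only: mult.commute)
    show "norm (\<phi> - ground \<alpha>) \<le> D \<phi> / c" using * by (simp only: pos_le_divide_eq[OF c])
    have "norm (\<phi> - ground \<alpha>) * c \<le> \<rho> * c" using * that(2) dX(3) by argo
    then show "norm (\<phi> - ground \<alpha>) \<le> \<rho>" using c by simp
    have "norm (\<phi> - ground \<alpha>) * c \<le> (norm (ground \<alpha>) / 2) * c" using * that(2) dX(4) by argo
    then show "norm (\<phi> - ground \<alpha>) \<le> norm (ground \<alpha>) / 2" using c by simp
  qed
  define Cd where "Cd = max (C / c) (L / c)"
  have Cd: "Cd > 0" "C / c \<le> Cd" "L / c \<le> Cd" using C c by (auto simp: Cd_def less_max_iff_disj)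
  have lin: "a \<le> Cd * D \<phi>" if ps: "\<phi> \<in> phase_space" "D \<phi> \<le> dX" and a: "a \<le> A * norm (\<phi> - ground \<alpha>)" and A: "0 < A" "A / c \<le> Cd"
    for \<phi> a A
  proof -
    have "a \<le> A * (D \<phi> / c)" using a nb(1)[OF ps] A mult_left_mono[of "norm (\<phi> - ground \<alpha>)" "D \<phi> / c" A] by linarith
    also have "\<dots> = (A / c) * D \<phi>" by simp
    also have "\<dots> \<le> Cd * D \<phi>" using A D_bounds(3)[OF ps(1)] by (intro mult_right_mono)
    finally show ?thesis .
  qed
  define c1 where "c1 = P / 2"
  define C2 where "C2 = C / c * M"
  have pos: "0 < c1" "0 < C2" using P C c M by (simp_all add: c1_def C2_def)
  show thesis
  proof (rule that[of dX M c1 C2 Cd cl "q\<^sup>2 / 2"])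
    show "0 < dX" "dX \<le> \<delta>E" "0 < M" "0 < c1" "0 < C2" "0 < Cd" "0 < cl" "0 < q\<^sup>2 / 2"
      using dX M pos Cd cl q_pos by simp_all
  next
    fix \<phi> assume ps: "\<phi> \<in> phase_space" and d: "D \<phi> \<le> dX"
    note n = nb[OF ps d]
    note nr = near[OF n(2)]
    have "dX < D (- \<phi>)"
    proof -
      have "norm (- \<phi> - ground \<alpha>) + norm (\<phi> - ground \<alpha>) \<ge> norm ((- \<phi> - ground \<alpha>) + (\<phi> - ground \<alpha>))"
        by (rule norm_triangle_ineq)
      also have "(- \<phi> - ground \<alpha>) + (\<phi> - ground \<alpha>) = - (2 *\<^sub>R ground \<alpha>)" by (simp add: scaleR_2)
      finally have "2 * norm (ground \<alpha>) \<le> norm (- \<phi> - ground \<alpha>) + norm (\<phi> - ground \<alpha>)" by simp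
      then have "norm (ground \<alpha>) < norm (- \<phi> - ground \<alpha>)" using n(3) g0 by linarith
      then have "c * norm (ground \<alpha>) < c * norm (- \<phi> - ground \<alpha>)" using c by simp
      moreover have "c * norm (- \<phi> - ground \<alpha>) \<le> D (- \<phi>)" using ps by (intro lo) (simp add: minus_phase_space)
      moreover have "c * norm (ground \<alpha>) > 0" using c g0 by simp
      ultimately show ?thesis using dX(4) by linarith
    qed
    moreover have "q\<^sup>2 / 2 \<le> wsq \<phi>"
    proof -
      have "\<bar>gap \<phi>\<bar> \<le> 1/2" using nr by blast
      then have "1/2 \<le> 1 - gap \<phi>" by linarith
      then have "q\<^sup>2 * (1/2) \<le> q\<^sup>2 * (1 - gap \<phi>)" by (intro mult_left_mono) auto
      then show ?thesis unfolding wsq_gap by simp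
    qed
    moreover have "norm \<phi> \<le> norm (ground \<alpha>) + 1"
      using norm_triangle_ineq[of "\<phi> - ground \<alpha>" "ground \<alpha>"] n(2) \<rho> by simp
    ultimately show "dX < D (- \<phi>) \<and> q\<^sup>2 / 2 \<le> wsq \<phi> \<and> norm \<phi> \<le> norm (ground \<alpha>) + 1
      \<and> \<bar>radial \<phi>\<bar> \<le> Cd * D \<phi> \<and> \<bar>dlam \<phi>\<bar> \<le> Cd * D \<phi> \<and> \<bar>lamQ \<phi>\<bar> \<le> Cd * D \<phi>"
      using lin[OF ps d _ C Cd(2)] lin[OF ps d lamL L Cd(3)] nr by blast
  next
    fix \<phi> \<epsilon> assume ps: "\<phi> \<in> phase_space" and d: "D \<phi> \<le> dX" and e: "excess \<phi> \<le> \<epsilon>\<^sup>2" "0 < \<epsilon>" "\<epsilon> \<le> dX" and de: "2 * \<epsilon> \<le> D \<phi>"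
    note n = nb[OF ps d]
    note nr = near[OF n(2)]
    define n' where "n' = norm (\<phi> - ground \<alpha>)"
    have n': "0 \<le> n'" "n' \<le> D \<phi> / c" using n by (simp_all add: n'_def)
    have D0: "0 < D \<phi>" using de e by linarith
    have dE: "D \<phi> \<le> \<delta>E" using d dX by linarith
    note Dsq = D_sq[OF ps dE]
    have "(2 * \<epsilon>)\<^sup>2 \<le> (D \<phi>)\<^sup>2" using de e by (intro power_mono) auto
    then have "4 * excess \<phi> \<le> (D \<phi>)\<^sup>2" using e(1) by (simp add: power_mult_distrib)
    then have "3 * (D \<phi>)\<^sup>2 \<le> 8 * k * (lamQ \<phi>)\<^sup>2" using Dsq(1) by linarith
    moreover have "8 * k * cl\<^sup>2 = 3" using k_pos by (simp add: cl_def)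
    ultimately have "8 * k * (cl * D \<phi>)\<^sup>2 \<le> 8 * k * (lamQ \<phi>)\<^sup>2"
      by (simp add: power_mult_distrib mult.assoc[symmetric])
    then have "(cl * D \<phi>)\<^sup>2 \<le> (lamQ \<phi>)\<^sup>2" using k_pos by simp
    then have clD: "cl * D \<phi> \<le> \<bar>lamQ \<phi>\<bar>" using abs_le_square_iff[of "cl * D \<phi>" "lamQ \<phi>"] cl D0 by simp
    have lamsq: "cl\<^sup>2 * (D \<phi>)\<^sup>2 \<le> (lamQ \<phi>)\<^sup>2" using \<open>(cl * D \<phi>)\<^sup>2 \<le> _\<close> by (simp add: power_mult_distrib)
    have "k\<^sup>2 / 2 * (lamQ \<phi>)\<^sup>2 \<le> lamQ \<phi> * ddlam \<phi>"
    proof -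
      have n2: "n'\<^sup>2 \<le> (D \<phi>)\<^sup>2 / c\<^sup>2" using power_mono[OF n'(2,1), of 2] by (simp add: power_divide)
      have "(D \<phi>)\<^sup>2 \<le> (lamQ \<phi>)\<^sup>2 / cl\<^sup>2" using lamsq cl by (simp add: field_simps)
      then have "(D \<phi>)\<^sup>2 / c\<^sup>2 \<le> (lamQ \<phi>)\<^sup>2 / cl\<^sup>2 / c\<^sup>2" by (intro divide_right_mono) auto
      then have nl: "C * n'\<^sup>2 \<le> C * ((lamQ \<phi>)\<^sup>2 / cl\<^sup>2 / c\<^sup>2)" using n2 C by (intro mult_left_mono) auto
      have "\<bar>lamQ \<phi>\<bar> \<le> L * (D \<phi> / c)" using lamL[of "\<phi> - ground \<alpha>"] n' L mult_left_mono[OF n'(2), of L] unfolding n'_def by linarith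
      also have "\<dots> \<le> L * (dX / c)" using d L c by (intro mult_left_mono divide_right_mono) auto
      finally have lb: "\<bar>lamQ \<phi>\<bar> \<le> L / c * dX" by simp
      have "\<bar>lamQ \<phi> * (ddlam \<phi> - k\<^sup>2 * lamQ \<phi>)\<bar> \<le> (L / c * dX) * (C * ((lamQ \<phi>)\<^sup>2 / cl\<^sup>2 / c\<^sup>2))"
        unfolding abs_mult using lb nr nl L c dX unfolding n'_def by (intro mult_mono) auto
      also have "\<dots> = (E * dX) * (lamQ \<phi>)\<^sup>2" unfolding E_def by (simp add: field_simps)
      also have "\<dots> \<le> (k\<^sup>2 / 2) * (lamQ \<phi>)\<^sup>2"
      proof (rule mult_right_mono)
        have "E * dX \<le> E * (k\<^sup>2 / (2 * E))" using dX(8) E by (intro mult_left_mono) auto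
        then show "E * dX \<le> k\<^sup>2 / 2" using E by simp
      qed simp
      finally have "- (lamQ \<phi> * (ddlam \<phi> - k\<^sup>2 * lamQ \<phi>)) \<le> (k\<^sup>2 / 2) * (lamQ \<phi>)\<^sup>2" by (rule abs_le_D2)
      then show ?thesis by (simp add: power2_eq_square algebra_simps)
    qed
    moreover have "virial \<phi> \<le> C2 * \<epsilon>" if "D \<phi> \<le> M * \<epsilon>"
    proof -
      have "virial \<phi> \<le> C * n'" using nr by (simp add: n'_def)
      also have "\<dots> \<le> C * (D \<phi> / c)" using n' C by (intro mult_left_mono) auto
      also have "\<dots> \<le> C * (M * \<epsilon> / c)" using that C c by (intro mult_left_mono divide_right_mono) auto
      finally show ?thesis by (simp add: C2_def)
    qed
    moreover have "virial \<phi> \<le> - (c1 * D \<phi>) \<and> 0 < gap \<phi>" if MD: "M * \<epsilon> \<le> D \<phi>" and neg: "lamQ \<phi> < 0"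
    proof -
      have e1: "\<epsilon> \<le> 1" "\<epsilon> \<le> \<epsilon>1" using e dX by linarith+
      have "M0 * \<epsilon> < M * \<epsilon>" using M e by simp
      then have "\<not> D \<phi> \<le> M0 * \<epsilon>" using MD by linarith
      moreover have "NQ \<phi> \<le> (4 * \<delta>E)\<^sup>2" by (rule D_small_NQ[OF ps dE])
      ultimately have xq: "\<phi> $ 1 < q" using mis[OF ps _ e(1,2) e1(2)] neg by (meson less_imp_le not_less)
      have "n' \<le> B * (\<bar>gap \<phi>\<bar> + \<epsilon>)" unfolding n'_def using circ[OF ps _ e(1) _ e1(1)] nr e by auto
      then have "C' * n' \<le> C' * (B * (\<bar>gap \<phi>\<bar> + \<epsilon>))" using C' by (intro mult_left_mono) auto
      then have "D \<phi> \<le> (C' * B) * (\<bar>gap \<phi>\<bar> + \<epsilon>)" using hi[OF ps] by (simp add: n'_def)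
      then have g1: "2 * b * D \<phi> \<le> \<bar>gap \<phi>\<bar> + \<epsilon>" using C' B by (simp add: b_def field_simps)
      have "(1 / b) * \<epsilon> \<le> M * \<epsilon>" using e(2) by (intro mult_right_mono[OF M(3)]) simp
      then have "(1 / b) * \<epsilon> \<le> D \<phi>" using MD by linarith
      then have "\<epsilon> \<le> b * D \<phi>" using b by (simp add: field_simps)
      then have g2: "b * D \<phi> \<le> \<bar>gap \<phi>\<bar>" using g1 by linarith
      \<comment> \<open>x < q makes the linear part of \<open>gap\<close> positive. A negative
        \<open>gap\<close> would be of second order in \<open>D\<close>, against the lower bound on
        its absolute value.\<close>
      have "- gap \<phi> \<le> C * n'\<^sup>2"
      proof -
        have "2 / q * (\<phi> $ 1 - q) \<le> 0" using xq q_pos by (simp add: divide_nonpos_pos)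
        then show ?thesis using nr unfolding n'_def[symmetric] by (simp add: abs_le_iff)
      qed
      also have "\<dots> \<le> C * (D \<phi> / c)\<^sup>2" using n' C by (intro mult_left_mono power_mono) auto
      also have "\<dots> = (C / c\<^sup>2 * D \<phi>) * D \<phi>" by (simp add: power_divide power2_eq_square)
      also have "\<dots> \<le> (b / 2) * D \<phi>"
      proof (rule mult_right_mono)
        have "C / c\<^sup>2 * D \<phi> \<le> C / c\<^sup>2 * (b * c\<^sup>2 / (2 * C))" using d dX(7) C c by (intro mult_left_mono) auto
        then show "C / c\<^sup>2 * D \<phi> \<le> b / 2" using C c by simp
      qed (use D0 in simp)
      finally have g3: "- gap \<phi> \<le> b / 2 * D \<phi>" .
      have bD: "0 < b * D \<phi>" using b D0 by simp
      have gp: "0 < gap \<phi>"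
      proof (rule ccontr)
        assume "\<not> 0 < gap \<phi>"
        then have "\<bar>gap \<phi>\<bar> = - gap \<phi>" by simp
        then show False using g2 g3 bD by linarith
      qed
      have "virial \<phi> \<le> - (m * q\<^sup>2 * gap \<phi>) + (2 + 4 * q) * \<epsilon>"
        using virial_inside[OF ps _ e(1) _ e1(1)] gp e by simp
      moreover have "P * D \<phi> \<le> m * q\<^sup>2 * gap \<phi>"
      proof -
        have "m * q\<^sup>2 * (b * D \<phi>) \<le> m * q\<^sup>2 * gap \<phi>" using g2 gp alpha by (intro mult_left_mono) auto
        then show ?thesis by (simp add: P_def mult.assoc)
      qed
      moreover have "(2 + 4 * q) * \<epsilon> \<le> P / 2 * D \<phi>"
      proof -
        have "2 * (2 + 4 * q) / P * \<epsilon> \<le> M * \<epsilon>" using e(2) by (intro mult_right_mono[OF M(4)]) simp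
        then have "2 * (2 + 4 * q) / P * \<epsilon> \<le> D \<phi>" using MD by linarith
        then have "P / 2 * (2 * (2 + 4 * q) / P * \<epsilon>) \<le> P / 2 * D \<phi>" using P by (rule_tac mult_left_mono) simp_all
        moreover have "P / 2 * (2 * (2 + 4 * q) / P * \<epsilon>) = (2 + 4 * q) * \<epsilon>" using P by (simp add: field_simps)
        ultimately show ?thesis by (simp only:)
      qed
      ultimately have "virial \<phi> \<le> - (c1 * D \<phi>)" unfolding c1_def by linarith
      then show ?thesis using gp by blast
    qed
    ultimately show "cl * D \<phi> \<le> \<bar>lamQ \<phi>\<bar> \<and> k\<^sup>2 / 2 * (lamQ \<phi>)\<^sup>2 \<le> lamQ \<phi> * ddlam \<phi>
      \<and> (D \<phi> \<le> M * \<epsilon> \<longrightarrow> virial \<phi> \<le> C2 * \<epsilon>)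
      \<and> (M * \<epsilon> \<le> D \<phi> \<and> lamQ \<phi> < 0 \<longrightarrow> virial \<phi> \<le> - (c1 * D \<phi>) \<and> 0 < gap \<phi>)"
      using clD by blast
  qed
qed

text \<open>Away from the ground states \<open>near_circle_bound\<close> keeps points of the closed
  disc at a definite distance from its boundary circle, so the main term in
  \<open>virial_inside\<close> has a fixed size. The strict \<open>0 < gap\<close> in the conclusion
  is what later forbids crossing the circle.\<close>

lemma outer_virial:
  assumes d: "0 < \<delta>"
  shows "\<exists>\<epsilon>2>0. \<forall>\<phi> \<epsilon>. \<phi> \<in> phase_space \<and> \<delta> \<le> dQ \<phi> \<and> 0 \<le> gap \<phi> \<and> excess \<phi> \<le> \<epsilon>\<^sup>2 \<and> 0 \<le> \<epsilon> \<and> \<epsilon> \<le> \<epsilon>2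
    \<longrightarrow> 0 < gap \<phi> \<and> virial \<phi> \<le> 0"
proof -
  obtain C' where C': "C' > 0" and hi: "\<And>\<phi>. \<phi> \<in> phase_space \<Longrightarrow> D \<phi> \<le> C' * norm (\<phi> - ground \<alpha>)"
    using D_norm_equiv by metis
  obtain B where B: "B > 0" and circ: "\<And>\<phi> \<epsilon>. \<phi> \<in> phase_space \<Longrightarrow> \<bar>gap \<phi>\<bar> \<le> 1/2 \<Longrightarrow> excess \<phi> \<le> \<epsilon>\<^sup>2 \<Longrightarrow> 0 \<le> \<epsilon> \<Longrightarrow> \<epsilon> \<le> 1 \<Longrightarrow> 0 \<le> \<phi> $ 1
    \<Longrightarrow> norm (\<phi> - ground \<alpha>) \<le> B * (\<bar>gap \<phi>\<bar> + \<epsilon>)"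
    using near_circle_bound by blast
  define \<eta> where "\<eta> = min (1/2) (\<delta> / (2 * (C' * B)))"
  have \<eta>: "0 < \<eta>" "\<eta> \<le> 1/2" "\<eta> \<le> \<delta> / (2 * (C' * B))" using d C' B by (auto simp: \<eta>_def)
  \<comment> \<open>\<open>near_circle_bound\<close> yields
    \<open>2 * \<eta> \<le> gap + \<epsilon>\<close>, so \<open>\<epsilon> \<le> \<eta>\<close>
    leaves \<open>gap \<ge> \<eta>\<close>; the last entry keeps the error of
    \<open>virial_inside\<close> below its main term.\<close>
  define \<epsilon>2 where "\<epsilon>2 = min 1 (min \<eta> (m * q\<^sup>2 * \<eta> / (2 + 4 * q)))"
  have q24: "2 + 4 * q > 0" using q_pos by simp
  have \<epsilon>2: "0 < \<epsilon>2" "\<epsilon>2 \<le> 1" "\<epsilon>2 \<le> \<eta>" "\<epsilon>2 \<le> m * q\<^sup>2 * \<eta> / (2 + 4 * q)"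
    using \<eta> q24 q_pos alpha unfolding \<epsilon>2_def by auto
  have "0 < gap \<phi> \<and> virial \<phi> \<le> 0" if ps: "\<phi> \<in> phase_space" and dq: "\<delta> \<le> dQ \<phi>" and g: "0 \<le> gap \<phi>"
    and e: "excess \<phi> \<le> \<epsilon>\<^sup>2" "0 \<le> \<epsilon>" "\<epsilon> \<le> \<epsilon>2" for \<phi> \<epsilon>
  proof -
    have e1: "\<epsilon> \<le> 1" using e \<epsilon>2 by linarith
    have "\<eta> \<le> gap \<phi>"
    proof (cases "gap \<phi> \<le> 1/2")
      case True
      obtain \<phi>' where \<phi>': "\<phi>' \<in> {\<phi>, - \<phi>}" "0 \<le> \<phi>' $ 1"
      proof (cases "0 \<le> \<phi> $ 1")
        case True
        then show ?thesis using that[of \<phi>] by simp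
      next
        case False
        then show ?thesis using that[of "- \<phi>"] by simp
      qed
      have s: "\<phi>' \<in> phase_space" "gap \<phi>' = gap \<phi>" "excess \<phi>' = excess \<phi>" "dQ \<phi> \<le> D \<phi>'"
        using \<phi>'(1) ps minus_phase_space gap_minus excess_minus by (auto simp: dQ_eq)
      have "norm (\<phi>' - ground \<alpha>) \<le> B * (\<bar>gap \<phi>'\<bar> + \<epsilon>)"
        using s True g e e1 \<phi>' by (intro circ) auto
      then have "C' * norm (\<phi>' - ground \<alpha>) \<le> C' * (B * (gap \<phi> + \<epsilon>))"
        using C' s g by (intro mult_left_mono) auto
      then have "\<delta> \<le> (C' * B) * (gap \<phi> + \<epsilon>)" using hi[OF s(1)] s(4) dq by (simp add: mult.assoc)
      then have "2 * (\<delta> / (2 * (C' * B))) \<le> gap \<phi> + \<epsilon>" using C' B by (simp add: field_simps)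
      then show ?thesis using \<eta> \<epsilon>2 e by linarith
    qed (use \<eta> in linarith)
    then have "m * q\<^sup>2 * \<eta> \<le> m * q\<^sup>2 * gap \<phi>" using alpha by (intro mult_left_mono) auto
    moreover have "(2 + 4 * q) * \<epsilon> \<le> (2 + 4 * q) * (m * q\<^sup>2 * \<eta> / (2 + 4 * q))"
      using e \<epsilon>2 q24 by (intro mult_left_mono) auto
    moreover have "(2 + 4 * q) * (m * q\<^sup>2 * \<eta> / (2 + 4 * q)) = m * q\<^sup>2 * \<eta>" using q24 by simp
    moreover have "virial \<phi> \<le> - (m * q\<^sup>2 * gap \<phi>) + (2 + 4 * q) * \<epsilon>"
      using virial_inside[OF ps g e(1,2) e1] .
    ultimately have "virial \<phi> \<le> 0" by linarith
    then show ?thesis using \<open>\<eta> \<le> gap \<phi>\<close> \<eta> by linarith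
  qed
  then show ?thesis using \<epsilon>2 by blast
qed

section \<open>The sign function inside the disc\<close>

lemma W_eq:
  assumes ps: "\<phi> \<in> phase_space"
  shows "W \<alpha> \<phi> = m * (\<phi> $ 1)\<^sup>2 - hforce \<alpha> \<phi> * wsq \<phi>"
proof -
  define x y where "x = \<phi> $ 1" and "y = \<phi> $ 2"
  have w: "0 < x\<^sup>2 + y\<^sup>2" using ps by (simp add: phase_space_iff wsq_def x_def y_def)
  define h where "h = \<alpha> * m * (x\<^sup>2 + y\<^sup>2) powr (- m / 2)"
  have ex: "- \<alpha> / 2 - 1 = - m / 2" by (simp add: field_simps)
  have h': "(- \<alpha> / 2) * (x\<^sup>2 + y\<^sup>2) powr (- \<alpha> / 2 - 1) * m = - h / 2"
    unfolding ex h_def by simp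
  have Vx: "((\<lambda>s. V \<alpha> s y) has_real_derivative (- m * x + h * x)) (at x)"
  proof (rule has_field_derivative_transform_within_open)
    show "((\<lambda>s. - m / 2 * s\<^sup>2 - m * (s\<^sup>2 + y\<^sup>2) powr (- \<alpha> / 2)) has_real_derivative (- m * x + h * x)) (at x)"
    proof -
      have 1: "((\<lambda>s. s\<^sup>2 + y\<^sup>2) has_real_derivative 2 * x) (at x)" by (auto intro!: derivative_eq_intros)
      have 2: "((\<lambda>s. (s\<^sup>2 + y\<^sup>2) powr (- \<alpha> / 2)) has_real_derivative
        (- \<alpha> / 2) * (x\<^sup>2 + y\<^sup>2) powr (- \<alpha> / 2 - 1) * (2 * x)) (at x)"
        by (rule DERIV_chain2[OF has_real_derivative_powr[OF w] 1])
      have 3: "((\<lambda>s. - m / 2 * s\<^sup>2) has_real_derivative - m * x) (at x)" by (auto intro!: derivative_eq_intros)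
      have "- m * x + h * x = - m * x - m * ((- \<alpha> / 2) * (x\<^sup>2 + y\<^sup>2) powr (- \<alpha> / 2 - 1) * (2 * x))"
        using h' by algebra
      then show ?thesis using DERIV_diff[OF 3 DERIV_cmult[OF 2, of m]] by (simp only:)
    qed
    show "open {s. 0 < s\<^sup>2 + y\<^sup>2}" by (intro open_Collect_less continuous_intros)
  qed (use w in \<open>auto simp: V_eq\<close>)
  have Vy: "((\<lambda>s. V \<alpha> x s) has_real_derivative (h * y)) (at y)"
  proof (rule has_field_derivative_transform_within_open)
    show "((\<lambda>s. - m / 2 * x\<^sup>2 - m * (x\<^sup>2 + s\<^sup>2) powr (- \<alpha> / 2)) has_real_derivative (h * y)) (at y)"
    proof -
      have 1: "((\<lambda>s. x\<^sup>2 + s\<^sup>2) has_real_derivative 2 * y) (at y)" by (auto intro!: derivative_eq_intros)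
      have 2: "((\<lambda>s. (x\<^sup>2 + s\<^sup>2) powr (- \<alpha> / 2)) has_real_derivative
        (- \<alpha> / 2) * (x\<^sup>2 + y\<^sup>2) powr (- \<alpha> / 2 - 1) * (2 * y)) (at y)"
        by (rule DERIV_chain2[OF has_real_derivative_powr[OF w] 1])
      have "h * y = 0 - m * ((- \<alpha> / 2) * (x\<^sup>2 + y\<^sup>2) powr (- \<alpha> / 2 - 1) * (2 * y))"
        using h' by algebra
      then show ?thesis using DERIV_diff[OF DERIV_const[of "- m / 2 * x\<^sup>2"] DERIV_cmult[OF 2, of m]] by (simp only:)
    qed
    show "open {s. 0 < x\<^sup>2 + s\<^sup>2}" by (intro open_Collect_less continuous_intros)
  qed (use w in \<open>auto simp: V_eq\<close>)
  have hh: "hforce \<alpha> \<phi> = h" by (simp add: hforce_def h_def wsq_def x_def y_def)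
  show ?thesis
    unfolding W_def Let_def x_def[symmetric] y_def[symmetric] DERIV_imp_deriv[OF Vx] DERIV_imp_deriv[OF Vy] hh
    unfolding wsq_def x_def[symmetric] y_def[symmetric] by algebra
qed

lemma W_neg:
  assumes ps: "\<phi> \<in> phase_space" and g: "0 < gap \<phi>"
  shows "W \<alpha> \<phi> < 0"
proof -
  have "(\<phi> $ 1)\<^sup>2 \<le> q\<^sup>2 * (1 - gap \<phi>)" using wsq_gap[of \<phi>] zero_le_power2[of "\<phi> $ 2"] unfolding wsq_def by linarith
  also have "\<dots> < q\<^sup>2 * 1" using g q_pos by (intro mult_strict_left_mono) auto
  also have "\<dots> \<le> q\<^sup>2 * Zed \<phi>" using Zed_ge_1[OF ps] g by (intro mult_left_mono) auto
  finally have "m * (\<phi> $ 1)\<^sup>2 < m * (q\<^sup>2 * Zed \<phi>)" using alpha by simp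
  then show ?thesis unfolding W_eq[OF ps] hforce_wsq[OF ps] by (simp add: mult.assoc)
qed

text \<open>Unfolds the definite description in \<open>sign_fun\<close>; \<open>is_delta_E\<close>
  supplies the uniqueness.\<close>

lemma nearest_sign:
  assumes ps: "\<phi> \<in> phase_space" and d: "dQ \<phi> \<le> \<delta>E"
  obtains \<sigma> where "\<sigma> \<in> {1, -1}" "dQ \<phi> = D (\<sigma> *\<^sub>R \<phi>)" "sign_fun \<alpha> F chi \<delta>E \<phi> = sign0 (lamQ (\<sigma> *\<^sub>R \<phi>))"
    "\<And>\<tau>. \<tau> \<in> {1, -1} \<Longrightarrow> dQ \<phi> = D (\<tau> *\<^sub>R \<phi>) \<Longrightarrow> \<tau> = \<sigma>"
proof -
  have ex: "\<exists>!\<sigma>. is_nearest_sign \<alpha> F chi \<delta>E \<phi> \<sigma>" using deltaE ps d unfolding is_delta_E_def by blast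
  define \<sigma> where "\<sigma> = (THE \<sigma>. is_nearest_sign \<alpha> F chi \<delta>E \<phi> \<sigma>)"
  have s: "is_nearest_sign \<alpha> F chi \<delta>E \<phi> \<sigma>" unfolding \<sigma>_def by (rule theI'[OF ex])
  have s1: "\<sigma> \<in> {1, -1}" and s2: "dQ \<phi> = d_sigma \<alpha> F chi \<delta>E \<sigma> \<phi>"
    using s unfolding is_nearest_sign_def by (rule conjunct1, rule conjunct2)
  have s3: "dQ \<phi> = D (\<sigma> *\<^sub>R \<phi>)" using s2 d_sigma_sign[OF s1] by (rule trans)
  have "sign_fun \<alpha> F chi \<delta>E \<phi> = sign0 (lamQ (\<sigma> *\<^sub>R \<phi>))"
    using d unfolding sign_fun_def \<sigma>_def[symmetric] displacement_def by simp
  moreover have "\<tau> = \<sigma>" if "\<tau> \<in> {1, -1}" "dQ \<phi> = D (\<tau> *\<^sub>R \<phi>)" for \<tau>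
  proof -
    have "is_nearest_sign \<alpha> F chi \<delta>E \<phi> \<tau>"
      unfolding is_nearest_sign_def using that trans[OF that(2) d_sigma_sign[OF that(1), symmetric]] by (rule_tac conjI)
    then show ?thesis using ex s by blast
  qed
  ultimately show thesis using that[OF s1 s3] by blast
qed

text \<open>Within \<open>\<delta>E\<close> the disc gives x \<le> q, and
  \<open>\<lambda>\<^sub>1 \<ge> 0\<close> would be a sign mismatch, confining the point to distance
  \<delta> / 2. Beyond \<open>\<delta>E\<close> the sign is that of W, which is negative in the
  disc.\<close>

lemma outer_sign:
  assumes d: "0 < \<delta>"
  shows "\<exists>\<epsilon>3>0. \<forall>\<phi> \<epsilon>. \<phi> \<in> phase_space \<and> \<delta> \<le> dQ \<phi> \<and> 0 < gap \<phi> \<and> excess \<phi> \<le> \<epsilon>\<^sup>2 \<and> 0 < \<epsilon> \<and> \<epsilon> \<le> \<epsilon>3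
    \<longrightarrow> sign_fun \<alpha> F chi \<delta>E \<phi> = -1"
proof -
  obtain M0 \<epsilon>1 where M0: "M0 > 0" and \<epsilon>1: "\<epsilon>1 > 0"
    and mis: "\<And>\<phi> \<epsilon>. \<phi> \<in> phase_space \<Longrightarrow> NQ \<phi> \<le> (4 * \<delta>E)\<^sup>2 \<Longrightarrow> excess \<phi> \<le> \<epsilon>\<^sup>2 \<Longrightarrow> 0 < \<epsilon> \<Longrightarrow> \<epsilon> \<le> \<epsilon>1 \<Longrightarrow>
      \<phi> $ 1 \<le> q \<and> 0 \<le> lamQ \<phi> \<or> q \<le> \<phi> $ 1 \<and> lamQ \<phi> \<le> 0 \<Longrightarrow> D \<phi> \<le> M0 * \<epsilon>"
    using sign_mismatch_close by blast
  define \<epsilon>3 where "\<epsilon>3 = min \<epsilon>1 (\<delta> / (2 * M0))"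
  have \<epsilon>3: "0 < \<epsilon>3" "\<epsilon>3 \<le> \<epsilon>1" "\<epsilon>3 \<le> \<delta> / (2 * M0)" using \<epsilon>1 M0 d by (auto simp: \<epsilon>3_def)
  have "sign_fun \<alpha> F chi \<delta>E \<phi> = -1" if ps: "\<phi> \<in> phase_space" and dq: "\<delta> \<le> dQ \<phi>" and g: "0 < gap \<phi>"
    and e: "excess \<phi> \<le> \<epsilon>\<^sup>2" "0 < \<epsilon>" "\<epsilon> \<le> \<epsilon>3" for \<phi> \<epsilon>
  proof (cases "dQ \<phi> \<le> \<delta>E")
    case True
    obtain \<sigma> where \<sigma>: "\<sigma> \<in> {1, -1}" "dQ \<phi> = D (\<sigma> *\<^sub>R \<phi>)" "sign_fun \<alpha> F chi \<delta>E \<phi> = sign0 (lamQ (\<sigma> *\<^sub>R \<phi>))"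
      using nearest_sign[OF ps True] by metis
    define \<phi>' where "\<phi>' = \<sigma> *\<^sub>R \<phi>"
    have s: "\<phi>' \<in> phase_space" "gap \<phi>' = gap \<phi>" "excess \<phi>' = excess \<phi>"
      using \<sigma>(1) ps minus_phase_space gap_minus excess_minus by (auto simp: \<phi>'_def)
    have "(\<phi>' $ 1)\<^sup>2 \<le> q\<^sup>2 * (1 - gap \<phi>')" using wsq_gap[of \<phi>'] zero_le_power2[of "\<phi>' $ 2"] unfolding wsq_def by linarith
    also have "\<dots> \<le> q\<^sup>2 * 1" using g s by (intro mult_left_mono) auto
    finally have "\<phi>' $ 1 \<le> q" using q_pos by (intro power2_le_imp_le[of "\<phi>' $ 1" q]) auto
    moreover have "NQ \<phi>' \<le> (4 * \<delta>E)\<^sup>2"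
      using D_small_NQ[OF s(1)] True \<sigma>(2) unfolding \<phi>'_def by simp
    moreover have "\<not> D \<phi>' \<le> M0 * \<epsilon>"
    proof -
      have "M0 * \<epsilon> \<le> M0 * (\<delta> / (2 * M0))" using e \<epsilon>3 M0 by (intro mult_left_mono) auto
      also have "\<dots> = \<delta> / 2" using M0 by simp
      finally show ?thesis using dq \<sigma>(2) d unfolding \<phi>'_def by linarith
    qed
    moreover have "excess \<phi>' \<le> \<epsilon>\<^sup>2" "\<epsilon> \<le> \<epsilon>1" using e \<epsilon>3 s(3) by linarith+
    ultimately have "lamQ \<phi>' < 0" using mis[OF s(1), of \<epsilon>] e(2) by (meson not_less)
    then show ?thesis using \<sigma>(3) by (simp add: \<phi>'_def sign0_def)
  next
    case False
    then show ?thesis using W_neg[OF ps g] by (simp add: sign_fun_def sign0_def)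
  qed
  then show ?thesis using \<epsilon>3 by blast
qed

end

subsection \<open>Solutions, ejection and collision\<close>

lemma first_hit:
  fixes f :: "real \<Rightarrow> real"
  assumes ab: "a \<le> b" and cont: "continuous_on {a..b} f" and fa: "c < f a" and fb: "f b \<le> c"
  obtains t where "a < t" "t \<le> b" "f t = c" "\<And>s. a \<le> s \<Longrightarrow> s \<le> t \<Longrightarrow> c \<le> f s"
proof -
  define B where "B = {s \<in> {a..b}. f s \<le> c}"
  have cl: "closed B" unfolding B_def
    by (rule continuous_on_closed_Collect_le) (auto intro: cont)
  have ne: "B \<noteq> {}" using ab fb by (auto simp: B_def)
  have bd: "bdd_below B" by (auto simp: B_def intro!: bdd_belowI[of _ a])
  define t where "t = Inf B"
  have tB: "t \<in> B" unfolding t_def by (rule closed_contains_Inf[OF ne bd cl])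
  then have t: "a \<le> t" "t \<le> b" "f t \<le> c" by (auto simp: B_def)
  have before: "c < f s" if "a \<le> s" "s < t" for s
  proof (rule ccontr)
    assume "\<not> c < f s"
    then have "s \<in> B" using that t by (auto simp: B_def)
    then have "t \<le> s" unfolding t_def by (rule cInf_lower[OF _ bd])
    then show False using that by simp
  qed
  have "f t = c"
  proof (rule ccontr)
    assume "f t \<noteq> c"
    then have lt: "f t < c" using t by simp
    have "continuous_on {a..t} f" using cont t by (auto intro: continuous_on_subset)
    then obtain s where s: "a \<le> s" "s \<le> t" "f s = c" using IVT2'[of f t c a] lt fa t by auto
    then have "s \<noteq> t" using lt by auto
    then show False using before[of s] s by auto
  qed
  moreover have "a \<noteq> t" using fa t by auto
  ultimately show thesis using that[of t] t before by (metis le_less order_refl)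
qed

lemma deriv_nonneg_mono:
  fixes f :: "real \<Rightarrow> real"
  assumes "a \<le> b" "\<And>t. a \<le> t \<Longrightarrow> t \<le> b \<Longrightarrow> (f has_real_derivative f' t) (at t)" "\<And>t. a \<le> t \<Longrightarrow> t \<le> b \<Longrightarrow> 0 \<le> f' t"
  shows "f a \<le> f b"
  by (rule DERIV_nonneg_imp_nondecreasing[OF assms(1)]) (use assms in blast)

text \<open>For the exit time, where only the earlier values are known to lie below the present
  one.\<close>

lemma deriv_nonneg_from_left:
  fixes f :: "real \<Rightarrow> real"
  assumes d: "(f has_real_derivative d) (at t)" and a: "a < t" and le: "\<And>s. a < s \<Longrightarrow> s < t \<Longrightarrow> f s \<le> f t"
  shows "0 \<le> d"
proof (rule ccontr)
  assume "\<not> 0 \<le> d"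
  then obtain e where e: "e > 0" "\<And>h. 0 < h \<Longrightarrow> h < e \<Longrightarrow> f t < f (t - h)"
    using DERIV_neg_dec_left[OF d] by auto
  define h where "h = min (e / 2) ((t - a) / 2)"
  have "0 < h" "h < e" "h < t - a" using e a by (auto simp: h_def min_less_iff_disj)
  then show False using e(2)[of h] le[of "t - h"] by force
qed

lemma DERIV_dot:
  fixes x y u v :: "real \<Rightarrow> real"
  assumes "(x has_real_derivative x') (at t)" "(y has_real_derivative y') (at t)"
    "(u has_real_derivative u') (at t)" "(v has_real_derivative v') (at t)"
  shows "((\<lambda>t. x t * u t + y t * v t) has_real_derivative (x' * u t + u' * x t + (y' * v t + v' * y t))) (at t)"
  by (intro DERIV_add DERIV_mult assms)

context hill_distance
begin

section \<open>Reflection symmetry of the flow\<close>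

lemma is_solution_iff:
  "is_solution \<alpha> \<psi> T \<longleftrightarrow> 0 < T \<and> (\<forall>t. 0 \<le> t \<and> ereal t < T \<longrightarrow> \<psi> t \<in> phase_space \<and>
    (\<psi> has_vector_derivative field \<alpha> (\<psi> t)) (at t within {s. 0 \<le> s \<and> ereal s < T}))"
  unfolding is_solution_def field_def using grad_energy[of _ \<alpha>] by (metis (no_types, lifting))

lemma field_minus: "field \<alpha> (- \<phi>) = - field \<alpha> \<phi>"
  unfolding vec4_eq_iff field_nth vector_uminus_component
  by (simp add: hforce_def wsq_def field_nth)

lemma is_solution_minus:
  assumes "is_solution \<alpha> \<psi> T"
  shows "is_solution \<alpha> (\<lambda>t. - \<psi> t) T"
  using assms unfolding is_solution_iff minus_phase_space field_minus
  by (auto intro: has_vector_derivative_minus)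

lemma is_maximal_solution_minus:
  assumes "is_maximal_solution \<alpha> \<psi> T"
  shows "is_maximal_solution \<alpha> (\<lambda>t. - \<psi> t) T"
  unfolding is_maximal_solution_def
proof (intro conjI notI)
  show "is_solution \<alpha> (\<lambda>t. - \<psi> t) T"
    using assms by (intro is_solution_minus) (simp add: is_maximal_solution_def)
  assume "\<exists>\<phi> T'. T < T' \<and> is_solution \<alpha> \<phi> T' \<and> (\<forall>t. 0 \<le> t \<and> ereal t < T \<longrightarrow> \<phi> t = - \<psi> t)"
  then obtain \<phi> T' where 1: "T < T'" "is_solution \<alpha> \<phi> T'" "\<forall>t. 0 \<le> t \<and> ereal t < T \<longrightarrow> \<phi> t = - \<psi> t" by blast
  have "\<exists>\<phi> T'. T < T' \<and> is_solution \<alpha> \<phi> T' \<and> (\<forall>t. 0 \<le> t \<and> ereal t < T \<longrightarrow> \<phi> t = \<psi> t)"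
    by (rule exI[of _ "\<lambda>t. - \<phi> t"], rule exI[of _ T']) (use 1 is_solution_minus[OF 1(2)] in auto)
  then show False using conjunct2[OF assms[unfolded is_maximal_solution_def]] by (rule notE[rotated])
qed

lemma maximal_bounded_global:
  assumes sol: "is_maximal_solution \<alpha> \<psi> T" and t1: "0 \<le> t1" "ereal t1 < T" and w: "0 < w"
    and b: "\<And>t. t1 \<le> t \<Longrightarrow> ereal t < T \<Longrightarrow> norm (\<psi> t) \<le> B \<and> w \<le> wsq (\<psi> t)"
  shows "T = \<infinity>"
proof (rule maximal_solution_leaves_compact[OF sol _ _ t1])
  have "closed {\<phi>. w \<le> wsq \<phi>}" unfolding wsq_def by (intro closed_Collect_le continuous_intros)
  then show "compact (cball 0 B \<inter> {\<phi>. w \<le> wsq \<phi>})" by (intro compact_Int_closed compact_cball)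
  show "cball 0 B \<inter> {\<phi>. w \<le> wsq \<phi>} \<subseteq> phase_space" using w by (auto simp: phase_space_iff)
  show "\<psi> t \<in> cball 0 B \<inter> {\<phi>. w \<le> wsq \<phi>}" if "t1 \<le> t" "ereal t < T" for t using b[OF that] by simp
qed

end

section \<open>Time derivatives along a solution\<close>

locale hill_solution = hill_distance +
  fixes \<psi> :: "real \<Rightarrow> phase" and T :: ereal
  assumes sol: "is_solution \<alpha> \<psi> T"
begin

lemma in_phase_space: "0 \<le> t \<Longrightarrow> ereal t < T \<Longrightarrow> \<psi> t \<in> phase_space"
  using sol by (simp add: is_solution_iff)

text \<open>Positive times only: at 0 the derivative in \<open>is_solution\<close> is
  one-sided.\<close>

lemma deriv_at:
  assumes t: "0 < t" "ereal t < T"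
  shows "(\<psi> has_vector_derivative field \<alpha> (\<psi> t)) (at t)"
proof -
  obtain b where b: "ereal t < ereal b" "ereal b < T" using ereal_dense2[OF t(2)] by blast
  let ?S = "{s. 0 \<le> s \<and> ereal s < T}"
  have "{0<..<b} \<subseteq> ?S" using b(2) by (auto intro: less_trans[of "ereal _" "ereal b"])
  then have "t \<in> interior ?S" using t b(1) by (intro interiorI[of "{0<..<b}"]) auto
  then have "at t within ?S = at t" by (rule at_within_interior)
  then show ?thesis using sol t unfolding is_solution_iff by (metis less_imp_le)
qed

lemma continuous_on_sol: "continuous_on {s. 0 \<le> s \<and> ereal s < T} \<psi>"
  unfolding continuous_on_eq_continuous_within
  using sol unfolding is_solution_iff by (auto intro: has_vector_derivative_continuous)

lemma continuous_on_comp: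
  assumes "continuous_on phase_space g" "0 \<le> a" "ereal b < T"
  shows "continuous_on {a..b} (\<lambda>t. g (\<psi> t))"
proof (rule continuous_on_compose2[OF assms(1)])
  have *: "{a..b} \<subseteq> {s. 0 \<le> s \<and> ereal s < T}"
    using assms by (auto intro: le_less_trans[of "ereal _" "ereal b"])
  show "continuous_on {a..b} \<psi>" by (rule continuous_on_subset[OF continuous_on_sol *])
  show "\<psi> ` {a..b} \<subseteq> phase_space" using * in_phase_space by auto
qed

lemma excess_const: "0 \<le> t \<Longrightarrow> ereal t < T \<Longrightarrow> excess (\<psi> t) = excess (\<psi> 0)"
  using energy_conserved[OF sol] by (simp add: excess_def)

lemma component_deriv:
  assumes t: "0 < t" "ereal t < T"
  shows "((\<lambda>t. \<psi> t $ i) has_real_derivative field \<alpha> (\<psi> t) $ i) (at t)"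
  unfolding has_real_derivative_iff_has_vector_derivative
  by (rule bounded_linear.has_vector_derivative[OF bounded_linear_vec_nth deriv_at[OF t]])

lemma v1_deriv:
  assumes t: "0 < t" "ereal t < T"
  shows "((\<lambda>t. \<psi> t $ 3 + \<psi> t $ 2) has_real_derivative
    (2 * (\<psi> t $ 4 - \<psi> t $ 1) + (m - hforce \<alpha> (\<psi> t)) * \<psi> t $ 1)) (at t)"
  by (rule DERIV_cong[OF DERIV_add[OF component_deriv[OF t] component_deriv[OF t]]])
    (simp add: field_nth algebra_simps)

lemma v2_deriv:
  assumes t: "0 < t" "ereal t < T"
  shows "((\<lambda>t. \<psi> t $ 4 - \<psi> t $ 1) has_real_derivative
    (- 2 * (\<psi> t $ 3 + \<psi> t $ 2) - hforce \<alpha> (\<psi> t) * \<psi> t $ 2)) (at t)"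
  by (rule DERIV_cong[OF DERIV_diff[OF component_deriv[OF t] component_deriv[OF t]]])
    (simp add: field_nth algebra_simps)

lemma wsq_deriv:
  assumes t: "0 < t" "ereal t < T"
  shows "((\<lambda>t. wsq (\<psi> t)) has_real_derivative 2 * radial (\<psi> t)) (at t)"
proof -
  have e: "(\<lambda>t. wsq (\<psi> t)) = (\<lambda>t. \<psi> t $ 1 * \<psi> t $ 1 + \<psi> t $ 2 * \<psi> t $ 2)"
    by (simp add: wsq_def power2_eq_square fun_eq_iff)
  show ?thesis unfolding e
    by (rule DERIV_cong[OF DERIV_dot[OF component_deriv[OF t] component_deriv[OF t] component_deriv[OF t] component_deriv[OF t]]])
      (simp add: field_nth radial_def algebra_simps)
qed

lemma radial_deriv:
  assumes t: "0 < t" "ereal t < T"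
  shows "((\<lambda>t. radial (\<psi> t)) has_real_derivative virial (\<psi> t)) (at t)"
  unfolding radial_def
  by (rule DERIV_cong[OF DERIV_dot[OF component_deriv[OF t] component_deriv[OF t] v1_deriv[OF t] v2_deriv[OF t]]])
    (simp add: field_nth virial_def vsq_def wsq_def power2_eq_square algebra_simps)

lemma lam_deriv:
  assumes t: "0 < t" "ereal t < T"
  shows "((\<lambda>t. lamQ (\<psi> t)) has_real_derivative dlam (\<psi> t)) (at t)"
proof -
  have e: "(\<lambda>t. lamQ (\<psi> t)) = (\<lambda>t. amp * (slope * (\<psi> t $ 1 - q) - mu * (\<psi> t $ 4 - \<psi> t $ 1)))"
    unfolding lam1_eq by (simp add: fun_eq_iff)
  have k: "k = slope + 2 * mu" by (simp add: slope_def)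
  have "((\<lambda>t. \<psi> t $ 1 - q) has_real_derivative field \<alpha> (\<psi> t) $ 1 - 0) (at t)"
    by (intro DERIV_diff component_deriv t DERIV_const)
  from DERIV_cmult[OF DERIV_diff[OF DERIV_cmult[OF this, of slope] DERIV_cmult[OF v2_deriv[OF t], of mu]], of amp]
  show ?thesis unfolding e
    by (rule DERIV_cong) (simp add: field_nth dlam_def k algebra_simps)
qed

lemma dlam_deriv:
  assumes t: "0 < t" "ereal t < T"
  shows "((\<lambda>t. dlam (\<psi> t)) has_real_derivative ddlam (\<psi> t)) (at t)"
proof -
  have p: "\<psi> t \<in> phase_space" using in_phase_space t by simp
  have d: "(\<psi> has_derivative (\<lambda>h. h *\<^sub>R field \<alpha> (\<psi> t))) (at t)"
    using deriv_at[OF t] by (simp add: has_vector_derivative_def)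
  have "((\<lambda>t. hforce \<alpha> (\<psi> t) * \<psi> t $ 2) has_real_derivative
    (hforce \<alpha> (\<psi> t) * (\<psi> t $ 4 - \<psi> t $ 1) - m * hforce \<alpha> (\<psi> t) / wsq (\<psi> t) * radial (\<psi> t) * \<psi> t $ 2)) (at t)"
    unfolding has_field_derivative_def
    by (rule has_derivative_eq_rhs[OF has_derivative_compose[OF d hforce_mult_has_derivative[OF p]]])
      (simp add: fun_eq_iff field_nth radial_def algebra_simps)
  from DERIV_cmult[OF DERIV_add[OF DERIV_cmult[OF v1_deriv[OF t], of k] DERIV_cmult[OF this, of mu]], of amp]
  show ?thesis unfolding dlam_def ddlam_def .
qed

end

section \<open>Ejection from the ground state\<close>

context hill_distance
begin

lemma D_nonneg: "\<phi> \<in> phase_space \<Longrightarrow> 0 \<le> D \<phi>"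
  by (rule D_bounds(3))

lemma continuous_on_lamQ: "continuous_on S lamQ"
  unfolding lam1_eq by (intro continuous_intros)

text \<open>
  Near the ground state \<open>D\<^sup>2\<close> is convex along the flow, so a solution that crosses the level \<open>r\<^sub>0\<close>
  outwards with \<open>\<lambda>\<^sub>1 < 0\<close> is ejected to the fixed level \<open>dX\<close>, and by then the virial identity has made
  \<open>radial\<close> negative by a fixed amount.
\<close>

lemma ejection:
  obtains dX \<kappa> r1 Cd cw where "0 < dX" "dX \<le> \<delta>E" "0 < \<kappa>" "0 < r1" "r1 < dX" "0 < Cd" "0 < cw"
    "\<And>\<phi>. \<phi> \<in> phase_space \<Longrightarrow> D \<phi> \<le> dX \<Longrightarrow> dX < D (- \<phi>) \<and> cw \<le> wsq \<phi> \<and> norm \<phi> \<le> norm (ground \<alpha>) + 1 \<and> \<bar>radial \<phi>\<bar> \<le> Cd * D \<phi>"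
    "\<And>\<psi> T \<epsilon> r0 t0 a. is_maximal_solution \<alpha> \<psi> T \<Longrightarrow> 0 \<le> a \<Longrightarrow> a < t0 \<Longrightarrow> ereal t0 < T \<Longrightarrow> 0 < \<epsilon> \<Longrightarrow> 2 * \<epsilon> < r0 \<Longrightarrow> r0 \<le> r1 \<Longrightarrow>
      excess (\<psi> 0) \<le> \<epsilon>\<^sup>2 \<Longrightarrow> D (\<psi> t0) = r0 \<Longrightarrow> lamQ (\<psi> t0) < 0 \<Longrightarrow> (\<And>t. a < t \<Longrightarrow> t < t0 \<Longrightarrow> D (\<psi> t) \<le> r0) \<Longrightarrow>
      \<exists>S\<ge>t0. ereal S < T \<and> D (\<psi> S) = dX \<and> 0 < gap (\<psi> S) \<and> radial (\<psi> S) \<le> - \<kappa> \<and>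
        (\<forall>t. t0 \<le> t \<and> t \<le> S \<longrightarrow> r0 \<le> D (\<psi> t) \<and> D (\<psi> t) \<le> dX \<and> lamQ (\<psi> t) < 0)"
proof -
  obtain dX M c1 C2 Cd cl cw where c: "0 < dX" "dX \<le> \<delta>E" "0 < M" "0 < c1" "0 < C2" "0 < Cd" "0 < cl" "0 < cw"
    and loc: "\<And>\<phi>. \<phi> \<in> phase_space \<Longrightarrow> D \<phi> \<le> dX \<Longrightarrow> dX < D (- \<phi>) \<and> cw \<le> wsq \<phi> \<and> norm \<phi> \<le> norm (ground \<alpha>) + 1
      \<and> \<bar>radial \<phi>\<bar> \<le> Cd * D \<phi> \<and> \<bar>dlam \<phi>\<bar> \<le> Cd * D \<phi> \<and> \<bar>lamQ \<phi>\<bar> \<le> Cd * D \<phi>"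
    and ej: "\<And>\<phi> \<epsilon>. \<phi> \<in> phase_space \<Longrightarrow> D \<phi> \<le> dX \<Longrightarrow> excess \<phi> \<le> \<epsilon>\<^sup>2 \<Longrightarrow> 0 < \<epsilon> \<Longrightarrow> \<epsilon> \<le> dX \<Longrightarrow> 2 * \<epsilon> \<le> D \<phi> \<Longrightarrow>
      cl * D \<phi> \<le> \<bar>lamQ \<phi>\<bar> \<and> k\<^sup>2 / 2 * (lamQ \<phi>)\<^sup>2 \<le> lamQ \<phi> * ddlam \<phi>
      \<and> (D \<phi> \<le> M * \<epsilon> \<longrightarrow> virial \<phi> \<le> C2 * \<epsilon>)
      \<and> (M * \<epsilon> \<le> D \<phi> \<and> lamQ \<phi> < 0 \<longrightarrow> virial \<phi> \<le> - (c1 * D \<phi>) \<and> 0 < gap \<phi>)"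
    by (rule near_facts) blast
  \<comment> \<open>\<open>Cd * D\<close> bounds \<open>dlam\<close>, so with this weight
    \<open>virial - c3 * dlam\<close> is nonpositive as soon as
    \<open>virial \<le> - (c1 * D)\<close>. For \<open>D \<le> M * \<epsilon>\<close> the same
    expression is at most \<open>C5 * \<epsilon>\<close>.\<close>
  define c3 where "c3 = c1 / Cd"
  define C5 where "C5 = C2 + c1 * M"
  \<comment> \<open>The waiting time: \<open>\<lambda>\<^sub>1\<close> starts with size at least
    \<open>2 * cl * \<epsilon>\<close> and grows at least by the factor
    \<open>k\<^sup>2 / 4 * K\<close>, which brings \<open>D\<close> above
    \<open>M * \<epsilon>\<close>. The added 1 ensures \<open>K \<le> K\<^sup>2\<close>.\<close>
  define K where "K = 2 * M * Cd / (cl * k\<^sup>2) + 1"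
  define C6 where "C6 = Cd + c1 + C5 * K"
  define c4 where "c4 = c3 * cl"
  \<comment> \<open>The second entry gives \<open>M * \<epsilon> \<le> dX\<close> at the end of the
    ejection; the third makes the loss \<open>C6 * r0\<close> at most half of the gain
    \<open>c4 * dX\<close>.\<close>
  define r1 where "r1 = min (dX / 2) (min (dX / M) (c4 * dX / (2 * C6)))"
  have k2: "0 < k\<^sup>2" using k_pos by simp
  have K: "1 \<le> K" using c k2 by (simp add: K_def)
  have pos: "0 < c3" "0 < C5" "0 < c4" using c by (simp_all add: c3_def C5_def c4_def add_pos_pos)
  have C6: "0 < C6" unfolding C6_def using c pos K by (intro add_pos_pos) auto
  have r1: "0 < r1" "r1 < dX" "r1 \<le> dX / M" "r1 \<le> c4 * dX / (2 * C6)"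
    using c pos C6 by (simp_all add: r1_def min_less_iff_disj)
  show thesis
  proof (rule that[of dX "c4 * dX / 2" r1 Cd cw])
    show "0 < dX" "dX \<le> \<delta>E" "0 < c4 * dX / 2" "0 < r1" "r1 < dX" "0 < Cd" "0 < cw" using c pos r1 by simp_all
  next
    fix \<phi> assume "\<phi> \<in> phase_space" "D \<phi> \<le> dX"
    then show "dX < D (- \<phi>) \<and> cw \<le> wsq \<phi> \<and> norm \<phi> \<le> norm (ground \<alpha>) + 1 \<and> \<bar>radial \<phi>\<bar> \<le> Cd * D \<phi>"
      using loc by blast
  next
    fix \<psi> T \<epsilon> r0 t0 a
    assume max: "is_maximal_solution \<alpha> \<psi> T" and a: "0 \<le> a" "a < t0" and t0: "ereal t0 < T"
      and eps: "0 < \<epsilon>" "2 * \<epsilon> < r0" and r0: "r0 \<le> r1" and ex: "excess (\<psi> 0) \<le> \<epsilon>\<^sup>2"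
      and Dt0: "D (\<psi> t0) = r0" and lam0: "lamQ (\<psi> t0) < 0"
      and left: "\<And>t. a < t \<Longrightarrow> t < t0 \<Longrightarrow> D (\<psi> t) \<le> r0"
    interpret hill_solution \<alpha> F chi \<delta>E \<psi> T
      by unfold_locales (use max in \<open>simp add: is_maximal_solution_def\<close>)
    have t0p: "0 < t0" using a by simp
    have r0X: "0 < r0" "r0 < dX" using eps r0 r1 by linarith+
    have eX: "\<epsilon> \<le> dX" using eps r0X by linarith
    define l0 where "l0 = lamQ (\<psi> t0)"
    have rng: "0 < t \<and> ereal t < T \<and> \<psi> t \<in> phase_space \<and> excess (\<psi> t) \<le> \<epsilon>\<^sup>2"
      if "t0 \<le> t" "t \<le> t1" "ereal t1 < T" for t t1
    proof -
      have "0 < t" using that t0p by simp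
      moreover have "ereal t < T" using that by (metis ereal_less_eq(3) le_less_trans)
      ultimately show ?thesis using in_phase_space[of t] excess_const[of t] ex by simp
    qed
    \<comment> \<open>\<open>D\<close> does not exceed \<open>r0\<close> shortly before
      \<open>t0\<close> and equals it there. So D^2, a constant plus
      \<open>2 * k * \<lambda>\<^sub>1\<^sup>2\<close>, has nonnegative derivative at
      \<open>t0\<close>: the crossing is not inward.\<close>
    have left_deriv: "0 \<le> lamQ (\<psi> t0) * dlam (\<psi> t0)"
    proof -
      have sq: "(D (\<psi> t))\<^sup>2 = excess (\<psi> 0) + 2 * k * (lamQ (\<psi> t))\<^sup>2" if "0 \<le> t" "ereal t < T" "D (\<psi> t) \<le> r0" for t
        using D_sq(1)[OF in_phase_space[OF that(1,2)]] excess_const[OF that(1,2)] that(3) r0X c by simp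
      have d: "((\<lambda>t. excess (\<psi> 0) + 2 * k * (lamQ (\<psi> t))\<^sup>2) has_real_derivative
        0 + 2 * k * (of_nat 2 * (dlam (\<psi> t0) * lamQ (\<psi> t0) ^ (2 - Suc 0)))) (at t0)"
        by (intro DERIV_add DERIV_const DERIV_cmult DERIV_power lam_deriv t0p t0)
      have "0 \<le> 0 + 2 * k * (of_nat 2 * (dlam (\<psi> t0) * lamQ (\<psi> t0) ^ (2 - Suc 0)))"
      proof (rule deriv_nonneg_from_left[OF d a(2)])
        fix s assume s: "a < s" "s < t0"
        have sT: "0 \<le> s" "ereal s < T" using s a t0 by (simp, metis ereal_less_eq(3) le_less_trans less_imp_le)
        have "(D (\<psi> s))\<^sup>2 \<le> (D (\<psi> t0))\<^sup>2"
          using left[OF s] D_nonneg[OF in_phase_space[OF sT]] Dt0 by (intro power_mono) auto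
        then show "excess (\<psi> 0) + 2 * k * (lamQ (\<psi> s))\<^sup>2 \<le> excess (\<psi> 0) + 2 * k * (lamQ (\<psi> t0))\<^sup>2"
          using sq[OF sT] left[OF s] sq[of t0] t0p t0 Dt0 by simp
      qed
      then have "0 \<le> (4 * k) * (lamQ (\<psi> t0) * dlam (\<psi> t0))" by (simp add: mult_ac)
      then show ?thesis using k_pos by (simp add: zero_le_mult_iff)
    qed
    \<comment> \<open>The estimates hold on any interval on which \<open>D \<le> dX\<close>. They
      are applied twice: to show that this bound must fail, and on the interval up to the first time
      with \<open>D = dX\<close>.\<close>
    have seg: "(\<forall>t. t0 \<le> t \<and> t \<le> t1 \<longrightarrow> r0 \<le> D (\<psi> t) \<and> lamQ (\<psi> t) < 0)
        \<and> lamQ (\<psi> t1) \<le> l0 + k\<^sup>2 / 4 * l0 * (t1 - t0)\<^sup>2 \<and> radial (\<psi> t1) \<le> C6 * r0 - c4 * D (\<psi> t1)"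
      if t1: "t0 \<le> t1" "ereal t1 < T" and dx: "\<And>t. t0 \<le> t \<Longrightarrow> t \<le> t1 \<Longrightarrow> D (\<psi> t) \<le> dX" for t1
    proof -
      note rg = rng[OF _ _ t1(2)]
      \<comment> \<open>While \<open>D \<ge> 2 * \<epsilon>\<close>, the product
        \<open>lamQ * dlam\<close> has the nonnegative derivative
        \<open>dlam\<^sup>2 + lamQ * ddlam\<close>. It starts nonnegative by
        \<open>left_deriv\<close>, so D^2 does not decrease.\<close>
      have convex: "r0 \<le> D (\<psi> t2) \<and> (\<forall>t. t0 \<le> t \<and> t \<le> t2 \<longrightarrow> 0 \<le> lamQ (\<psi> t) * dlam (\<psi> t))"
        if t2: "t0 \<le> t2" "t2 \<le> t1" and big: "\<And>t. t0 \<le> t \<Longrightarrow> t \<le> t2 \<Longrightarrow> 2 * \<epsilon> \<le> D (\<psi> t)" for t2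
      proof -
        have g: "0 \<le> lamQ (\<psi> t) * dlam (\<psi> t)" if t: "t0 \<le> t" "t \<le> t2" for t
        proof -
          have "lamQ (\<psi> t0) * dlam (\<psi> t0) \<le> lamQ (\<psi> t) * dlam (\<psi> t)"
          proof (rule deriv_nonneg_mono[OF t(1)])
            fix s assume s: "t0 \<le> s" "s \<le> t"
            then have s1: "s \<le> t1" using t t2 by simp
            note r = rg[OF s(1) s1]
            show "((\<lambda>s. lamQ (\<psi> s) * dlam (\<psi> s)) has_real_derivative
              dlam (\<psi> s) * dlam (\<psi> s) + ddlam (\<psi> s) * lamQ (\<psi> s)) (at s)"
              using r by (intro DERIV_mult lam_deriv dlam_deriv) auto
            have "k\<^sup>2 / 2 * (lamQ (\<psi> s))\<^sup>2 \<le> lamQ (\<psi> s) * ddlam (\<psi> s)"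
              using ej[of "\<psi> s" \<epsilon>] r dx[OF s(1) s1] eps(1) eX big[OF s(1)] s(2) t(2) by auto
            moreover have "0 \<le> k\<^sup>2 / 2 * (lamQ (\<psi> s))\<^sup>2" by simp
            ultimately have "0 \<le> ddlam (\<psi> s) * lamQ (\<psi> s)" by (simp only: mult.commute[of "ddlam (\<psi> s)"])
            then show "0 \<le> dlam (\<psi> s) * dlam (\<psi> s) + ddlam (\<psi> s) * lamQ (\<psi> s)"
              by (intro add_nonneg_nonneg) auto
          qed
          then show ?thesis using left_deriv by linarith
        qed
        have grow: "excess (\<psi> 0) + 2 * k * (lamQ (\<psi> t0))\<^sup>2 \<le> excess (\<psi> 0) + 2 * k * (lamQ (\<psi> t2))\<^sup>2"
        proof (rule deriv_nonneg_mono[OF t2(1)])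
          fix s assume s: "t0 \<le> s" "s \<le> t2"
          then have s1: "s \<le> t1" using t2 by simp
          show "((\<lambda>t. excess (\<psi> 0) + 2 * k * (lamQ (\<psi> t))\<^sup>2) has_real_derivative
            0 + 2 * k * (of_nat 2 * (dlam (\<psi> s) * lamQ (\<psi> s) ^ (2 - Suc 0)))) (at s)"
            using rg[OF s(1) s1] by (intro DERIV_add DERIV_const DERIV_cmult DERIV_power lam_deriv) auto
          have "0 \<le> (4 * k) * (lamQ (\<psi> s) * dlam (\<psi> s))" by (rule mult_nonneg_nonneg) (use g[OF s] k_pos in simp_all)
          then show "0 \<le> 0 + 2 * k * (of_nat 2 * (dlam (\<psi> s) * lamQ (\<psi> s) ^ (2 - Suc 0)))" by (simp add: mult_ac)
        qed
        have sq: "(D (\<psi> s))\<^sup>2 = excess (\<psi> 0) + 2 * k * (lamQ (\<psi> s))\<^sup>2" if "t0 \<le> s" "s \<le> t1" for s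
        proof -
          have "D (\<psi> s) \<le> \<delta>E" using dx[OF that] c by linarith
          then show ?thesis using D_sq(1)[of "\<psi> s"] rg[OF that] excess_const[of s] by simp
        qed
        have "(D (\<psi> t0))\<^sup>2 \<le> (D (\<psi> t2))\<^sup>2"
          using grow unfolding sq[OF t2] sq[OF order_refl t1(1)] .
        then have "r0\<^sup>2 \<le> (D (\<psi> t2))\<^sup>2" unfolding Dt0 .
        then have "r0 \<le> D (\<psi> t2)" by (rule power2_le_imp_le) (use rg[OF t2] D_nonneg in blast)
        then show ?thesis using g by blast
      qed
      \<comment> \<open>Bootstrap: at a first time with \<open>D = 2 * \<epsilon>\<close> the claim
        \<open>convex\<close> still applies and gives \<open>D \<ge> r0\<close>, which exceeds
        \<open>2 * \<epsilon>\<close>.\<close>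
      have ge2: "2 * \<epsilon> \<le> D (\<psi> t)" if t: "t0 \<le> t" "t \<le> t1" for t
      proof (rule ccontr)
        assume "\<not> 2 * \<epsilon> \<le> D (\<psi> t)"
        then have lt: "D (\<psi> t) \<le> 2 * \<epsilon>" by simp
        have "continuous_on {t0..t} (\<lambda>t. D (\<psi> t))"
          using t0p rg[OF t] by (intro continuous_on_comp continuous_on_D) auto
        then obtain t2 where t2: "t0 < t2" "t2 \<le> t" "D (\<psi> t2) = 2 * \<epsilon>" "\<And>s. t0 \<le> s \<Longrightarrow> s \<le> t2 \<Longrightarrow> 2 * \<epsilon> \<le> D (\<psi> s)"
          by (rule first_hit[OF t(1)]) (use lt Dt0 eps in auto)
        have "r0 \<le> D (\<psi> t2)" using convex[of t2] t2 t by auto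
        then show False using t2(3) eps by linarith
      qed
      have ger: "r0 \<le> D (\<psi> t)" and dl: "0 \<le> lamQ (\<psi> t) * dlam (\<psi> t)" if t: "t0 \<le> t" "t \<le> t1" for t
        using convex[OF t] ge2 t by auto
      note facts = ej[OF _ dx _ eps(1) eX ge2]
      have cl: "cl * D (\<psi> t) \<le> \<bar>lamQ (\<psi> t)\<bar>" if t: "t0 \<le> t" "t \<le> t1" for t
        using facts[of t] t rg[OF t] by auto
      \<comment> \<open>\<open>\<lambda>\<^sub>1\<close> cannot pass through 0, since its size is at
        least \<open>cl * r0\<close>.\<close>
      have neg: "lamQ (\<psi> t) < 0" if t: "t0 \<le> t" "t \<le> t1" for t
      proof (rule ccontr)
        assume n: "\<not> lamQ (\<psi> t) < 0"
        have "continuous_on {t0..t} (\<lambda>t. lamQ (\<psi> t))"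
          using t0p rg[OF t] by (intro continuous_on_comp continuous_on_lamQ) auto
        then obtain s where s: "t0 \<le> s" "s \<le> t" "lamQ (\<psi> s) = 0"
          using IVT'[of "\<lambda>t. lamQ (\<psi> t)" t0 0 t] n lam0 t by auto
        have st: "s \<le> t1" using s t by simp
        have "0 < cl * D (\<psi> s)" using ger[OF s(1) st] c r0X by simp
        then show False using cl[OF s(1) st] s(3) by simp
      qed
      have dneg: "dlam (\<psi> t) \<le> 0" if t: "t0 \<le> t" "t \<le> t1" for t
        using dl[OF t] neg[OF t] by (simp add: zero_le_mult_iff)
      have ddneg: "ddlam (\<psi> t) \<le> k\<^sup>2 / 2 * lamQ (\<psi> t)" if t: "t0 \<le> t" "t \<le> t1" for t
      proof -
        have "k\<^sup>2 / 2 * (lamQ (\<psi> t))\<^sup>2 \<le> lamQ (\<psi> t) * ddlam (\<psi> t)" using facts[of t] t rg[OF t] by auto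
        then have "lamQ (\<psi> t) * (k\<^sup>2 / 2 * lamQ (\<psi> t)) \<le> lamQ (\<psi> t) * ddlam (\<psi> t)"
          by (simp add: power2_eq_square mult_ac)
        then show ?thesis using neg[OF t] by (simp only: mult_le_cancel_left_neg)
      qed
      have lmono: "lamQ (\<psi> t) \<le> l0" if t: "t0 \<le> t" "t \<le> t1" for t
      proof -
        have "- lamQ (\<psi> t0) \<le> - lamQ (\<psi> t)"
        proof (rule deriv_nonneg_mono[OF t(1)])
          fix s assume s: "t0 \<le> s" "s \<le> t"
          then have s1: "s \<le> t1" using t by simp
          show "((\<lambda>t. - lamQ (\<psi> t)) has_real_derivative - dlam (\<psi> s)) (at s)"
            using rg[OF s(1) s1] by (intro DERIV_minus lam_deriv) auto
          show "0 \<le> - dlam (\<psi> s)" using dneg[OF s(1) s1] by simp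
        qed
        then show ?thesis by (simp add: l0_def)
      qed
      have dgrow: "dlam (\<psi> t) \<le> k\<^sup>2 / 2 * l0 * (t - t0)" if t: "t0 \<le> t" "t \<le> t1" for t
      proof -
        have "k\<^sup>2 / 2 * l0 * (t0 - t0) - dlam (\<psi> t0) \<le> k\<^sup>2 / 2 * l0 * (t - t0) - dlam (\<psi> t)"
        proof (rule deriv_nonneg_mono[OF t(1)])
          fix s assume s: "t0 \<le> s" "s \<le> t"
          then have s1: "s \<le> t1" using t by simp
          show "((\<lambda>t. k\<^sup>2 / 2 * l0 * (t - t0) - dlam (\<psi> t)) has_real_derivative k\<^sup>2 / 2 * l0 * (1 - 0) - ddlam (\<psi> s)) (at s)"
            using rg[OF s(1) s1] by (intro DERIV_diff DERIV_cmult DERIV_ident DERIV_const dlam_deriv) auto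
          have "k\<^sup>2 / 2 * lamQ (\<psi> s) \<le> k\<^sup>2 / 2 * l0" using lmono[OF s(1) s1] by (intro mult_left_mono) auto
          then show "0 \<le> k\<^sup>2 / 2 * l0 * (1 - 0) - ddlam (\<psi> s)" using ddneg[OF s(1) s1] by simp
        qed
        then show ?thesis using dneg[of t0] t1 by simp
      qed
      have lgrow: "lamQ (\<psi> t) \<le> l0 + k\<^sup>2 / 4 * l0 * (t - t0)\<^sup>2" if t: "t0 \<le> t" "t \<le> t1" for t
      proof -
        have "k\<^sup>2 / 4 * l0 * (t0 - t0)\<^sup>2 - lamQ (\<psi> t0) \<le> k\<^sup>2 / 4 * l0 * (t - t0)\<^sup>2 - lamQ (\<psi> t)"
        proof (rule deriv_nonneg_mono[OF t(1)])
          fix s assume s: "t0 \<le> s" "s \<le> t"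
          then have s1: "s \<le> t1" using t by simp
          show "((\<lambda>t. k\<^sup>2 / 4 * l0 * (t - t0)\<^sup>2 - lamQ (\<psi> t)) has_real_derivative
            k\<^sup>2 / 4 * l0 * (of_nat 2 * ((1 - 0) * (s - t0) ^ (2 - Suc 0))) - dlam (\<psi> s)) (at s)"
            using rg[OF s(1) s1] by (intro DERIV_diff DERIV_cmult DERIV_power DERIV_ident DERIV_const lam_deriv) auto
          show "0 \<le> k\<^sup>2 / 4 * l0 * (of_nat 2 * ((1 - 0) * (s - t0) ^ (2 - Suc 0))) - dlam (\<psi> s)"
            using dgrow[OF s(1) s1] by (simp add: algebra_simps)
        qed
        then show ?thesis by (simp add: l0_def)
      qed
      \<comment> \<open>Compares the quadratic growth of \<open>\<lambda>\<^sub>1\<close> with the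
        upper bound \<open>Cd * D\<close> on its size.\<close>
      have late: "M * \<epsilon> \<le> D (\<psi> t)" if t: "t0 + K \<le> t" "t \<le> t1" for t
      proof -
        have t': "t0 \<le> t" using t K by simp
        have "0 < cl * r0" using c r0X by simp
        have l0: "l0 \<le> - (cl * r0)" using cl[of t0] neg[of t0] t1 Dt0 by (simp add: l0_def)
        have tK: "K \<le> t - t0" "1 \<le> t - t0" "0 \<le> t - t0" using t K by linarith+
        have "K * 1 \<le> (t - t0) * (t - t0)" by (rule mult_mono[OF tK]) simp
        then have Kt: "K \<le> (t - t0)\<^sup>2" by (simp add: power2_eq_square)
        have "cl * (2 * \<epsilon>) \<le> - l0" using l0 eps c mult_left_mono[of "2 * \<epsilon>" r0 cl] by linarith
        then have A: "k\<^sup>2 / 4 * (cl * (2 * \<epsilon>)) \<le> k\<^sup>2 / 4 * (- l0)" by (rule mult_left_mono) simp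
        have "0 \<le> cl * (2 * \<epsilon>)" using c eps by simp
        then have A0: "0 \<le> k\<^sup>2 / 4 * (cl * (2 * \<epsilon>))" by (rule mult_nonneg_nonneg[rotated]) simp
        then have "0 \<le> k\<^sup>2 / 4 * (- l0)" using A by (rule order_trans)
        then have "k\<^sup>2 / 4 * (cl * (2 * \<epsilon>)) * K \<le> k\<^sup>2 / 4 * (- l0) * (t - t0)\<^sup>2"
          using K by (intro mult_mono[OF A Kt]) simp_all
        also have "\<dots> \<le> - lamQ (\<psi> t)" using lgrow[OF t' t(2)] l0 \<open>0 < cl * r0\<close> by linarith
        also have "\<dots> \<le> Cd * D (\<psi> t)" using loc[of "\<psi> t"] rg[OF t' t(2)] dx[OF t' t(2)] by (auto simp: abs_le_iff)
        finally have 1: "k\<^sup>2 / 4 * (cl * (2 * \<epsilon>)) * K \<le> Cd * D (\<psi> t)" .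
        have "k\<^sup>2 / 4 * (cl * (2 * \<epsilon>)) * K = Cd * (M * \<epsilon>) + k\<^sup>2 / 4 * (cl * (2 * \<epsilon>))"
          unfolding K_def using c k2 by (simp add: field_simps)
        then have "Cd * (M * \<epsilon>) \<le> Cd * D (\<psi> t)" using 1 A0 by linarith
        then show ?thesis using c by simp
      qed
      \<comment> \<open>The comparison function that transfers the negative sign of
        \<open>\<lambda>\<^sub>1\<close> to \<open>radial\<close>.\<close>
      define H where "H = (\<lambda>t. radial (\<psi> t) - c3 * lamQ (\<psi> t))"
      have Hd: "(H has_real_derivative virial (\<psi> t) - c3 * dlam (\<psi> t)) (at t)" if t: "t0 \<le> t" "t \<le> t1" for t
        unfolding H_def using rg[OF t] by (intro DERIV_diff DERIV_cmult radial_deriv lam_deriv) auto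
      have c3d: "- (c3 * dlam (\<psi> t)) \<le> c1 * D (\<psi> t)" if t: "t0 \<le> t" "t \<le> t1" for t
      proof -
        have "- dlam (\<psi> t) \<le> Cd * D (\<psi> t)" using loc[of "\<psi> t"] rg[OF t] dx[OF t] by (auto simp: abs_le_iff)
        then have "c3 * (- dlam (\<psi> t)) \<le> c3 * (Cd * D (\<psi> t))" using pos by (intro mult_left_mono) auto
        also have "\<dots> = c1 * D (\<psi> t)" using c by (simp add: c3_def)
        finally show ?thesis by simp
      qed
      have Hlate: "virial (\<psi> t) - c3 * dlam (\<psi> t) \<le> 0" if t: "t0 \<le> t" "t \<le> t1" and l: "M * \<epsilon> \<le> D (\<psi> t)" for t
      proof -
        have "virial (\<psi> t) \<le> - (c1 * D (\<psi> t))" using facts[of t] t rg[OF t] neg[OF t] l by auto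
        then show ?thesis using c3d[OF t] by linarith
      qed
      have Hall: "virial (\<psi> t) - c3 * dlam (\<psi> t) \<le> C5 * \<epsilon>" if t: "t0 \<le> t" "t \<le> t1" for t
      proof (cases "M * \<epsilon> \<le> D (\<psi> t)")
        case True
        have "0 \<le> C5 * \<epsilon>" using pos eps by simp
        then show ?thesis using Hlate[OF t True] by linarith
      next
        case False
        then have "virial (\<psi> t) \<le> C2 * \<epsilon>" using facts[of t] t rg[OF t] by auto
        moreover have "c1 * D (\<psi> t) \<le> c1 * (M * \<epsilon>)" using False c by (intro mult_left_mono) auto
        ultimately show ?thesis using c3d[OF t] by (simp add: C5_def algebra_simps)
      qed
      \<comment> \<open>Up to \<open>t0 + K\<close> the function \<open>H\<close> rises by at most
        \<open>C5 * \<epsilon> * K\<close>; afterwards it does not rise. The minimum covers the case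
        that the interval ends earlier.\<close>
      define t3 where "t3 = min t1 (t0 + K)"
      have t3: "t0 \<le> t3" "t3 \<le> t1" "t3 - t0 \<le> K" using t1 K by (auto simp: t3_def)
      have H3: "H t3 \<le> H t0 + C5 * \<epsilon> * K"
      proof -
        have "C5 * \<epsilon> * t0 - H t0 \<le> C5 * \<epsilon> * t3 - H t3"
        proof (rule deriv_nonneg_mono[OF t3(1)])
          fix s assume s: "t0 \<le> s" "s \<le> t3"
          then have s1: "s \<le> t1" using t3 by simp
          show "((\<lambda>t. C5 * \<epsilon> * t - H t) has_real_derivative C5 * \<epsilon> * 1 - (virial (\<psi> s) - c3 * dlam (\<psi> s))) (at s)"
            by (intro DERIV_diff DERIV_cmult DERIV_ident Hd s(1) s1)
          show "0 \<le> C5 * \<epsilon> * 1 - (virial (\<psi> s) - c3 * dlam (\<psi> s))" using Hall[OF s(1) s1] by simp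
        qed
        moreover have "C5 * \<epsilon> * (t3 - t0) \<le> C5 * \<epsilon> * K" using t3 pos eps by (intro mult_left_mono) auto
        ultimately show ?thesis by (simp add: right_diff_distrib)
      qed
      have H1: "H t1 \<le> H t3"
      proof (cases "t3 = t1")
        case False
        then have "t3 = t0 + K" by (auto simp: t3_def)
        have "- H t3 \<le> - H t1"
        proof (rule deriv_nonneg_mono[OF t3(2)])
          fix s assume s: "t3 \<le> s" "s \<le> t1"
          then have s0: "t0 \<le> s" using t3 by simp
          show "((\<lambda>t. - H t) has_real_derivative - (virial (\<psi> s) - c3 * dlam (\<psi> s))) (at s)"
            by (intro DERIV_minus Hd s0 s(2))
          show "0 \<le> - (virial (\<psi> s) - c3 * dlam (\<psi> s))"
            using Hlate[OF s0 s(2) late] s \<open>t3 = t0 + K\<close> by simp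
        qed
        then show ?thesis by simp
      qed simp
      have "radial (\<psi> t1) \<le> C6 * r0 - c4 * D (\<psi> t1)"
      proof -
        have p0: "\<psi> t0 \<in> phase_space" using rg[of t0] t1 by auto
        have "radial (\<psi> t0) \<le> Cd * r0" "\<bar>lamQ (\<psi> t0)\<bar> \<le> Cd * r0"
          using loc[OF p0] Dt0 r0X by (auto simp: abs_le_iff)
        then have "c3 * (- lamQ (\<psi> t0)) \<le> c3 * (Cd * r0)" using pos by (intro mult_left_mono) auto
        also have "\<dots> = c1 * r0" using c by (simp add: c3_def)
        finally have h0: "H t0 \<le> Cd * r0 + c1 * r0" using \<open>radial (\<psi> t0) \<le> Cd * r0\<close> by (simp add: H_def)
        have "C5 * \<epsilon> * K \<le> C5 * r0 * K" using eps pos K by (intro mult_right_mono mult_left_mono) auto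
        then have "H t1 \<le> C6 * r0" using H1 H3 h0 unfolding C6_def by (simp add: algebra_simps)
        moreover have "c3 * (cl * D (\<psi> t1)) \<le> c3 * (- lamQ (\<psi> t1))"
          using cl[of t1] neg[of t1] t1 pos by (intro mult_left_mono) auto
        ultimately show ?thesis by (simp add: H_def c4_def)
      qed
      then show ?thesis using ger neg lgrow[of t1] t1 by auto
    qed
    \<comment> \<open>If \<open>D\<close> stayed below \<open>dX\<close>, the solution would remain
      in a compact set and be global, and the growth of \<open>\<lambda>\<^sub>1\<close> would break
      the bound \<open>Cd * dX\<close>.\<close>
    have exit: "\<exists>t\<ge>t0. ereal t < T \<and> dX \<le> D (\<psi> t)"
    proof (rule ccontr)
      assume "\<not> ?thesis"
      then have small: "D (\<psi> t) \<le> dX" if "t0 \<le> t" "ereal t < T" for t using that by (meson le_cases not_le)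
      have "T = \<infinity>"
      proof (rule maximal_bounded_global[OF max _ t0])
        show "norm (\<psi> t) \<le> norm (ground \<alpha>) + 1 \<and> cw \<le> wsq (\<psi> t)" if "t0 \<le> t" "ereal t < T" for t
          using loc[of "\<psi> t"] small[OF that] in_phase_space[of t] that t0p by auto
      qed (use t0p c in auto)
      define b where "b = k\<^sup>2 / 4 * (- l0)"
      \<comment> \<open>A time span after which \<open>b * X\<^sup>2\<close> exceeds
        \<open>Cd * dX\<close>.\<close>
      define X where "X = 1 + Cd * dX / b"
      have l0: "0 < - l0" using lam0 by (simp add: l0_def)
      have b: "0 < b" unfolding b_def by (rule mult_pos_pos) (use k2 l0 in simp_all)
      have X: "1 \<le> X" using c b by (simp add: X_def)
      have t1: "t0 \<le> t0 + X" "ereal (t0 + X) < T" using X \<open>T = \<infinity>\<close> by auto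
      have p1: "\<psi> (t0 + X) \<in> phase_space" using in_phase_space[of "t0 + X"] t1 t0p X by auto
      have "lamQ (\<psi> (t0 + X)) \<le> l0 + k\<^sup>2 / 4 * l0 * (t0 + X - t0)\<^sup>2"
        using seg[OF t1] small \<open>T = \<infinity>\<close> by auto
      then have "b * X\<^sup>2 + (- l0) \<le> - lamQ (\<psi> (t0 + X))" unfolding b_def by simp
      moreover have "- lamQ (\<psi> (t0 + X)) \<le> Cd * D (\<psi> (t0 + X))"
        using loc[OF p1] small[OF t1] by (auto simp: abs_le_iff)
      moreover have "Cd * D (\<psi> (t0 + X)) \<le> Cd * dX" using small[OF t1] c by (intro mult_left_mono) auto
      moreover have "b * X \<le> b * X\<^sup>2"
      proof (rule mult_left_mono)
        show "X \<le> X\<^sup>2" using mult_right_mono[of 1 X X] X by (simp add: power2_eq_square)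
      qed (use b in simp)
      moreover have "b * X = b + Cd * dX" using b by (simp add: X_def distrib_left)
      ultimately show False using l0 b by linarith
    qed
    then obtain te where te: "t0 \<le> te" "ereal te < T" "dX \<le> D (\<psi> te)" by blast
    have cD: "continuous_on {t0..te} (\<lambda>t. - D (\<psi> t))"
      using t0p te by (intro continuous_intros continuous_on_comp continuous_on_D) auto
    have hits: "- dX < - D (\<psi> t0)" "- D (\<psi> te) \<le> - dX" using te Dt0 r0X by simp_all
    obtain S where S: "t0 < S" "S \<le> te" "- D (\<psi> S) = - dX" "\<And>s. t0 \<le> s \<Longrightarrow> s \<le> S \<Longrightarrow> - dX \<le> - D (\<psi> s)"
      using first_hit[OF te(1) cD hits] by blast
    have ST: "t0 \<le> S" using S by simp
    have ST2: "ereal S < T" by (rule le_less_trans[of _ "ereal te"]) (use S te in simp_all)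
    have dxS: "D (\<psi> t) \<le> dX" if "t0 \<le> t" "t \<le> S" for t using S(4)[OF that] by simp
    have sg: "(\<forall>t. t0 \<le> t \<and> t \<le> S \<longrightarrow> r0 \<le> D (\<psi> t) \<and> lamQ (\<psi> t) < 0)
        \<and> lamQ (\<psi> S) \<le> l0 + k\<^sup>2 / 4 * l0 * (S - t0)\<^sup>2 \<and> radial (\<psi> S) \<le> C6 * r0 - c4 * D (\<psi> S)"
      by (rule seg[OF ST ST2]) (rule dxS)
    have DS: "D (\<psi> S) = dX" using S(3) by simp
    have "radial (\<psi> S) \<le> - (c4 * dX / 2)"
    proof -
      have "C6 * r0 \<le> C6 * (c4 * dX / (2 * C6))" using r0 r1 C6 by (intro mult_left_mono) auto
      also have "\<dots> = c4 * dX / 2" using C6 by simp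
      finally show ?thesis using conjunct2[OF conjunct2[OF sg]] unfolding DS by linarith
    qed
    moreover have "0 < gap (\<psi> S)"
    proof -
      have "\<epsilon> \<le> dX / M" using eps r0 r1 by linarith
      then have "M * \<epsilon> \<le> dX" using c by (simp add: field_simps)
      moreover have "lamQ (\<psi> S) < 0" using sg ST by blast
      moreover have "2 * \<epsilon> \<le> D (\<psi> S)" "D (\<psi> S) \<le> dX" "M * \<epsilon> \<le> D (\<psi> S)" using \<open>M * \<epsilon> \<le> dX\<close> DS eps r0X by linarith+
      ultimately show ?thesis using ej[of "\<psi> S" \<epsilon>] rng[OF ST order_refl ST2] eps(1) eX by blast
    qed
    ultimately show "\<exists>S\<ge>t0. ereal S < T \<and> D (\<psi> S) = dX \<and> 0 < gap (\<psi> S) \<and> radial (\<psi> S) \<le> - (c4 * dX / 2) \<and>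
        (\<forall>t. t0 \<le> t \<and> t \<le> S \<longrightarrow> r0 \<le> D (\<psi> t) \<and> D (\<psi> t) \<le> dX \<and> lamQ (\<psi> t) < 0)"
      using ST ST2 DS sg dxS by blast
  qed
qed

end

section \<open>Inward motion and collision\<close>

context hill_distance
begin

text \<open>In the disc and away from the origin the potential is bounded, so the energy bounds the
  velocity. Momentum is recovered from
  \<open>(norm \<phi>)\<^sup>2 \<le> 3 * wsq \<phi> + 2 * vsq \<phi>\<close>.\<close>

lemma inside_norm_bound:
  assumes ps: "\<phi> \<in> phase_space" and g: "0 \<le> gap \<phi>" and w: "0 < w" "w \<le> wsq \<phi>" and e: "excess \<phi> \<le> E"
  shows "norm \<phi> \<le> sqrt (3 * q\<^sup>2 + 2 * (2 * E + m * q\<^sup>2 + 2 * m * (q\<^sup>2 / \<alpha> * (w / q\<^sup>2) powr (- (\<alpha> / 2)))))"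
proof (rule real_le_rsqrt)
  have q2: "0 < q\<^sup>2" using q_pos by simp
  have wq: "wsq \<phi> \<le> q\<^sup>2" using g q2 wsq_gap[of \<phi>] mult_left_mono[of "1 - gap \<phi>" 1 "q\<^sup>2"] by simp
  have "w / q\<^sup>2 \<le> 1 - gap \<phi>" using w q2 by (simp add: gap_def divide_right_mono)
  then have "Zed \<phi> \<le> (w / q\<^sup>2) powr (- (\<alpha> / 2))"
    unfolding Zed_def using w q2 alpha by (intro powr_mono2') auto
  then have Z: "2 * m * (q\<^sup>2 / \<alpha> * Zed \<phi>) \<le> 2 * m * (q\<^sup>2 / \<alpha> * (w / q\<^sup>2) powr (- (\<alpha> / 2)))"
    using alpha by (intro mult_left_mono) auto
  have x2: "m * (\<phi> $ 1)\<^sup>2 \<le> m * q\<^sup>2"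
    using wq zero_le_power2[of "\<phi> $ 2"] alpha unfolding wsq_def by (intro mult_left_mono) linarith+
  have "0 \<le> m * q\<^sup>2" "0 \<le> 2 * m * (q\<^sup>2 / \<alpha>)" using alpha by auto
  then have v: "vsq \<phi> \<le> 2 * E + m * q\<^sup>2 + 2 * m * (q\<^sup>2 / \<alpha> * (w / q\<^sup>2) powr (- (\<alpha> / 2)))"
    unfolding vsq_eq[OF ps] using Z x2 e by linarith
  have "(norm \<phi>)\<^sup>2 \<le> 3 * wsq \<phi> + 2 * vsq \<phi>"
  proof -
    have "3 * wsq \<phi> + 2 * vsq \<phi> - (norm \<phi>)\<^sup>2 = (\<phi> $ 3 + 2 * \<phi> $ 2)\<^sup>2 + (\<phi> $ 4 - 2 * \<phi> $ 1)\<^sup>2"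
      unfolding norm_sq_4 wsq_def vsq_def by algebra
    then show ?thesis using zero_le_power2[of "\<phi> $ 3 + 2 * \<phi> $ 2"] zero_le_power2[of "\<phi> $ 4 - 2 * \<phi> $ 1"] by linarith
  qed
  then show "(norm \<phi>)\<^sup>2 \<le> 3 * q\<^sup>2 + 2 * (2 * E + m * q\<^sup>2 + 2 * m * (q\<^sup>2 / \<alpha> * (w / q\<^sup>2) powr (- (\<alpha> / 2))))"
    by (rule order_trans) (intro add_mono mult_left_mono wq v; simp)
qed

lemma continuous_on_gap: "continuous_on S gap"
  unfolding gap_def wsq_def by (intro continuous_intros) (use q_pos in auto)

text \<open>Staying at distance at least \<delta> inside the disc is self-sustaining. While it
  lasts, \<open>vir\<close> keeps \<open>radial \<le> - \<kappa>\<close>. It cannot end on the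
  circle, because \<open>vir\<close> improves \<open>0 \<le> gap\<close> to a strict inequality, nor
  at distance \<delta>, because there \<open>rad\<close> contradicts
  \<open>radial \<le> - \<kappa>\<close>.\<close>

lemma inward_collision:
  assumes max: "is_maximal_solution \<alpha> \<psi> T" and S: "0 < S" "ereal S < T"
    and rad: "\<And>\<phi>. \<phi> \<in> phase_space \<Longrightarrow> dQ \<phi> \<le> \<delta> \<Longrightarrow> - \<kappa> < radial \<phi>" and \<kappa>: "0 < \<kappa>"
    and vir: "\<And>\<phi>. \<phi> \<in> phase_space \<Longrightarrow> \<delta> \<le> dQ \<phi> \<Longrightarrow> 0 \<le> gap \<phi> \<Longrightarrow> excess \<phi> \<le> E \<Longrightarrow> 0 < gap \<phi> \<and> virial \<phi> \<le> 0"
    and init: "excess (\<psi> 0) \<le> E" "\<delta> < dQ (\<psi> S)" "0 < gap (\<psi> S)" "radial (\<psi> S) \<le> - \<kappa>"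
  shows "\<And>t. S \<le> t \<Longrightarrow> ereal t < T \<Longrightarrow> \<delta> \<le> dQ (\<psi> t) \<and> 0 < gap (\<psi> t)" "T < \<infinity>"
    "((\<lambda>t. (\<psi> t $ 1, \<psi> t $ 2)) \<longlongrightarrow> (0, 0)) (at_left (real_of_ereal T))"
proof -
  interpret hill_solution \<alpha> F chi \<delta>E \<psi> T
    by unfold_locales (use max in \<open>simp add: is_maximal_solution_def\<close>)
  have rng: "0 < t \<and> ereal t < T \<and> \<psi> t \<in> phase_space \<and> excess (\<psi> t) \<le> E"
    if "S \<le> t" "t \<le> t1" "ereal t1 < T" for t t1
  proof -
    have "0 < t" using that S by simp
    moreover have "ereal t < T" by (rule le_less_trans[of _ "ereal t1"]) (use that in simp_all)
    ultimately show ?thesis using in_phase_space[of t] excess_const[of t] init(1) by simp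
  qed
  have rmono: "radial (\<psi> t1) \<le> - \<kappa>"
    if t1: "S \<le> t1" "ereal t1 < T" and good: "\<And>t. S \<le> t \<Longrightarrow> t \<le> t1 \<Longrightarrow> \<delta> \<le> dQ (\<psi> t) \<and> 0 \<le> gap (\<psi> t)" for t1
  proof -
    have "- radial (\<psi> S) \<le> - radial (\<psi> t1)"
    proof (rule deriv_nonneg_mono[OF t1(1)])
      fix s assume s: "S \<le> s" "s \<le> t1"
      note r = rng[OF s t1(2)]
      show "((\<lambda>t. - radial (\<psi> t)) has_real_derivative - virial (\<psi> s)) (at s)"
        using r by (intro DERIV_minus radial_deriv) auto
      show "0 \<le> - virial (\<psi> s)" using vir[of "\<psi> s"] r good[OF s] by simp
    qed
    then show ?thesis using init(4) by linarith
  qed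
  have good: "\<delta> < dQ (\<psi> t1) \<and> 0 < gap (\<psi> t1)" if t1: "S \<le> t1" "ereal t1 < T" for t1
  proof (rule ccontr)
    assume n: "\<not> ?thesis"
    \<comment> \<open>One function whose first zero marks the failure of either condition.\<close>
    define f where "f = (\<lambda>t. min (dQ (\<psi> t) - \<delta>) (gap (\<psi> t)))"
    have cf: "continuous_on {S..t1} f" unfolding f_def
      using S t1 by (intro continuous_intros continuous_on_comp continuous_on_dQ continuous_on_gap) auto
    have f0: "0 < f S" "f t1 \<le> 0" using n init by (auto simp: f_def)
    obtain t2 where t2: "S < t2" "t2 \<le> t1" "f t2 = 0" "\<And>s. S \<le> s \<Longrightarrow> s \<le> t2 \<Longrightarrow> 0 \<le> f s"
      using first_hit[OF t1(1) cf f0] by blast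
    have g: "\<delta> \<le> dQ (\<psi> t) \<and> 0 \<le> gap (\<psi> t)" if "S \<le> t" "t \<le> t2" for t
      using t2(4)[OF that] by (simp add: f_def)
    have t2T: "S \<le> t2" "ereal t2 < T" using rng[OF _ t2(2) t1(2)] t2(1) by auto
    have r: "radial (\<psi> t2) \<le> - \<kappa>" by (rule rmono[OF t2T g])
    note rg = rng[OF t2T(1) order_refl t2T(2)]
    have "0 < gap (\<psi> t2)" using vir[of "\<psi> t2"] g[OF t2T(1) order_refl] rg by blast
    then have "dQ (\<psi> t2) \<le> \<delta>" using t2(3) unfolding f_def min_def by (auto split: if_splits)
    then show False using rad[of "\<psi> t2"] rg r by simp
  qed
  then show "\<And>t. S \<le> t \<Longrightarrow> ereal t < T \<Longrightarrow> \<delta> \<le> dQ (\<psi> t) \<and> 0 < gap (\<psi> t)" by (simp add: less_imp_le)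
  have rneg: "radial (\<psi> t) \<le> - \<kappa>" if t: "S \<le> t" "ereal t < T" for t
  proof (rule rmono[OF t])
    fix s assume "S \<le> s" "s \<le> t"
    then show "\<delta> \<le> dQ (\<psi> s) \<and> 0 \<le> gap (\<psi> s)" using good[of s] rng[OF _ _ t(2)] by (simp add: less_imp_le)
  qed
  \<comment> \<open>The squared radius has derivative \<open>2 * radial\<close>, so it falls at
    least at the rate \<open>2 * \<kappa>\<close>. This gives the finite lifetime, and its
    monotonicity turns arbitrarily small values into a limit.\<close>
  have wdec: "wsq (\<psi> t2) \<le> wsq (\<psi> t1) - 2 * \<kappa> * (t2 - t1)" if t: "S \<le> t1" "t1 \<le> t2" "ereal t2 < T" for t1 t2
  proof -
    have "- (2 * \<kappa>) * t1 - wsq (\<psi> t1) \<le> - (2 * \<kappa>) * t2 - wsq (\<psi> t2)"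
    proof (rule deriv_nonneg_mono[OF t(2)])
      fix s assume s: "t1 \<le> s" "s \<le> t2"
      then have r: "S \<le> s" "0 < s \<and> ereal s < T" using t rng[of s t2] by auto
      show "((\<lambda>t. - (2 * \<kappa>) * t - wsq (\<psi> t)) has_real_derivative - (2 * \<kappa>) * 1 - 2 * radial (\<psi> s)) (at s)"
        using r by (intro DERIV_diff DERIV_cmult DERIV_ident wsq_deriv) auto
      show "0 \<le> - (2 * \<kappa>) * 1 - 2 * radial (\<psi> s)" using rneg[of s] r by simp
    qed
    then show ?thesis by (simp add: algebra_simps)
  qed
  show Tfin: "T < \<infinity>"
  proof (rule ccontr)
    assume "\<not> T < \<infinity>"
    then have T: "T = \<infinity>" by simp
    define t2 where "t2 = S + wsq (\<psi> S) / (2 * \<kappa>) + 1"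
    have "S \<le> t2" using \<kappa> wsq_nonneg[of "\<psi> S"] by (simp add: t2_def)
    then have "wsq (\<psi> t2) \<le> wsq (\<psi> S) - 2 * \<kappa> * (t2 - S)" using wdec[of S t2] T by simp
    also have "\<dots> = - (2 * \<kappa>)" using \<kappa> by (simp add: t2_def field_simps)
    finally show False using \<kappa> wsq_nonneg[of "\<psi> t2"] by linarith
  qed
  then obtain b where b: "T = ereal b" using S by (cases T) auto
  have Sb: "S < b" using S b by simp
  \<comment> \<open>A positive lower bound on the squared radius would, with
    \<open>inside_norm_bound\<close>, confine the solution to a compact set and make
    \<open>T\<close> infinite.\<close>
  have small: "\<exists>t1. S \<le> t1 \<and> t1 < b \<and> wsq (\<psi> t1) < w" if w: "0 < w" for w
  proof (rule ccontr)
    assume n: "\<not> ?thesis"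
    have "T = \<infinity>"
    proof (rule maximal_bounded_global[OF max _ S(2) w])
      fix t assume t: "S \<le> t" "ereal t < T"
      have "w \<le> wsq (\<psi> t)" using n t b by (auto simp: not_less)
      then show "norm (\<psi> t) \<le> sqrt (3 * q\<^sup>2 + 2 * (2 * E + m * q\<^sup>2 + 2 * m * (q\<^sup>2 / \<alpha> * (w / q\<^sup>2) powr (- (\<alpha> / 2)))))
        \<and> w \<le> wsq (\<psi> t)"
        using inside_norm_bound[OF _ _ w, of "\<psi> t" E] good[OF t] rng[OF t(1) order_refl t(2)] by simp
    qed (use S in simp)
    then show False using b by simp
  qed
  have wlim: "((\<lambda>t. wsq (\<psi> t)) \<longlongrightarrow> 0) (at_left b)"
  proof (rule tendstoI)
    fix e :: real assume "0 < e"
    then obtain t1 where t1: "S \<le> t1" "t1 < b" "wsq (\<psi> t1) < e" using small by blast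
    have "eventually (\<lambda>t. t \<in> {t1<..<b}) (at_left b)" by (rule eventually_at_left_real[OF t1(2)])
    then show "eventually (\<lambda>t. dist (wsq (\<psi> t)) 0 < e) (at_left b)"
    proof eventually_elim
      case (elim t)
      have "wsq (\<psi> t) \<le> wsq (\<psi> t1) - 2 * \<kappa> * (t - t1)" using wdec[of t1 t] elim t1 b by simp
      moreover have "0 \<le> 2 * \<kappa> * (t - t1)" using \<kappa> elim by simp
      ultimately have "wsq (\<psi> t) < e" using t1(3) by linarith
      then show ?case using wsq_nonneg[of "\<psi> t"] by simp
    qed
  qed
  have slim: "((\<lambda>t. sqrt (wsq (\<psi> t))) \<longlongrightarrow> 0) (at_left b)"
    using tendsto_real_sqrt[OF wlim] by simp
  have "((\<lambda>t. \<psi> t $ 1) \<longlongrightarrow> 0) (at_left b)"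
    by (rule Lim_null_comparison[OF _ slim], rule always_eventually) (simp add: wsq_def real_le_rsqrt)
  moreover have "((\<lambda>t. \<psi> t $ 2) \<longlongrightarrow> 0) (at_left b)"
    by (rule Lim_null_comparison[OF _ slim], rule always_eventually) (simp add: wsq_def real_le_rsqrt)
  ultimately show "((\<lambda>t. (\<psi> t $ 1, \<psi> t $ 2)) \<longlongrightarrow> (0, 0)) (at_left (real_of_ereal T))"
    unfolding b real_of_ereal.simps by (rule tendsto_Pair)
qed

section \<open>The trapping time\<close>

lemma T_trap_inside:
  assumes t: "0 \<le> t" "ereal t < T_trap dQ R \<psi> T"
  shows "dQ (\<psi> t) < R + R\<^sup>2"
proof -
  obtain x where x: "x \<in> {ereal t' |t'. 0 \<le> t' \<and> ereal t' \<le> T \<and> (\<forall>t. 0 \<le> t \<and> t < t' \<longrightarrow> dQ (\<psi> t) < R + R\<^sup>2)}" "ereal t < x"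
    using t(2) unfolding T_trap_def less_Sup_iff by blast
  then show ?thesis using t(1) by auto
qed

text \<open>Below the level at the supremum, continuity would allow a longer interval; above it, an
  earlier time would already be at the level. The initial value lies below the level, so the time is
  positive.\<close>

lemma T_trap_exit:
  assumes sol: "is_solution \<alpha> \<psi> T" and tr: "T_trap dQ R \<psi> T < T" and init: "dQ (\<psi> 0) < R + R\<^sup>2"
  obtains t0 where "T_trap dQ R \<psi> T = ereal t0" "0 < t0" "dQ (\<psi> t0) = R + R\<^sup>2"
proof -
  interpret hill_solution \<alpha> F chi \<delta>E \<psi> T by unfold_locales (rule sol)
  define r where "r = R + R\<^sup>2"
  define A where "A = {ereal t' |t'. 0 \<le> t' \<and> ereal t' \<le> T \<and> (\<forall>t. 0 \<le> t \<and> t < t' \<longrightarrow> dQ (\<psi> t) < r)}"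
  have TA: "T_trap dQ R \<psi> T = Sup A" by (simp add: T_trap_def A_def r_def)
  have T0: "0 < T" using sol by (simp add: is_solution_def)
  have "ereal 0 \<in> A" unfolding A_def using T0 by (auto intro!: exI[of _ 0] simp: zero_ereal_def[symmetric] less_imp_le)
  then have "ereal 0 \<le> Sup A" by (rule Sup_upper)
  moreover have "Sup A < T" using tr TA by simp
  ultimately obtain t0 where t0: "Sup A = ereal t0" "0 \<le> t0" by (cases "Sup A") auto
  have t0T: "ereal t0 < T" using \<open>Sup A < T\<close> t0 by simp
  have before: "dQ (\<psi> t) < r" if "0 \<le> t" "t < t0" for t
    unfolding r_def by (rule T_trap_inside[where T = T, OF that(1)]) (use that TA t0 in simp)
  have ge: "r \<le> dQ (\<psi> t0)"
  proof (rule ccontr)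
    assume "\<not> r \<le> dQ (\<psi> t0)"
    then have lt: "dQ (\<psi> t0) < r" by simp
    obtain b where b: "ereal t0 < ereal b" "ereal b < T" using ereal_dense2[OF t0T] by blast
    have c: "continuous_on {t0..b} (\<lambda>t. dQ (\<psi> t))" using t0 b by (intro continuous_on_comp continuous_on_dQ)
    have "((\<lambda>t. dQ (\<psi> t)) \<longlongrightarrow> dQ (\<psi> t0)) (at t0 within {t0..b})"
      using c b unfolding continuous_on_def by simp
    then have "eventually (\<lambda>t. dQ (\<psi> t) < r) (at t0 within {t0..b})" using lt by (rule order_tendstoD)
    then obtain d where d: "d > 0" "\<And>t. t \<in> {t0..b} \<Longrightarrow> t \<noteq> t0 \<Longrightarrow> dist t t0 < d \<Longrightarrow> dQ (\<psi> t) < r"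
      unfolding eventually_at by blast
    define t' where "t' = min b (t0 + d)"
    have t': "t0 < t'" "t' \<le> b" using b d by (auto simp: t'_def)
    have "dQ (\<psi> t) < r" if "0 \<le> t" "t < t'" for t
    proof (cases t t0 rule: linorder_cases)
      case greater
      then show ?thesis using that d(2)[of t] by (auto simp: t'_def dist_real_def)
    qed (use before lt that in auto)
    moreover have "ereal t' \<le> T" using t' b by (meson ereal_less_eq(3) less_imp_le order_trans)
    ultimately have "ereal t' \<in> A" using t' t0(2) unfolding A_def by auto
    then have "ereal t' \<le> Sup A" by (rule Sup_upper)
    then show False using t0 t' by simp
  qed
  have i: "dQ (\<psi> 0) < r" using init by (simp add: r_def)
  have "dQ (\<psi> t0) = r"
  proof (rule ccontr)
    assume "dQ (\<psi> t0) \<noteq> r"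
    then have gt: "r < dQ (\<psi> t0)" using ge by simp
    have "continuous_on {0..t0} (\<lambda>t. dQ (\<psi> t))" using t0 t0T by (intro continuous_on_comp continuous_on_dQ) auto
    then obtain s where s: "0 \<le> s" "s \<le> t0" "dQ (\<psi> s) = r"
      using IVT'[of "\<lambda>t. dQ (\<psi> t)" 0 r t0] i gt t0 by auto
    then have "s < t0" using gt by (cases "s = t0") auto
    then show False using before[OF s(1)] s(3) by simp
  qed
  moreover have "t0 \<noteq> 0" using i ge by auto
  ultimately show thesis using that[of t0] t0 TA by (simp add: r_def)
qed

section \<open>Combination of trapping, ejection and collision\<close>

lemma signed_maximal:
  assumes "is_maximal_solution \<alpha> \<psi> T" "\<sigma> \<in> {1, -1}"
  shows "is_maximal_solution \<alpha> (\<lambda>t. \<sigma> *\<^sub>R \<psi> t) T"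
  using assms is_maximal_solution_minus[OF assms(1)] by auto

lemma signed_simps:
  assumes "\<sigma> \<in> {1, -1}"
  shows "dQ (\<sigma> *\<^sub>R \<phi>) = dQ \<phi>" "gap (\<sigma> *\<^sub>R \<phi>) = gap \<phi>" "radial (\<sigma> *\<^sub>R \<phi>) = radial \<phi>"
    "excess (\<sigma> *\<^sub>R \<phi>) = excess \<phi>" "wsq (\<sigma> *\<^sub>R \<phi>) = wsq \<phi>" "norm (\<sigma> *\<^sub>R \<phi>) = norm \<phi>"
    "\<sigma> *\<^sub>R \<phi> \<in> phase_space \<longleftrightarrow> \<phi> \<in> phase_space"
  using assms by (auto simp: dQ_minus gap_minus radial_minus excess_minus minus_phase_space wsq_def)

lemma trapping_or_collision:
  "\<exists>R0. 0 < R0 \<and> R0 < 1 \<and> (\<forall>\<psi> T \<epsilon> R.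
    is_maximal_solution \<alpha> \<psi> T \<and> 0 < \<epsilon> \<and> 2 * \<epsilon> < R \<and> R \<le> R0 \<and> energy \<alpha> (\<psi> 0) < E_star \<alpha> + \<epsilon>\<^sup>2 \<and> dQ (\<psi> 0) < R \<longrightarrow>
    (T_trap dQ R \<psi> T = T \<longrightarrow>
      (\<forall>t. 0 \<le> t \<and> ereal t < T \<longrightarrow> dQ (\<psi> t) < R + R\<^sup>2) \<and> T = \<infinity>) \<and>
    (T_trap dQ R \<psi> T < T \<and> sign_fun \<alpha> F chi \<delta>E (\<psi> (real_of_ereal (T_trap dQ R \<psi> T))) = -1 \<longrightarrow>
      (\<forall>t. real_of_ereal (T_trap dQ R \<psi> T) \<le> t \<and> ereal t < T \<longrightarrow>
        sign_fun \<alpha> F chi \<delta>E (\<psi> t) = -1 \<and> R + R\<^sup>2 \<le> dQ (\<psi> t)) \<and>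
      T < \<infinity> \<and> ((\<lambda>t. (\<psi> t $ 1, \<psi> t $ 2)) \<longlongrightarrow> (0, 0)) (at_left (real_of_ereal T))))"
proof -
  obtain dX \<kappa> r1 Cd cw where c: "0 < dX" "dX \<le> \<delta>E" "0 < \<kappa>" "0 < r1" "r1 < dX" "0 < Cd" "0 < cw"
    and loc: "\<And>\<phi>. \<phi> \<in> phase_space \<Longrightarrow> D \<phi> \<le> dX \<Longrightarrow> dX < D (- \<phi>) \<and> cw \<le> wsq \<phi> \<and> norm \<phi> \<le> norm (ground \<alpha>) + 1 \<and> \<bar>radial \<phi>\<bar> \<le> Cd * D \<phi>"
    and ej: "\<And>\<psi> T \<epsilon> r0 t0 a. is_maximal_solution \<alpha> \<psi> T \<Longrightarrow> 0 \<le> a \<Longrightarrow> a < t0 \<Longrightarrow> ereal t0 < T \<Longrightarrow> 0 < \<epsilon> \<Longrightarrow> 2 * \<epsilon> < r0 \<Longrightarrow> r0 \<le> r1 \<Longrightarrow>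
      excess (\<psi> 0) \<le> \<epsilon>\<^sup>2 \<Longrightarrow> D (\<psi> t0) = r0 \<Longrightarrow> lamQ (\<psi> t0) < 0 \<Longrightarrow> (\<And>t. a < t \<Longrightarrow> t < t0 \<Longrightarrow> D (\<psi> t) \<le> r0) \<Longrightarrow>
      \<exists>S\<ge>t0. ereal S < T \<and> D (\<psi> S) = dX \<and> 0 < gap (\<psi> S) \<and> radial (\<psi> S) \<le> - \<kappa> \<and>
        (\<forall>t. t0 \<le> t \<and> t \<le> S \<longrightarrow> r0 \<le> D (\<psi> t) \<and> D (\<psi> t) \<le> dX \<and> lamQ (\<psi> t) < 0)"
    by (rule ejection) blast
  have near: "\<exists>\<sigma>\<in>{1, -1}. dQ \<phi> = D (\<sigma> *\<^sub>R \<phi>)" for \<phi>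
    unfolding dQ_eq min_def by auto
  have loc': "cw \<le> wsq \<phi> \<and> norm \<phi> \<le> norm (ground \<alpha>) + 1 \<and> \<bar>radial \<phi>\<bar> \<le> Cd * dQ \<phi>"
    if ps: "\<phi> \<in> phase_space" and d: "dQ \<phi> \<le> dX" for \<phi>
  proof -
    obtain \<sigma> where \<sigma>: "\<sigma> \<in> {1, -1}" "dQ \<phi> = D (\<sigma> *\<^sub>R \<phi>)" using near by blast
    then show ?thesis using loc[of "\<sigma> *\<^sub>R \<phi>"] d ps by (simp only: signed_simps)
  qed
  \<comment> \<open>The return radius: within it \<open>radial\<close> is at most \<kappa> / 2 in
    absolute value, so no point with \<open>radial \<le> - \<kappa>\<close> lies there. Being below
    \<open>dX\<close>, it is exceeded at the end of the ejection.\<close>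
  define \<delta> where "\<delta> = min (dX / 2) (\<kappa> / (2 * Cd))"
  have \<delta>: "0 < \<delta>" "\<delta> < dX" "\<delta> \<le> \<kappa> / (2 * Cd)" using c by (auto simp: \<delta>_def min_less_iff_disj)
  obtain \<epsilon>2 where \<epsilon>2: "0 < \<epsilon>2" and ov: "\<And>\<phi> \<epsilon>. \<phi> \<in> phase_space \<Longrightarrow> \<delta> \<le> dQ \<phi> \<Longrightarrow> 0 \<le> gap \<phi> \<Longrightarrow> excess \<phi> \<le> \<epsilon>\<^sup>2 \<Longrightarrow> 0 \<le> \<epsilon> \<Longrightarrow> \<epsilon> \<le> \<epsilon>2
    \<Longrightarrow> 0 < gap \<phi> \<and> virial \<phi> \<le> 0" using outer_virial[OF \<delta>(1)] by blast
  obtain \<epsilon>3 where \<epsilon>3: "0 < \<epsilon>3" and os: "\<And>\<phi> \<epsilon>. \<phi> \<in> phase_space \<Longrightarrow> \<delta> \<le> dQ \<phi> \<Longrightarrow> 0 < gap \<phi> \<Longrightarrow> excess \<phi> \<le> \<epsilon>\<^sup>2 \<Longrightarrow> 0 < \<epsilon> \<Longrightarrow> \<epsilon> \<le> \<epsilon>3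
    \<Longrightarrow> sign_fun \<alpha> F chi \<delta>E \<phi> = -1" using outer_sign[OF \<delta>(1)] by blast
  \<comment> \<open>\<open>R + R\<^sup>2 \<le> 2 * R\<close> puts the exit level below
    \<open>r1\<close> and below \<delta>; since \<open>2 * \<epsilon> < R\<close>, the last two
    entries bound \<epsilon>.\<close>
  define R0 where "R0 = min (1/2) (min (r1 / 2) (min (\<delta> / 2) (min \<epsilon>2 \<epsilon>3)))"
  have R0: "0 < R0" "R0 \<le> 1/2" "R0 \<le> r1 / 2" "R0 \<le> \<delta> / 2" "R0 \<le> \<epsilon>2" "R0 \<le> \<epsilon>3"
    using c \<delta> \<epsilon>2 \<epsilon>3 by (simp_all add: R0_def min_le_iff_disj)
  show ?thesis
  proof (rule exI[of _ R0], intro conjI allI impI; (elim conjE)?)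
    show "0 < R0" "R0 < 1" using R0 by simp_all
  next
    fix \<psi> T \<epsilon> R t
    assume tr: "T_trap dQ R \<psi> T = T" and t: "0 \<le> t" "ereal t < T"
    show "dQ (\<psi> t) < R + R\<^sup>2" by (rule T_trap_inside[where T = T, OF t(1)]) (simp add: tr t)
  next
    fix \<psi> T \<epsilon> R
    assume max: "is_maximal_solution \<alpha> \<psi> T" and eR: "0 < \<epsilon>" "2 * \<epsilon> < R" "R \<le> R0" and tr: "T_trap dQ R \<psi> T = T"
    interpret hill_solution \<alpha> F chi \<delta>E \<psi> T
      by unfold_locales (use max in \<open>simp add: is_maximal_solution_def\<close>)
    have "R * R \<le> 1 * R" using eR R0 by (intro mult_right_mono) linarith+
    then have r: "R + R\<^sup>2 \<le> dX" unfolding power2_eq_square using eR R0 c by linarith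
    have T0: "ereal 0 < T" using sol by (simp add: is_solution_def zero_ereal_def[symmetric])
    show "T = \<infinity>"
    proof (rule maximal_bounded_global[OF max order_refl T0 c(7)])
      fix t :: real assume t: "0 \<le> t" "ereal t < T"
      have "dQ (\<psi> t) < R + R\<^sup>2" by (rule T_trap_inside[where T = T, OF t(1)]) (simp add: tr t)
      then have "dQ (\<psi> t) \<le> dX" using r by linarith
      then show "norm (\<psi> t) \<le> norm (ground \<alpha>) + 1 \<and> cw \<le> wsq (\<psi> t)"
        using loc'[OF in_phase_space[OF t]] by blast
    qed
  next
    fix \<psi> T \<epsilon> R
    assume max: "is_maximal_solution \<alpha> \<psi> T" and eR: "0 < \<epsilon>" "2 * \<epsilon> < R" "R \<le> R0"
      and en: "energy \<alpha> (\<psi> 0) < E_star \<alpha> + \<epsilon>\<^sup>2" and d0: "dQ (\<psi> 0) < R"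
      and tr: "T_trap dQ R \<psi> T < T"
      and sg: "sign_fun \<alpha> F chi \<delta>E (\<psi> (real_of_ereal (T_trap dQ R \<psi> T))) = -1"
    interpret hill_solution \<alpha> F chi \<delta>E \<psi> T
      by unfold_locales (use max in \<open>simp add: is_maximal_solution_def\<close>)
    define r where "r = R + R\<^sup>2"
    have "R * R \<le> 1 * R" using eR R0 by (intro mult_right_mono) linarith+
    moreover have "0 < R * R" using eR by simp
    ultimately have r: "R < r" "r \<le> r1" "r \<le> \<delta>" unfolding r_def power2_eq_square using eR R0 by linarith+
    have ex: "excess (\<psi> 0) \<le> \<epsilon>\<^sup>2" using en by (simp add: excess_def)
    have eps: "\<epsilon> \<le> \<epsilon>2" "\<epsilon> \<le> \<epsilon>3" "2 * \<epsilon> < r" using eR R0 r by linarith+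
    obtain t0 where t0: "T_trap dQ R \<psi> T = ereal t0" "0 < t0" "dQ (\<psi> t0) = r"
      using T_trap_exit[OF sol tr] d0 r unfolding r_def by (metis less_trans)
    have t0T: "ereal t0 < T" using tr t0 by simp
    have before: "dQ (\<psi> t) < r" if "0 \<le> t" "t < t0" for t
      unfolding r_def by (rule T_trap_inside[where T = T, OF that(1)]) (use that t0 in simp)
    have p0: "\<psi> t0 \<in> phase_space" using in_phase_space t0 t0T by simp
    have dE: "dQ (\<psi> t0) \<le> \<delta>E" using t0 r c by linarith
    obtain \<sigma> where \<sigma>: "\<sigma> \<in> {1, -1}" "dQ (\<psi> t0) = D (\<sigma> *\<^sub>R \<psi> t0)" "sign_fun \<alpha> F chi \<delta>E (\<psi> t0) = sign0 (lamQ (\<sigma> *\<^sub>R \<psi> t0))"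
      by (rule nearest_sign[OF p0 dE]) blast
    \<comment> \<open>The solution reflected so that the nearest ground state at the exit time is
      the one at which \<open>D\<close> is centred.\<close>
    define \<chi>' where "\<chi>' = (\<lambda>t. \<sigma> *\<^sub>R \<psi> t)"
    note ss = signed_simps[OF \<sigma>(1)]
    have max': "is_maximal_solution \<alpha> \<chi>' T" unfolding \<chi>'_def by (rule signed_maximal[OF max \<sigma>(1)])
    interpret chi: hill_solution \<alpha> F chi \<delta>E \<chi>' T
      by unfold_locales (use max' in \<open>simp add: is_maximal_solution_def\<close>)
    have l0: "lamQ (\<chi>' t0) < 0" using sg \<sigma>(3) t0(1) by (simp add: \<chi>'_def sign0_def split: if_splits)
    have D0: "D (\<chi>' t0) = r" using \<sigma>(2) t0(3) by (simp add: \<chi>'_def)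
    have dQchi: "dQ (\<psi> t) = D (\<chi>' t)" if "0 \<le> t" "ereal t < T" "D (\<chi>' t) \<le> dX" for t
    proof -
      have "dQ (\<chi>' t) = D (\<chi>' t)"
        using loc[OF chi.in_phase_space[OF that(1,2)] that(3)] that(3) unfolding dQ_eq min_def by simp
      then show ?thesis unfolding \<chi>'_def ss(1) .
    qed
    \<comment> \<open>Before \<open>t0\<close> only the minimum of the two distances is known to be
      below \<open>r\<close>. Continuity of \<open>D\<close> at \<open>t0\<close> shows that,
      shortly before, this minimum is attained at the same ground state.\<close>
    have "\<exists>a. 0 \<le> a \<and> a < t0 \<and> (\<forall>t. a < t \<and> t < t0 \<longrightarrow> D (\<chi>' t) \<le> r)"
    proof -
      have cD: "continuous_on {0..t0} (\<lambda>t. D (\<chi>' t))" using t0T by (intro chi.continuous_on_comp continuous_on_D) auto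
      have "((\<lambda>t. D (\<chi>' t)) \<longlongrightarrow> D (\<chi>' t0)) (at t0 within {0..t0})"
        using cD t0(2) unfolding continuous_on_def by simp
      moreover have "D (\<chi>' t0) < dX" using D0 r c by linarith
      ultimately have "eventually (\<lambda>t. D (\<chi>' t) < dX) (at t0 within {0..t0})" by (rule order_tendstoD)
      then obtain d where d: "d > 0" "\<And>t. t \<in> {0..t0} \<Longrightarrow> t \<noteq> t0 \<Longrightarrow> dist t t0 < d \<Longrightarrow> D (\<chi>' t) < dX"
        unfolding eventually_at by blast
      have "D (\<chi>' t) \<le> r" if t: "max 0 (t0 - d) < t" "t < t0" for t
      proof -
        have "D (\<chi>' t) < dX" using t by (intro d(2)) (auto simp: dist_real_def)
        moreover have "ereal t < T" by (rule less_trans[of _ "ereal t0"]) (use t t0T in simp_all)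
        ultimately have "dQ (\<psi> t) = D (\<chi>' t)" using t by (intro dQchi) auto
        then show ?thesis using before[of t] t by simp
      qed
      then show ?thesis using t0(2) d(1) by (intro exI[of _ "max 0 (t0 - d)"]) auto
    qed
    then obtain a where a: "0 \<le> a" "a < t0" "\<And>t. a < t \<Longrightarrow> t < t0 \<Longrightarrow> D (\<chi>' t) \<le> r" by blast
    have ex': "excess (\<chi>' 0) \<le> \<epsilon>\<^sup>2" using ex unfolding \<chi>'_def ss(4) .
    obtain S where S: "t0 \<le> S" "ereal S < T" "D (\<chi>' S) = dX" "0 < gap (\<chi>' S)" "radial (\<chi>' S) \<le> - \<kappa>"
      "\<And>t. t0 \<le> t \<Longrightarrow> t \<le> S \<Longrightarrow> r \<le> D (\<chi>' t) \<and> D (\<chi>' t) \<le> dX \<and> lamQ (\<chi>' t) < 0"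
      using ej[OF max' a(1,2) t0T eR(1) eps(3) r(2) ex' D0 l0 a(3)] by blast
    have dS: "\<delta> < dQ (\<psi> S)" using dQchi[of S] S t0 \<delta> by simp
    have rad: "- \<kappa> < radial \<phi>" if "\<phi> \<in> phase_space" "dQ \<phi> \<le> \<delta>" for \<phi>
    proof -
      have "\<bar>radial \<phi>\<bar> \<le> Cd * dQ \<phi>" using loc'[OF that(1)] that(2) \<delta> by auto
      also have "\<dots> \<le> Cd * (\<kappa> / (2 * Cd))" using that(2) \<delta> c by (intro mult_left_mono) auto
      also have "\<dots> = \<kappa> / 2" using c by simp
      finally show ?thesis using c by linarith
    qed
    have vir: "0 < gap \<phi> \<and> virial \<phi> \<le> 0" if "\<phi> \<in> phase_space" "\<delta> \<le> dQ \<phi>" "0 \<le> gap \<phi>" "excess \<phi> \<le> \<epsilon>\<^sup>2" for \<phi>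
      using ov[OF that] eR eps by simp
    have S0: "0 < S" using S t0 by simp
    note ic = inward_collision[where E = "\<epsilon>\<^sup>2" and \<kappa> = \<kappa>, OF max S0 S(2) _ c(3) _ ex dS S(4,5)[unfolded \<chi>'_def ss(2,3)]]
    have coll1: "\<delta> \<le> dQ (\<psi> t) \<and> 0 < gap (\<psi> t)" if "S \<le> t" "ereal t < T" for t
      by (rule ic(1)) (use rad vir that in blast)+
    have coll2: "T < \<infinity>"
      by (rule ic(2)) (use rad vir in blast)+
    have coll3: "((\<lambda>t. (\<psi> t $ 1, \<psi> t $ 2)) \<longlongrightarrow> (0, 0)) (at_left (real_of_ereal T))"
      by (rule ic(3)) (use rad vir in blast)+
    \<comment> \<open>Up to \<open>S\<close> the sign is read off from
      \<open>\<lambda>\<^sub>1\<close>, where uniqueness identifies \<sigma> as the nearest sign;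
      after \<open>S\<close> it follows from the position in the disc by
      \<open>outer_sign\<close>.\<close>
    have fin: "sign_fun \<alpha> F chi \<delta>E (\<psi> t) = -1 \<and> r \<le> dQ (\<psi> t)" if t: "t0 \<le> t" "ereal t < T" for t
    proof (cases "t \<le> S")
      case True
      note s = S(6)[OF t(1) True]
      have e: "dQ (\<psi> t) = D (\<chi>' t)" using dQchi[of t] t t0(2) s by simp
      have ps: "\<psi> t \<in> phase_space" using in_phase_space[of t] t t0(2) by simp
      have "dQ (\<psi> t) \<le> \<delta>E" using e s c by linarith
      from nearest_sign[OF ps this] obtain \<tau> where \<tau>: "sign_fun \<alpha> F chi \<delta>E (\<psi> t) = sign0 (lamQ (\<tau> *\<^sub>R \<psi> t))"
        "\<And>\<tau>'. \<tau>' \<in> {1, -1} \<Longrightarrow> dQ (\<psi> t) = D (\<tau>' *\<^sub>R \<psi> t) \<Longrightarrow> \<tau>' = \<tau>" by metis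
      have "\<sigma> = \<tau>" using \<tau>(2)[OF \<sigma>(1)] e by (simp add: \<chi>'_def)
      then show ?thesis using \<tau>(1) s e by (simp add: \<chi>'_def sign0_def)
    next
      case False
      then have St: "S \<le> t" by simp
      have o: "\<delta> \<le> dQ (\<psi> t)" "0 < gap (\<psi> t)" using coll1[OF St t(2)] by auto
      have tt: "0 \<le> t" using St S0 by simp
      have "excess (\<psi> t) \<le> \<epsilon>\<^sup>2" using excess_const[OF tt t(2)] ex by simp
      then have "sign_fun \<alpha> F chi \<delta>E (\<psi> t) = -1" using os[OF in_phase_space[OF tt t(2)] o] eR(1) eps(2) by blast
      then show ?thesis using o r by simp
    qed
    show "T < \<infinity>" by (rule coll2)
    show "((\<lambda>t. (\<psi> t $ 1, \<psi> t $ 2)) \<longlongrightarrow> (0, 0)) (at_left (real_of_ereal T))" by (rule coll3)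
    fix t assume "real_of_ereal (T_trap dQ R \<psi> T) \<le> t" "ereal t < T"
    then show "sign_fun \<alpha> F chi \<delta>E (\<psi> t) = -1" "R + R\<^sup>2 \<le> dQ (\<psi> t)"
      using fin[of t] t0(1) by (simp_all add: r_def)
  qed
qed

end

theorem theorem4:
  fixes \<alpha> \<delta>E :: real and F :: frame and chi :: "real \<Rightarrow> real"
  assumes "2 \<le> \<alpha>"
    and "is_frame \<alpha> F"
    and "is_cutoff chi"
    and "is_delta_E \<alpha> F chi \<delta>E"
  shows "\<exists>R0. 0 < R0 \<and> R0 < 1 \<and> (\<forall>R_star. 0 < R_star \<and> R_star \<le> R0 \<longrightarrow>
    (\<exists>\<epsilon>0. 0 < \<epsilon>0 \<and> \<epsilon>0 < R_star \<and> (\<forall>\<epsilon>_star. 0 < \<epsilon>_star \<and> \<epsilon>_star \<le> \<epsilon>0 \<longrightarrow>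
      (\<forall>\<psi> T_max \<epsilon> R.
        is_maximal_solution \<alpha> \<psi> T_max \<and>
        0 < \<epsilon> \<and> \<epsilon> \<le> \<epsilon>_star \<and> 2 * \<epsilon> < R \<and> R \<le> R_star \<and>
        energy \<alpha> (\<psi> 0) < E_star \<alpha> + \<epsilon>\<^sup>2 \<and>
        d_Q \<alpha> F chi \<delta>E (\<psi> 0) < R \<longrightarrow>
        (let Tt = T_trap (d_Q \<alpha> F chi \<delta>E) R \<psi> T_max;
             t0 = real_of_ereal Tt
         in
          (Tt = T_max \<longrightarrow>
            (\<forall>t. 0 \<le> t \<and> ereal t < T_max \<longrightarrow> d_Q \<alpha> F chi \<delta>E (\<psi> t) < R + R\<^sup>2) \<and>
            T_max = \<infinity>) \<and>
          (Tt < T_max \<and> sign_fun \<alpha> F chi \<delta>E (\<psi> t0) = -1 \<longrightarrow>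
            (\<forall>t. t0 \<le> t \<and> ereal t < T_max \<longrightarrow>
              sign_fun \<alpha> F chi \<delta>E (\<psi> t) = sign_fun \<alpha> F chi \<delta>E (\<psi> t0) \<and>
              R + R\<^sup>2 \<le> d_Q \<alpha> F chi \<delta>E (\<psi> t)) \<and>
            T_max < \<infinity> \<and>
            ((\<lambda>t. (\<psi> t $ 1, \<psi> t $ 2)) \<longlongrightarrow> (0, 0)) (at_left (real_of_ereal T_max))))))))"
proof -
  interpret hill_distance \<alpha> F chi \<delta>E by unfold_locales (fact assms)+
  obtain R0 where R0: "0 < R0" "R0 < 1" and main: "\<And>\<psi> T \<epsilon> R.
    is_maximal_solution \<alpha> \<psi> T \<and> 0 < \<epsilon> \<and> 2 * \<epsilon> < R \<and> R \<le> R0 \<and> energy \<alpha> (\<psi> 0) < E_star \<alpha> + \<epsilon>\<^sup>2 \<and> dQ (\<psi> 0) < R \<Longrightarrow>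
    (T_trap dQ R \<psi> T = T \<longrightarrow>
      (\<forall>t. 0 \<le> t \<and> ereal t < T \<longrightarrow> dQ (\<psi> t) < R + R\<^sup>2) \<and> T = \<infinity>) \<and>
    (T_trap dQ R \<psi> T < T \<and> sign_fun \<alpha> F chi \<delta>E (\<psi> (real_of_ereal (T_trap dQ R \<psi> T))) = -1 \<longrightarrow>
      (\<forall>t. real_of_ereal (T_trap dQ R \<psi> T) \<le> t \<and> ereal t < T \<longrightarrow>
        sign_fun \<alpha> F chi \<delta>E (\<psi> t) = -1 \<and> R + R\<^sup>2 \<le> dQ (\<psi> t)) \<and>
      T < \<infinity> \<and> ((\<lambda>t. (\<psi> t $ 1, \<psi> t $ 2)) \<longlongrightarrow> (0, 0)) (at_left (real_of_ereal T)))"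
    using trapping_or_collision by blast
  show ?thesis
  proof (rule exI[of _ R0], intro conjI R0 allI impI, goal_cases)
    case R: (1 R_star)
    show ?case
    \<comment> \<open>\<open>trapping_or_collision\<close> takes its bound on \<epsilon> from
      \<open>2 * \<epsilon> < R \<le> R0\<close>, so half of \<open>R_star\<close> is a convenient
      witness.\<close>
    proof (rule exI[of _ "R_star / 2"], intro conjI allI impI, goal_cases)
      case h: (3 \<epsilon>_star \<psi> T_max \<epsilon> R)
      have "is_maximal_solution \<alpha> \<psi> T_max \<and> 0 < \<epsilon> \<and> 2 * \<epsilon> < R \<and> R \<le> R0 \<and>
        energy \<alpha> (\<psi> 0) < E_star \<alpha> + \<epsilon>\<^sup>2 \<and> dQ (\<psi> 0) < R"
        using h R by auto
      note main[OF this]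
      then show ?case unfolding Let_def by presburger
    qed (use R in simp_all)
  qed
qed

end
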